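(* Given $q\in(1,\infty)$, $\delta>0$ and $D_0\in\mathbb{N}$, there are $\varepsilon>0$ and $D\ge D_0$ such that the following holds for all sufficiently large $\ell\in\mathbb{N}$. Let $m=\ell D$ and let $\mu,\nu$ be $2^{-m}$-measures with $\|\mu*\nu\|_q\ge2^{-\varepsilon m}\|\mu\|_q$ (convolution on $\mathbb{R}/\mathbb{Z}$). Then, after translating $\mu$ and $\nu$ (each by some number of the form $k2^{-m}$, on the circle), there exist sets $A\subset\operatorname{supp}\mu$, $B\subset\operatorname{supp}\nu$ such that: (A-i) $\|\mu|_A\|_q\ge2^{-\delta m}\|\mu\|_q$; (A-ii) $\mu(y)\le2\mu(x)$ for all $x,y\in A$; (A-iii) there is a sequence $(R'_s)_{s\in[\ell]}$ with $\mathcal{N}_{(s+1)D}(A\cap I)=R'_s$ for all $s\in[\ell]$ and all $I\in\mathcal{D}_{sD}(A)$; (A-iv) $x\in\frac12\mathcal{D}_{sD}(x)$ for all $x\in A$, $s\in[\ell]$; (B-i) $\nu(B)\ge2^{-\delta m}$; (B-ii) $\nu(y)\le2\nu(x)$ for all $x,y\in B$; (B-iii) there is a sequence $(R''_s)_{s\in[\ell]}$ with $\mathcal{N}_{(s+1)D}(B\cap I)=R''_s$ for all $s\in[\ell]$ and all $I\in\mathcal{D}_{sD}(B)$; (B-iv) $y\in\frac12\mathcal{D}_{sD}(y)$ for all $y\in B$, $s\in[\ell]$. Moreover: (v) for each $s\in[\ell]$, either $R''_s=1$ or $R'_s\ge2^{(1-\delta)D}$; and (vi) if $\mathcal{S}$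 is the set of $s\in[\ell]$ with $R'_s\ge 2^{(1-\delta)D}$, then \[ \log(\|\nu\|_q^{-q'})-\delta m\le D|\mathcal{S}|\le\log(\|\mu\|_q^{-q'})+\delta m. \]
   Context: Logarithms base 2. $[\ell]=\{0,1,\dots,\ell-1\}$. A $2^{-m}$-measure is a probability measure supported on $2^{-m}\mathbb{Z}\cap[0,1)$, identified with points of $\mathbb{R}/\mathbb{Z}$. For a purely atomic measure $\mu$, $\|\mu\|_q=(\sum_y\mu(y)^q)^{1/q}$; $q'=q/(q-1)$. $\mathcal{D}_s$ is the family of dyadic intervals $[j2^{-s},(j+1)2^{-s})$; $\mathcal{D}_s(E)$ is the set of those meeting $E$; $\mathcal{N}_s(E)=|\mathcal{D}_s(E)|$; $\mathcal{D}_s(x)$ is the element of $\mathcal{D}_s$ containing $x$; $\frac12I$ is the interval with the same center as $I$ and half its length. $\mu|_A$ is the restriction of $\mu$ to $A$. *)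

theory Defs
  imports Complex_Main
begin

text \<open>Support of a purely atomic measure given by its mass function.\<close>
definition supp :: "(real \<Rightarrow> real) \<Rightarrow> real set" where
  "supp \<mu> = {x. \<mu> x \<noteq> 0}"

definition grid :: "nat \<Rightarrow> real set" where
  "grid m = {real j / 2 ^ m | j. j < (2::nat) ^ m}"

definition dyadic_measure :: "nat \<Rightarrow> (real \<Rightarrow> real) \<Rightarrow> bool" where
  "dyadic_measure m \<mu> \<longleftrightarrow> (\<forall>x. 0 \<le> \<mu> x) \<and> supp \<mu> \<subseteq> grid m \<and> (\<Sum>x\<in>grid m. \<mu> x) = 1"

definition mass :: "(real \<Rightarrow> real) \<Rightarrow> real set \<Rightarrow> real" where
  "mass \<mu> A = (\<Sum>x\<in>A \<inter> supp \<mu>. \<mu> x)"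

definition qnorm :: "real \<Rightarrow> (real \<Rightarrow> real) \<Rightarrow> real" where
  "qnorm q \<mu> = (\<Sum>x\<in>supp \<mu>. \<mu> x powr q) powr (1 / q)"

definition conj_exp :: "real \<Rightarrow> real" where
  "conj_exp q = q / (q - 1)"

definition restr :: "(real \<Rightarrow> real) \<Rightarrow> real set \<Rightarrow> (real \<Rightarrow> real)" where
  "restr \<mu> A = (\<lambda>x. if x \<in> A then \<mu> x else 0)"

text \<open>Convolution on \<open>\<real>/\<int>\<close>, points represented in [0,1).\<close>
definition conv :: "(real \<Rightarrow> real) \<Rightarrow> (real \<Rightarrow> real) \<Rightarrow> (real \<Rightarrow> real)" where
  "conv \<mu> \<nu> = (\<lambda>z. \<Sum>x\<in>supp \<mu>. \<Sum>y\<in>supp \<nu>. if frac (x + y) = z then \<mu> x * \<nu> y else 0)"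

definition translate :: "real \<Rightarrow> (real \<Rightarrow> real) \<Rightarrow> (real \<Rightarrow> real)" where
  "translate t \<mu> = (\<lambda>x. if 0 \<le> x \<and> x < 1 then \<mu> (frac (x - t)) else 0)"

definition dyadic_interval :: "nat \<Rightarrow> int \<Rightarrow> real set" where
  "dyadic_interval s j = {y. real_of_int j / 2 ^ s \<le> y \<and> y < (real_of_int j + 1) / 2 ^ s}"

definition dyadic_family :: "nat \<Rightarrow> real set set" where
  "dyadic_family s = range (dyadic_interval s)"

definition dyadic_cover :: "nat \<Rightarrow> real set \<Rightarrow> real set set" where
  "dyadic_cover s E = {I \<in> dyadic_family s. I \<inter> E \<noteq> {}}"

definition covering_number :: "nat \<Rightarrow> real set \<Rightarrow> nat" where
  "covering_number s E = card (dyadic_cover s E)"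

definition dyadic_of :: "nat \<Rightarrow> real \<Rightarrow> real set" where
  "dyadic_of s x = dyadic_interval s \<lfloor>2 ^ s * x\<rfloor>"

text \<open>\<open>\<frac>12 I\<close> for a half-open interval \<open>I=[a,b)\<close>: same center, half length, again half-open.\<close>
definition half_interval :: "real set \<Rightarrow> real set" where
  "half_interval I = {y. (3 * Inf I + Sup I) / 4 \<le> y \<and> y < (Inf I + 3 * Sup I) / 4}"

end

(* Restricting \<mu> and \<nu> to level sets A0, B0 and using that the L^q norm of 1_A0 * 1_B0 is nearly
   maximal, one gets an L^2 energy |1_A0 * 1_B|^2 >= 2^(-small m) |A0| |B|^2 for a subset B of B0 that is
   a regular tree with respect to base b = 2^D and whose points stay in the central halves of their
   intervals.  The operator f \<mapsto> f * 1_B * 1_(-B) is positive, so by Cauchy--Schwarz the correlation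
   <f * (1_B * 1_(-B))^(2^j), f>, f = 1_A0, is still at least 2^(-small m) of its maximum.  As \<epsilon> may
   depend on the number of steps, no Balog--Szemeredi--Gowers argument is needed.

   Where B branches at some level, a long random walk with steps in B is spread out over the next M
   coarser levels (Littlewood--Offord), with deviations of comparable order (Chernoff).  Hence, for a
   regular A in A0, the walk started on A is spread over |A| times the product of b/R'_s over the
   coarser neighbours s of the branching levels; as it returns to A0 with probability 2^(-small m),
   A is nearly full at almost all of these levels.  At the few remaining branching levels of B
   one child of each node is kept, which costs little mass. *)
theory Submission
  imports Defs "HOL-Library.FuncSet" "HOL-Real_Asymp.Real_Asymp"
begin

section \<open>Regular trees of digits\<close>


text \<open>The walk length \<open>n = 2 ^ Suc j\<close> enters the exponent of the energy loss
  \<open>r\<close>, so it must be fixed before \<epsilon> and must not grow with the number of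
  levels. Yet spreading out at one level takes a group of \<open>b ^ (2 * M)\<close> variables of
  its own, which would make \<open>n\<close> proportional to the height. The levels are therefore
  cut into blocks of \<open>P = M * M\<close> levels, and all blocks use the same \<open>n\<close>
  variables: once the digits of a block are fixed, the digits below it form a problem of the same
  shape, and the only interaction is a carry with at most \<open>2 * n + 3\<close> values. In each
  block at most \<open>2 * M\<close> branching levels stay uncontrolled and a factor of about
  \<open>b ^ (4 * M)\<close> is lost, both a proportion of order \<open>1 / M\<close> of what the
  block contains. Central points matter because points in different nodes of a level then differ by
  at least half the node length, and anticoncentration needs such a lower bound on the steps. The
  parameters are chosen in the order \<delta>, \<eta>, \<open>M\<close>, \<open>D\<close>,
  \<open>n\<close>, \<epsilon>, and last the number of levels.\<close>

text \<open>Digits are indexed from the least significant one: \<open>\<rho> k\<close> counts the choices of digit \<open>k\<close> given the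
  higher digits, so for base \<open>2 ^ D\<close> it corresponds to the paper's \<open>R\<^sub>s\<close> with \<open>s = h - 1 - k\<close>.\<close>

definition reg :: "int \<Rightarrow> nat \<Rightarrow> (nat \<Rightarrow> nat) \<Rightarrow> int set \<Rightarrow> bool" where
  "reg b h \<rho> X \<longleftrightarrow> X \<subseteq> {0..<b ^ h} \<and> X \<noteq> {} \<and>
     (\<forall>k<h. \<forall>x\<in>X. card ((\<lambda>y. y div b ^ k) ` {y \<in> X. y div b ^ Suc k = x div b ^ Suc k}) = \<rho> k)"

text \<open>The residue modulo \<open>b ^ Suc k\<close> is the position inside the node of that
  length. The condition is thus membership in the half-open middle half of every node containing
  \<open>x\<close>, from level 1 up to the root \<open>[0, b ^ h)\<close>; level 0 imposes
  nothing.\<close>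

definition central :: "int \<Rightarrow> nat \<Rightarrow> int \<Rightarrow> bool" where
  "central b h x \<longleftrightarrow> (\<forall>k<h. b ^ Suc k \<le> 4 * (x mod b ^ Suc k) \<and> 4 * (x mod b ^ Suc k) < 3 * b ^ Suc k)"

lemma reg_finite: "reg b h \<rho> X \<Longrightarrow> finite X"
  unfolding reg_def using finite_subset by blast

lemma div_div_pow: "b > 0 \<Longrightarrow> (x::int) div b ^ h div b ^ k = x div b ^ (k + h)"
  by (simp add: zdiv_zmult2_eq power_add mult.commute)

lemma int_div_less:
  assumes "0 < c" "x < p * c"
  shows "(x::int) div c < p"
  using assms by (metis mult_right_mono div_mult_mod_eq le_add_same_cancel1 leD leI less_imp_le order_trans pos_mod_sign)

text \<open>Discarding the \<open>h\<close> lowest digits only relabels nodes: a node of level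
  \<open>k\<close> in the quotient is a node of level \<open>k + h\<close> of \<open>X\<close>, with
  the same children.\<close>

lemma reg_top:
  assumes "b > 0" "reg b (p + h) \<rho> X"
  shows "reg b p (\<lambda>k. \<rho> (k + h)) ((\<lambda>x. x div b ^ h) ` X)"
  unfolding reg_def
proof (intro conjI allI impI ballI)
  show "(\<lambda>x. x div b ^ h) ` X \<subseteq> {0..<b ^ p}"
  proof clarify
    fix x assume "x \<in> X"
    then have "0 \<le> x" "x < b ^ p * b ^ h" using assms(2) by (auto simp: reg_def power_add)
    then show "x div b ^ h \<in> {0..<b ^ p}"
      using assms(1) int_div_less[of "b ^ h" x "b ^ p"] by (simp add: pos_imp_zdiv_nonneg_iff)
  qed
  show "(\<lambda>x. x div b ^ h) ` X \<noteq> {}" using assms by (auto simp: reg_def)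
  fix k y assume k: "k < p" and "y \<in> (\<lambda>x. x div b ^ h) ` X"
  then obtain x where x: "x \<in> X" "y = x div b ^ h" by auto
  have e: "(\<lambda>y. y div b ^ k) ` {y \<in> (\<lambda>x. x div b ^ h) ` X. y div b ^ Suc k = x div b ^ h div b ^ Suc k}
     = (\<lambda>y. y div b ^ (k + h)) ` {y \<in> X. y div b ^ Suc (k + h) = x div b ^ Suc (k + h)}"
  proof -
    have "{y \<in> (\<lambda>x. x div b ^ h) ` X. y div b ^ Suc k = x div b ^ h div b ^ Suc k}
      = (\<lambda>x. x div b ^ h) ` {y \<in> X. y div b ^ Suc (k + h) = x div b ^ Suc (k + h)}"
      using div_div_pow[OF assms(1), of _ h "Suc k"] by (auto simp del: power_Suc)
    then show ?thesis using div_div_pow[OF assms(1)] by (simp add: image_image del: power_Suc)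
  qed
  show "card ((\<lambda>y. y div b ^ k) ` {z \<in> (\<lambda>x. x div b ^ h) ` X. z div b ^ Suc k = y div b ^ Suc k}) = \<rho> (k + h)"
    unfolding x(2) e using assms(2) x(1) k by (auto simp: reg_def simp del: power_Suc)
qed

lemma mod_div_pow:
  assumes "b > 0" "k \<le> h"
  shows "(x::int) mod b ^ h div b ^ k = x div b ^ k - b ^ (h - k) * (x div b ^ h)"
proof -
  have e: "b ^ h = b ^ k * b ^ (h - k)" using assms by (simp flip: power_add)
  have "x mod b ^ h = x + b ^ k * (- (b ^ (h - k) * (x div b ^ h)))"
    by (simp add: minus_div_mult_eq_mod[symmetric] e mult_ac)
  then show ?thesis using assms(1)
    by (metis (no_types, lifting) add.commute div_mult_self2 order_less_irrefl power_eq_0_iff uminus_add_conv_diff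
        diff_conv_add_uminus zero_less_power)
qed

text \<open>The children of a node of level at most \<open>h\<close> all lie below the same node of
  level \<open>h\<close>, so moving that node to the origin changes no branching number. Together
  with \<open>reg_top\<close> this cuts a tree into an upper and a lower block.\<close>

lemma reg_sub:
  assumes "b > 0" "reg b (p + h) \<rho> X" "x0 \<in> X"
  shows "reg b h \<rho> ((\<lambda>x. x mod b ^ h) ` {x \<in> X. x div b ^ h = x0 div b ^ h})"
  unfolding reg_def
proof (intro conjI allI impI ballI)
  let ?F = "{x \<in> X. x div b ^ h = x0 div b ^ h}"
  show "(\<lambda>x. x mod b ^ h) ` ?F \<subseteq> {0..<b ^ h}" using assms by auto
  show "(\<lambda>x. x mod b ^ h) ` ?F \<noteq> {}" using assms by auto
  fix k y assume k: "k < h" and "y \<in> (\<lambda>x. x mod b ^ h) ` ?F"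
  then obtain x where x: "x \<in> X" "x div b ^ h = x0 div b ^ h" "y = x mod b ^ h" by auto
  let ?c = "b ^ (h - k) * (x0 div b ^ h)"
  let ?G = "{z \<in> X. z div b ^ Suc k = x div b ^ Suc k}"
  have sub: "z div b ^ h = x0 div b ^ h" if "z div b ^ Suc k = x div b ^ Suc k" for z
    using div_div_pow[OF assms(1), of z "Suc k" "h - Suc k"] div_div_pow[OF assms(1), of x "Suc k" "h - Suc k"]
      that x(2) k by (simp del: power_Suc)
  have "{z \<in> (\<lambda>x. x mod b ^ h) ` ?F. z div b ^ Suc k = y div b ^ Suc k} = (\<lambda>x. x mod b ^ h) ` ?G"
    using k x sub by (auto simp: image_iff mod_div_pow[OF assms(1)] simp del: power_Suc)
  then have "(\<lambda>z. z div b ^ k) ` {z \<in> (\<lambda>x. x mod b ^ h) ` ?F. z div b ^ Suc k = y div b ^ Suc k}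
    = (\<lambda>z. z - ?c) ` ((\<lambda>z. z div b ^ k) ` ?G)"
    unfolding image_image using k sub
    by (auto simp: mod_div_pow[OF assms(1)] image_iff simp del: power_Suc)
  moreover have "inj_on (\<lambda>z. z - ?c) ((\<lambda>z. z div b ^ k) ` ?G)" by (auto simp: inj_on_def)
  ultimately show "card ((\<lambda>z. z div b ^ k) ` {z \<in> (\<lambda>x. x mod b ^ h) ` ?F. z div b ^ Suc k = y div b ^ Suc k}) = \<rho> k"
    using assms(2) x(1) k by (simp add: card_image reg_def del: power_Suc)
qed

lemma card_fibres:
  assumes "finite X" "\<And>y. y \<in> f ` X \<Longrightarrow> card {x \<in> X. f x = y} = c"
  shows "card X = c * card (f ` X)"
proof -
  have "card X = (\<Sum>y\<in>f ` X. card {x \<in> X. f x = y})"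
    using sum.image_gen[OF assms(1), of "\<lambda>_. 1::nat" f] by simp
  then show ?thesis using assms(2) by simp
qed

lemma reg_card:
  assumes "b > 0" "reg b h \<rho> X"
  shows "card X = (\<Prod>k<h. \<rho> k)"
  using assms(2)
proof (induction h arbitrary: \<rho> X)
  case 0
  then have "X \<subseteq> {0}" "X \<noteq> {}" by (auto simp: reg_def)
  then have "X = {0}" by blast
  then show ?case by simp
next
  case (Suc h)
  have t: "reg b h (\<lambda>k. \<rho> (k + 1)) ((\<lambda>x. x div b ^ 1) ` X)"
    using reg_top[OF assms(1), of h 1 \<rho> X] Suc.prems by simp
  have "card X = \<rho> 0 * card ((\<lambda>x. x div b ^ 1) ` X)"
  proof (rule card_fibres)
    show "finite X" using Suc.prems by (rule reg_finite)
    fix y assume "y \<in> (\<lambda>x. x div b ^ 1) ` X"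
    then show "card {x \<in> X. x div b ^ 1 = y} = \<rho> 0"
      using Suc.prems by (auto simp: reg_def)
  qed
  also have "\<dots> = \<rho> 0 * (\<Prod>k<h. \<rho> (k + 1))" using Suc.IH[OF t] by simp
  finally show ?case by (simp add: prod.lessThan_Suc_shift del: prod.lessThan_Suc)
qed

lemma mod_inj_on_fibre: "inj_on (\<lambda>x::int. x mod c) {x \<in> X. x div c = y}"
  unfolding inj_on_def using div_mult_mod_eq by (metis (mono_tags, lifting) mem_Collect_eq)

lemma reg_card_fibre:
  assumes "b > 0" "reg b (p + h) \<rho> X" "x0 \<in> X"
  shows "card {x \<in> X. x div b ^ h = x0 div b ^ h} = (\<Prod>k<h. \<rho> k)"
  using reg_card[OF assms(1) reg_sub[OF assms]] by (simp add: card_image mod_inj_on_fibre)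

lemma reg_pos:
  assumes "b > 0" "reg b h \<rho> X" "k < h"
  shows "\<rho> k \<ge> 1"
proof -
  obtain x where x: "x \<in> X" using assms(2) by (auto simp: reg_def)
  have "finite ((\<lambda>y. y div b ^ k) ` {y \<in> X. y div b ^ Suc k = x div b ^ Suc k})"
    using reg_finite[OF assms(2)] by auto
  moreover have "x div b ^ k \<in> (\<lambda>y. y div b ^ k) ` {y \<in> X. y div b ^ Suc k = x div b ^ Suc k}"
    using x by auto
  ultimately have "card ((\<lambda>y. y div b ^ k) ` {y \<in> X. y div b ^ Suc k = x div b ^ Suc k}) > 0"
    using card_gt_0_iff by blast
  then show ?thesis using assms x by (simp add: reg_def del: power_Suc)
qed

lemma reg_le:
  assumes "b > 0" "reg b h \<rho> X" "k < h"
  shows "int (\<rho> k) \<le> b"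
proof -
  obtain x where x: "x \<in> X" using assms(2) by (auto simp: reg_def)
  let ?S = "(\<lambda>y. y div b ^ k) ` {y \<in> X. y div b ^ Suc k = x div b ^ Suc k}"
  have sub: "?S \<subseteq> {b * (x div b ^ Suc k)..<b * (x div b ^ Suc k) + b}"
  proof clarify
    fix y assume y: "y div b ^ Suc k = x div b ^ Suc k"
    have "y div b ^ k div b = x div b ^ Suc k"
      using div_div_pow[OF assms(1), of y k 1] y by simp
    then show "y div b ^ k \<in> {b * (x div b ^ Suc k)..<b * (x div b ^ Suc k) + b}"
      using assms(1) by (metis atLeastLessThan_iff div_mult_mod_eq mult.commute add_left_mono add_strict_left_mono
          add.right_neutral pos_mod_bound pos_mod_sign)
  qed
  have "card ?S \<le> nat b" using card_mono[OF _ sub] by simp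
  then have "int (card ?S) \<le> b" using assms(1) by linarith
  then show ?thesis using assms x by (simp add: reg_def del: power_Suc)
qed

text \<open>Trees are built from the top: below every point of \<open>Z\<close> exactly
  \<open>r\<close> children are kept. As \<open>r \<ge> 1\<close>, no point of \<open>Z\<close>
  disappears, so the branching numbers of the higher digits survive unchanged.\<close>

lemma reg_extend:
  assumes "b > 0" "reg b h \<rho> Z" "X \<subseteq> {0..<b ^ Suc h}" "r \<ge> 1"
    "\<And>z. z \<in> Z \<Longrightarrow> r \<le> card {x \<in> X. x div b = z}"
  shows "\<exists>Y\<subseteq>X. reg b (Suc h) (case_nat r \<rho>) Y \<and> card Y = r * card Z"
proof -
  have fX: "finite X" using assms(3) finite_subset by blast
  have "\<forall>z\<in>Z. \<exists>Y. Y \<subseteq> {x \<in> X. x div b = z} \<and> card Y = r"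
    using assms(5) by (meson obtain_subset_with_card_n)
  then obtain f where f: "\<And>z. z \<in> Z \<Longrightarrow> f z \<subseteq> {x \<in> X. x div b = z}" "\<And>z. z \<in> Z \<Longrightarrow> card (f z) = r"
    by metis
  define Y where "Y = (\<Union>z\<in>Z. f z)"
  have YX: "Y \<subseteq> X" using f unfolding Y_def by auto
  have fib: "{y \<in> Y. y div b = z} = f z" if "z \<in> Z" for z
    using f(1) that unfolding Y_def by fastforce
  have Yd: "(\<lambda>y. y div b) ` Y = Z"
  proof
    show "(\<lambda>y. y div b) ` Y \<subseteq> Z" using f(1) unfolding Y_def by fastforce
    show "Z \<subseteq> (\<lambda>y. y div b) ` Y"
    proof
      fix z assume z: "z \<in> Z"
      then have "f z \<noteq> {}" using f(2)[OF z] assms(4) by auto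
      then obtain y where "y \<in> f z" by auto
      then have "y \<in> Y" "z = y div b" using f(1)[OF z] z unfolding Y_def by auto
      then show "z \<in> (\<lambda>y. y div b) ` Y" by blast
    qed
  qed
  have cY: "card Y = r * card Z"
    using card_fibres[of Y "\<lambda>y. y div b" r] fib f(2) finite_subset[OF YX fX] Yd by simp
  have "reg b (Suc h) (case_nat r \<rho>) Y"
    unfolding reg_def
  proof (intro conjI allI impI ballI)
    show "Y \<subseteq> {0..<b ^ Suc h}" using YX assms(3) by simp
    show "Y \<noteq> {}" using Yd assms(2) by (auto simp: reg_def)
    fix k x assume k: "k < Suc h" and x: "x \<in> Y"
    show "card ((\<lambda>y. y div b ^ k) ` {y \<in> Y. y div b ^ Suc k = x div b ^ Suc k}) = (case k of 0 \<Rightarrow> r | Suc n \<Rightarrow> \<rho> n)"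
    proof (cases k)
      case 0
      have "x div b \<in> Z" using Yd x by blast
      then show ?thesis using 0 fib f(2) by simp
    next
      case (Suc j)
      have dd: "y div b div b ^ i = y div b ^ Suc i" for y i
        using div_div_pow[OF assms(1), of y 1 i] by simp
      have "(\<lambda>y. y div b ^ k) ` {y \<in> Y. y div b ^ Suc k = x div b ^ Suc k}
        = (\<lambda>y. y div b ^ j) ` {y \<in> Z. y div b ^ Suc j = x div b div b ^ Suc j}"
      proof -
        have "{y \<in> Z. y div b ^ Suc j = x div b div b ^ Suc j} = (\<lambda>y. y div b) ` {y \<in> Y. y div b ^ Suc k = x div b ^ Suc k}"
          unfolding Yd[symmetric] Suc using dd by (auto simp del: power_Suc)
        then show ?thesis using dd Suc by (simp add: image_image del: power_Suc)
      qed
      then show ?thesis using assms(2) Yd x k Suc by (auto simp: reg_def simp del: power_Suc)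
    qed
  qed
  then show ?thesis using YX cY by blast
qed

text \<open>Used at the very end to impose smaller branching numbers, for instance a single child at
  levels that have to be switched off.\<close>

lemma reg_thin:
  assumes "b > 0" "reg b h \<rho> X" "\<And>k. k < h \<Longrightarrow> 1 \<le> \<tau> k \<and> \<tau> k \<le> \<rho> k"
  shows "\<exists>Y\<subseteq>X. reg b h \<tau> Y"
  using assms(2,3)
proof (induction h arbitrary: \<rho> \<tau> X)
  case 0
  then show ?case by (auto simp: reg_def)
next
  case (Suc h)
  have t: "reg b h (\<lambda>k. \<rho> (Suc k)) ((\<lambda>x. x div b) ` X)"
    using reg_top[OF assms(1), of h 1 \<rho> X] Suc.prems by simp
  obtain Z where Z: "Z \<subseteq> (\<lambda>x. x div b) ` X" "reg b h (\<lambda>k. \<tau> (Suc k)) Z"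
    using Suc.IH[OF t, of "\<lambda>k. \<tau> (Suc k)"] Suc.prems(2) by auto
  have "\<exists>Y\<subseteq>X. reg b (Suc h) (case_nat (\<tau> 0) (\<lambda>k. \<tau> (Suc k))) Y \<and> card Y = \<tau> 0 * card Z"
  proof (rule reg_extend[OF assms(1) Z(2)])
    show "X \<subseteq> {0..<b ^ Suc h}" using Suc.prems by (simp add: reg_def)
    show "\<tau> 0 \<ge> 1" using Suc.prems by simp
    fix z assume "z \<in> Z"
    then obtain x where "x \<in> X" "z = x div b" using Z by auto
    then have "card {y \<in> X. y div b = z} = \<rho> 0" using Suc.prems(1) by (auto simp: reg_def)
    then show "\<tau> 0 \<le> card {x \<in> X. x div b = z}" using Suc.prems by simp
  qed
  moreover have "case_nat (\<tau> 0) (\<lambda>k. \<tau> (Suc k)) = \<tau>" by (auto split: nat.split)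
  ultimately show ?case by auto
qed

text \<open>Pigeonhole from the lowest digit upwards. Parents are grouped by the dyadic size
  \<open>2 ^ i\<close>, \<open>i \<le> D\<close>, of their number of children. One group carries a
  share \<open>1 / (D + 1)\<close> of the points, and trimming its fibres to exactly
  \<open>2 ^ i\<close> children costs at most another factor 2.\<close>

lemma reg_uniformize:
  assumes "D \<ge> 1" "X \<subseteq> {0..<(2 ^ D) ^ h}" "X \<noteq> {}"
  shows "\<exists>Y\<subseteq>X. \<exists>\<rho>. reg (2 ^ D) h \<rho> Y \<and> card X \<le> (2 * (D + 1)) ^ h * card Y"
  using assms(2,3)
proof (induction h arbitrary: X)
  case 0
  then have "reg (2 ^ D) 0 (\<lambda>_. 0) X" by (auto simp: reg_def)
  then show ?case by auto
next
  case (Suc h)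
  define b :: int where "b = 2 ^ D"
  have b: "b > 0" by (simp add: b_def)
  have fX: "finite X" using Suc.prems finite_subset by blast
  define N where "N = (\<lambda>x. x div b) ` X"
  define c where "c z = card {x \<in> X. x div b = z}" for z
  have c1: "c z \<ge> 1" if "z \<in> N" for z
    using that fX unfolding c_def N_def by (auto simp: Suc_le_eq card_gt_0_iff)
  have "\<exists>j. 2 ^ j \<le> c z \<and> c z < 2 ^ (j + 1)" if "z \<in> N" for z
    using ex_power_ivl1[of 2 "c z"] c1[OF that] by simp
  then obtain j where j: "\<And>z. z \<in> N \<Longrightarrow> 2 ^ j z \<le> c z \<and> c z < 2 ^ (j z + 1)" by metis
  have jD: "j z \<le> D" if z: "z \<in> N" for z
  proof -
    have "{x \<in> X. x div b = z} \<subseteq> {b * z..<b * z + b}"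
    proof clarify
      fix x show "x \<in> {b * (x div b)..<b * (x div b) + b}"
        using b pos_mod_bound[OF b, of x] pos_mod_sign[OF b, of x] mult_div_mod_eq[of b x] by (auto; linarith)
    qed
    then have "c z \<le> nat b" using card_mono[of "{b * z..<b * z + b}"] unfolding c_def by fastforce
    then have "c z \<le> 2 ^ D" by (simp add: b_def nat_power_eq)
    then have "(2::nat) ^ j z \<le> 2 ^ D" using j[OF z] by linarith
    then show ?thesis by simp
  qed
  have fN: "finite N" using fX by (simp add: N_def)
  have Nne: "N \<noteq> {}" using Suc.prems by (simp add: N_def)
  have "card X = (\<Sum>z\<in>N. c z)"
    using sum.image_gen[OF fX, of "\<lambda>_. 1::nat" "\<lambda>x. x div b"] by (simp add: N_def c_def)
  also have "\<dots> = (\<Sum>i\<le>D. \<Sum>z\<in>{z\<in>N. j z = i}. c z)"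
    using sum.group[OF fN, of "{..D}" j c] jD by (simp add: image_subset_iff)
  finally have cX: "card X = (\<Sum>i\<le>D. \<Sum>z\<in>{z\<in>N. j z = i}. c z)" .
  have "\<exists>i\<le>D. card X \<le> (D + 1) * (\<Sum>z\<in>{z\<in>N. j z = i}. c z)"
  proof (rule ccontr)
    assume "\<not> ?thesis"
    then have *: "\<And>i. i \<in> {..D} \<Longrightarrow> (D + 1) * (\<Sum>z\<in>{z\<in>N. j z = i}. c z) < card X" by auto
    have "(\<Sum>i\<le>D. (D + 1) * (\<Sum>z\<in>{z\<in>N. j z = i}. c z)) < (\<Sum>i\<le>D. card X)"
      using * by (intro sum_strict_mono) auto
    then show False unfolding sum_distrib_left[symmetric] cX[symmetric] by simp
  qed
  then obtain i where i: "i \<le> D" "card X \<le> (D + 1) * (\<Sum>z\<in>{z\<in>N. j z = i}. c z)" by blast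
  define N' where "N' = {z\<in>N. j z = i}"
  have "(\<Sum>z\<in>N'. c z) \<le> (\<Sum>z\<in>N'. 2 ^ (i + 1))"
    using j by (intro sum_mono) (auto simp: N'_def less_imp_le)
  then have le: "card X \<le> (D + 1) * (2 ^ (i + 1) * card N')"
    using i(2) unfolding N'_def[symmetric] by (simp add: mult.commute) (meson le_trans mult_le_mono2 add_le_mono)
  have "card X > 0" using fX Suc.prems by (simp add: card_gt_0_iff)
  then have "N' \<noteq> {}" using le by auto
  moreover have "N' \<subseteq> {0..<(2 ^ D) ^ h}"
  proof
    fix z assume "z \<in> N'"
    then obtain x where x: "x \<in> X" "z = x div b" by (auto simp: N'_def N_def)
    then have "0 \<le> x" "x < b ^ h * b" using Suc.prems(1) by (auto simp: b_def mult.commute)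
    then show "z \<in> {0..<(2 ^ D) ^ h}"
      using int_div_less[OF b] b x(2) by (simp add: pos_imp_zdiv_nonneg_iff b_def[symmetric])
  qed
  ultimately obtain Z \<rho> where Z: "Z \<subseteq> N'" "reg (2 ^ D) h \<rho> Z" "card N' \<le> (2 * (D + 1)) ^ h * card Z"
    using Suc.IH[of N'] by blast
  have "\<exists>Y\<subseteq>X. reg b (Suc h) (case_nat (2 ^ i) \<rho>) Y \<and> card Y = 2 ^ i * card Z"
  proof (rule reg_extend[OF b])
    show "reg b h \<rho> Z" using Z by (simp add: b_def)
    show "X \<subseteq> {0..<b ^ Suc h}" using Suc.prems by (simp add: b_def)
    show "1 \<le> (2::nat) ^ i" by simp
    fix z assume "z \<in> Z"
    then show "2 ^ i \<le> card {x \<in> X. x div b = z}"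
      using Z(1) j[of z] by (auto simp: N'_def c_def)
  qed
  then obtain Y where Y: "Y \<subseteq> X" "reg b (Suc h) (case_nat (2 ^ i) \<rho>) Y" "card Y = 2 ^ i * card Z" by blast
  have "card X \<le> (D + 1) * (2 ^ (i + 1) * ((2 * (D + 1)) ^ h * card Z))"
    using le Z(3) by (meson le_trans mult_le_mono2)
  also have "\<dots> = (2 * (D + 1)) ^ Suc h * card Y" by (simp add: Y(3) algebra_simps)
  finally show ?case using Y unfolding b_def by blast
qed

section \<open>Anticoncentration and tails of signed subset sums\<close>


text \<open>Induction by deleting one ground element. For each \<open>x\<close> the members of
  \<open>F\<close> avoiding \<open>x\<close> form an antichain in \<open>G - {x}\<close>. Summing
  these inequalities over \<open>x\<close> counts each \<open>S\<close> exactly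
  \<open>card G - card S\<close> times, and this weight converts the smaller binomial coefficient
  into the larger one. If \<open>G\<close> itself belongs to \<open>F\<close>, it is the only
  member, which is treated apart.\<close>

lemma LYM:
  assumes "finite G" "F \<subseteq> Pow G" "\<And>S T. S \<in> F \<Longrightarrow> T \<in> F \<Longrightarrow> \<not> S \<subset> T"
  shows "(\<Sum>S\<in>F. 1 / real (card G choose card S)) \<le> 1"
  using assms
proof (induction "card G" arbitrary: G F)
  case 0
  have "G = {}" using 0 by (metis card_0_eq)
  moreover have "F \<subseteq> Pow G" by fact
  ultimately have "F \<subseteq> {{}}" by (metis Pow_empty)
  then have "F = {} \<or> F = {{}}" by (rule subset_singletonD)
  then show ?case by (elim disjE) simp_all
next
  case (Suc n)
  have fF: "finite F" using Suc.prems(1,2) by (metis finite_Pow_iff finite_subset)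
  have fS: "finite S" if "S \<in> F" for S using that Suc.prems(1,2) by (meson PowD finite_subset subsetD)
  show ?case
  proof (cases "G \<in> F")
    case True
    have "S = G" if "S \<in> F" for S
      using Suc.prems(2) Suc.prems(3)[OF that True] that by auto
    then have "F = {G}" using True by blast
    then show ?thesis by simp
  next
    case False
    define Fx where "Fx x = {S \<in> F. x \<notin> S}" for x
    have IH: "(\<Sum>S\<in>Fx x. 1 / real (n choose card S)) \<le> 1" if "x \<in> G" for x
    proof -
      have c: "n = card (G - {x})" using Suc.hyps(2) that Suc.prems(1) by simp
      show ?thesis
      proof (subst c, rule Suc.hyps(1)[OF c])
        show "finite (G - {x})" using Suc.prems(1) by simp
        show "Fx x \<subseteq> Pow (G - {x})" using Suc.prems(2) by (auto simp: Fx_def)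
        show "\<not> S \<subset> T" if "S \<in> Fx x" "T \<in> Fx x" for S T
          using Suc.prems(3)[of S T] that by (simp add: Fx_def)
      qed
    qed
    have t: "(real (Suc n) - card S) * (1 / real (n choose card S)) = real (Suc n) * (1 / real (Suc n choose card S))"
      if "S \<in> F" for S
    proof -
      have "S \<subset> G" using that False Suc.prems(2) by blast
      then have "card S < Suc n" using Suc.hyps(2) Suc.prems(1) psubset_card_mono by metis
      then have l: "card S \<le> n" by simp
      have e: "(Suc n - card S) * (Suc n choose card S) = Suc n * (n choose card S)"
        using binomial_absorb_comp[of "Suc n" "card S"] by simp
      have "(real (Suc n) - card S) * real (Suc n choose card S) = real (Suc n) * real (n choose card S)"
        using arg_cong[OF e, of real] l
        unfolding of_nat_mult by (simp only: of_nat_diff[OF le_SucI[OF l]])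
      moreover have "real (n choose card S) > 0" "real (Suc n choose card S) > 0" using l by simp_all
      ultimately show ?thesis by (simp add: field_simps del: binomial_Suc_Suc of_nat_Suc)
    qed
    have "real (Suc n) * (\<Sum>S\<in>F. 1 / real (Suc n choose card S))
        = (\<Sum>S\<in>F. (real (Suc n) - card S) * (1 / real (n choose card S)))"
      unfolding sum_distrib_left using t by (intro sum.cong) auto
    also have "\<dots> = (\<Sum>S\<in>F. \<Sum>x\<in>G. if x \<notin> S then 1 / real (n choose card S) else 0)"
    proof (intro sum.cong refl)
      fix S assume S: "S \<in> F"
      then have "S \<subseteq> G" using Suc.prems(2) by blast
      have "(\<Sum>x\<in>G. if x \<notin> S then 1 / real (n choose card S) else 0) = real (card (G - S)) * (1 / real (n choose card S))"
        using Suc.prems(1) by (simp add: sum.If_cases Collect_neg_eq[symmetric] Diff_eq Int_def Compl_eq)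
      also have "real (card (G - S)) = real (Suc n) - card S"
        using \<open>S \<subseteq> G\<close> Suc.hyps(2) Suc.prems(1) fS[OF S] by (simp add: card_Diff_subset of_nat_diff card_mono)
      finally show "(real (Suc n) - card S) * (1 / real (n choose card S)) = (\<Sum>x\<in>G. if x \<notin> S then 1 / real (n choose card S) else 0)" by simp
    qed
    also have "\<dots> = (\<Sum>x\<in>G. \<Sum>S\<in>F. if x \<notin> S then 1 / real (n choose card S) else 0)" by (rule sum.swap)
    also have "\<dots> = (\<Sum>x\<in>G. \<Sum>S\<in>Fx x. 1 / real (n choose card S))"
      unfolding Fx_def by (simp add: sum.inter_filter[OF fF])
    also have "\<dots> \<le> (\<Sum>x\<in>G. 1)" using IH by (intro sum_mono) auto
    also have "\<dots> = real (Suc n)" using Suc.hyps(2) by simp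
    finally show ?thesis using Suc.hyps(2) by (simp del: of_nat_Suc)
  qed
qed

text \<open>The induction needs the stronger bound with \<open>2 * r + 1\<close> under the root:
  passing from \<open>r\<close> to \<open>r + 1\<close> multiplies the squared quantity by
  \<open>4 * (2 * r + 1) * (2 * r + 3) / (r + 1)^2\<close>, which is below 16.\<close>

lemma central_binomial_upper: "real (2 * r choose r) * sqrt (2 * real r) \<le> 2 ^ (2 * r)"
proof -
  have "(real (2 * r choose r))\<^sup>2 * (2 * real r + 1) \<le> 16 ^ r"
  proof (induction r)
    case (Suc r)
    have e1: "Suc r * (Suc (Suc (2*r)) choose Suc r) = (Suc (Suc (2*r))) * (Suc (2*r) choose r)"
      using binomial_absorption[of r "Suc (Suc (2*r))"] by (simp del: binomial_Suc_Suc)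
    have e2: "Suc r * (Suc (2*r) choose r) = (Suc (2*r)) * (2 * r choose r)"
      using binomial_absorb_comp[of "Suc (2*r)" r] by simp
    have x1: "real (Suc (Suc (2*r)) choose Suc r) = 2 * real (Suc (2*r) choose r)"
    proof -
      have "(real r + 1) * real (Suc (Suc (2*r)) choose Suc r) = (real r + 1) * (2 * real (Suc (2*r) choose r))"
        using arg_cong[OF e1, of real] unfolding of_nat_mult by (simp add: algebra_simps del: binomial_Suc_Suc)
      then show ?thesis by (simp del: binomial_Suc_Suc)
    qed
    have x2: "real (Suc (2*r) choose r) = (2*real r+1) * real (2 * r choose r) / (real r + 1)"
      using arg_cong[OF e2, of real] by (simp add: field_simps del: binomial_Suc_Suc)
    have alg: "(2 * (u * x / v))\<^sup>2 * w = (x\<^sup>2 * u) * (4 * u * w / v\<^sup>2)" for u v w x :: real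
      by (simp add: power2_eq_square)
    have "(real (2 * Suc r choose Suc r))\<^sup>2 * (2 * real (Suc r) + 1)
       = (2 * ((2 * real r + 1) * real (2 * r choose r) / (real r + 1)))\<^sup>2 * (2 * real r + 3)"
      using x1 unfolding x2 by (simp add: algebra_simps del: binomial_Suc_Suc)
    also have "\<dots> = ((real (2 * r choose r))\<^sup>2 * (2 * real r + 1)) * (4 * (2 * real r + 1) * (2 * real r + 3) / (real r + 1)\<^sup>2)"
      by (rule alg)
    also have "\<dots> \<le> 16 ^ r * 16"
    proof (rule mult_mono)
      show "4 * (2 * real r + 1) * (2 * real r + 3) / (real r + 1)\<^sup>2 \<le> 16"
      proof (subst pos_divide_le_eq)
        show "0 < (real r + 1)\<^sup>2" by (rule zero_less_power) simp
      qed (simp add: power2_eq_square algebra_simps)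
    qed (use Suc in auto)
    finally show ?case by simp
  qed auto
  moreover have "(real (2 * r choose r))\<^sup>2 * (2 * real r) \<le> (real (2 * r choose r))\<^sup>2 * (2 * real r + 1)"
    by (intro mult_left_mono) auto
  ultimately have "(real (2 * r choose r))\<^sup>2 * (2 * real r) \<le> 16 ^ r" by linarith
  then have "(real (2 * r choose r) * sqrt (2 * real r))\<^sup>2 \<le> (2 ^ (2 * r))\<^sup>2"
  proof -
    have "((2::real) ^ (2 * r))\<^sup>2 = 2 ^ (4 * r)" by (simp add: power_mult[symmetric] mult.commute)
    also have "\<dots> = 16 ^ r" by (simp add: power_mult)
    finally show ?thesis using \<open>(real (2 * r choose r))\<^sup>2 * (2 * real r) \<le> 16 ^ r\<close>
      by (simp add: power_mult_distrib)
  qed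
  then show ?thesis by (rule power2_le_imp_le) simp
qed

text \<open>The argument of Erdos for the Littlewood-Offord problem: adding an index raises the sum
  by at least \<open>\<Delta>\<close>, so the sets with sum in a half-open window of length
  \<open>\<Delta>\<close> form an antichain, and a central binomial coefficient bounds its
  size.\<close>

lemma subset_sum_anticoncentration:
  fixes d :: "'i \<Rightarrow> real"
  assumes "finite G" "even (card G)" "card G > 0" "0 < \<Delta>" "\<And>i. i \<in> G \<Longrightarrow> \<Delta> \<le> d i"
  shows "real (card {S. S \<subseteq> G \<and> x \<le> sum d S \<and> sum d S < x + \<Delta>}) * sqrt (card G) \<le> 2 ^ card G"
proof -
  define F where "F = {S. S \<subseteq> G \<and> x \<le> sum d S \<and> sum d S < x + \<Delta>}"
  have anti: "\<not> S \<subset> T" if S: "S \<in> F" and T: "T \<in> F" for S T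
  proof
    assume st: "S \<subset> T"
    then obtain i where i: "i \<in> T" "i \<notin> S" by blast
    have fT: "finite T" using T assms(1) finite_subset unfolding F_def by blast
    have "sum d S + \<Delta> \<le> sum d S + d i" using assms(5) i T by (auto simp: F_def)
    also have "\<dots> = sum d (insert i S)" using i st fT finite_subset[of S T] by (simp add: psubset_imp_subset)
    also have "\<dots> \<le> sum d T"
      using st i T assms(4,5) by (intro sum_mono2[OF fT]) (auto simp: F_def, smt (verit, best) subsetD)
    finally show False using S T by (auto simp: F_def)
  qed
  obtain r where r: "card G = 2 * r" using assms(2) by blast
  let ?C = "real (2 * r choose r)"
  have C: "?C > 0" by simp
  have "real (card F) / ?C = (\<Sum>S\<in>F. 1 / ?C)" by simp
  also have "\<dots> \<le> (\<Sum>S\<in>F. 1 / real (card G choose card S))"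
  proof (intro sum_mono)
    fix S assume "S \<in> F"
    then have "card S \<le> card G" using assms(1) by (auto simp: F_def card_mono)
    moreover have "card G choose card S \<le> 2 * r choose r" using binomial_maximum' r by simp
    ultimately show "1 / ?C \<le> 1 / real (card G choose card S)"
      by (intro divide_left_mono) auto
  qed
  also have "\<dots> \<le> 1" using LYM[OF assms(1), of F] anti by (auto simp: F_def)
  finally have "real (card F) \<le> ?C" using C by (simp add: divide_simps)
  then have "real (card F) * sqrt (card G) \<le> ?C * sqrt (card G)" by (intro mult_right_mono) auto
  also have "\<dots> \<le> 2 ^ card G" using central_binomial_upper[of r] r by simp
  finally show ?thesis by (simp add: F_def)
qed

text \<open>Symmetric difference with the negative indices reduces to positive steps.\<close>

lemma signed_sum_anticoncentration:
  fixes d :: "'i \<Rightarrow> real"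
  assumes "finite G" "even (card G)" "card G > 0" "0 < \<Delta>" "\<And>i. i \<in> G \<Longrightarrow> \<Delta> \<le> \<bar>d i\<bar>"
  shows "real (card {S. S \<subseteq> G \<and> x \<le> sum d S \<and> sum d S < x + \<Delta>}) * sqrt (card G) \<le> 2 ^ card G"
proof -
  define Ng where "Ng = {i \<in> G. d i < 0}"
  define c where "c = sum d Ng"
  have key: "sum (\<lambda>i. \<bar>d i\<bar>) (sym_diff S Ng) = sum d S - c" if "S \<subseteq> G" for S
  proof -
    have f: "finite S" "finite Ng" using that assms(1) finite_subset by (auto simp: Ng_def)
    have "sum (\<lambda>i. \<bar>d i\<bar>) (sym_diff S Ng) = sum (\<lambda>i. \<bar>d i\<bar>) (S - Ng) + sum (\<lambda>i. \<bar>d i\<bar>) (Ng - S)"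
      using f by (intro sum.union_disjoint) auto
    also have "sum (\<lambda>i. \<bar>d i\<bar>) (S - Ng) = sum d (S - Ng)"
      using that by (intro sum.cong) (auto simp: Ng_def)
    also have "sum (\<lambda>i. \<bar>d i\<bar>) (Ng - S) = - sum d (Ng - S)"
      unfolding sum_negf[symmetric] by (intro sum.cong) (auto simp: Ng_def)
    also have "sum d (S - Ng) = sum d S - sum d (S \<inter> Ng)" using f by (metis add_diff_cancel_left' sum.Int_Diff)
    also have "sum d (Ng - S) = c - sum d (S \<inter> Ng)" using f
      by (metis add_diff_cancel_left' sum.Int_Diff Int_commute c_def)
    finally show ?thesis by simp
  qed
  have "card {S. S \<subseteq> G \<and> x \<le> sum d S \<and> sum d S < x + \<Delta>}
      \<le> card {S. S \<subseteq> G \<and> x - c \<le> sum (\<lambda>i. \<bar>d i\<bar>) S \<and> sum (\<lambda>i. \<bar>d i\<bar>) S < x - c + \<Delta>}"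
  proof (rule card_inj_on_le)
    show "inj_on (\<lambda>S. sym_diff S Ng) {S. S \<subseteq> G \<and> x \<le> sum d S \<and> sum d S < x + \<Delta>}"
      by (rule inj_onI) blast
    show "(\<lambda>S. sym_diff S Ng) ` {S. S \<subseteq> G \<and> x \<le> sum d S \<and> sum d S < x + \<Delta>} \<subseteq>
       {S. S \<subseteq> G \<and> x - c \<le> sum (\<lambda>i. \<bar>d i\<bar>) S \<and> sum (\<lambda>i. \<bar>d i\<bar>) S < x - c + \<Delta>}"
      using key by (auto simp: Ng_def)
    show "finite {S. S \<subseteq> G \<and> x - c \<le> sum (\<lambda>i. \<bar>d i\<bar>) S \<and> sum (\<lambda>i. \<bar>d i\<bar>) S < x - c + \<Delta>}"
      using assms(1) by simp
  qed
  then have "real (card {S. S \<subseteq> G \<and> x \<le> sum d S \<and> sum d S < x + \<Delta>}) * sqrt (card G)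
    \<le> real (card {S. S \<subseteq> G \<and> x - c \<le> sum (\<lambda>i. \<bar>d i\<bar>) S \<and> sum (\<lambda>i. \<bar>d i\<bar>) S < x - c + \<Delta>}) * sqrt (card G)"
    by (intro mult_right_mono) auto
  also have "\<dots> \<le> 2 ^ card G"
    using assms by (intro subset_sum_anticoncentration) auto
  finally show ?thesis .
qed

text \<open>Centring at the mean over uniformly random subsets makes each index contribute a
  symmetric sign times \<open>d i / 2\<close>, as the two-sided tail bound requires.\<close>

definition csum :: "('i \<Rightarrow> real) \<Rightarrow> 'i set \<Rightarrow> 'i set \<Rightarrow> real" where
  "csum d G S = sum d S - sum d G / 2"

lemma csum_anticoncentration:
  fixes d :: "'i \<Rightarrow> real"
  assumes "finite G" "even (card G)" "card G > 0" "0 < \<Delta>" "\<And>i. i \<in> G \<Longrightarrow> \<Delta> \<le> \<bar>d i\<bar>" "r \<ge> 0"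
  shows "real (card {S. S \<subseteq> G \<and> \<bar>csum d G S - x\<bar> \<le> r}) * sqrt (card G) \<le> (2 * r / \<Delta> + 1) * 2 ^ card G"
proof -
  \<comment> \<open>The closed window of length \<open>2 * r\<close> is covered by
    \<open>m + 1\<close> consecutive half-open windows of length \<open>\<Delta>\<close>, starting
    from its left end, which is \<open>c\<close> in terms of the uncentred sum.\<close>
  define m where "m = nat \<lfloor>2 * r / \<Delta>\<rfloor>"
  define c where "c = x - r + sum d G / 2"
  have m: "real m \<le> 2 * r / \<Delta>" "2 * r / \<Delta> < real m + 1"
    using assms(4,6) unfolding m_def by (simp_all add: of_nat_nat)
  let ?P = "\<lambda>j. {S. S \<subseteq> G \<and> c + real j * \<Delta> \<le> sum d S \<and> sum d S < c + real j * \<Delta> + \<Delta>}"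
  have "{S. S \<subseteq> G \<and> \<bar>csum d G S - x\<bar> \<le> r} \<subseteq> (\<Union>j\<le>m. ?P j)"
  proof clarify
    fix S assume S: "S \<subseteq> G" "\<bar>csum d G S - x\<bar> \<le> r"
    define j where "j = nat \<lfloor>(sum d S - c) / \<Delta>\<rfloor>"
    have 0: "0 \<le> (sum d S - c) / \<Delta>" "(sum d S - c) / \<Delta> \<le> 2 * r / \<Delta>"
      using S(2) assms(4) by (auto simp: csum_def c_def abs_le_iff divide_right_mono)
    have j: "real j \<le> (sum d S - c) / \<Delta>" "(sum d S - c) / \<Delta> < real j + 1"
      using 0 unfolding j_def by (simp_all add: of_nat_nat)
    then have "j \<le> m" using 0 m by linarith
    moreover have "S \<in> ?P j" using j S assms(4) by (simp add: field_simps)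
    ultimately show "S \<in> (\<Union>j\<le>m. ?P j)" by blast
  qed
  then have "card {S. S \<subseteq> G \<and> \<bar>csum d G S - x\<bar> \<le> r} \<le> card (\<Union>j\<le>m. ?P j)"
    using assms(1) by (intro card_mono) auto
  also have "\<dots> \<le> (\<Sum>j\<le>m. card (?P j))" by (rule card_UN_le) simp
  finally have "real (card {S. S \<subseteq> G \<and> \<bar>csum d G S - x\<bar> \<le> r}) \<le> (\<Sum>j\<le>m. real (card (?P j)))"
    unfolding of_nat_sum[symmetric] by (rule of_nat_mono)
  then have "real (card {S. S \<subseteq> G \<and> \<bar>csum d G S - x\<bar> \<le> r}) * sqrt (card G) \<le> (\<Sum>j\<le>m. real (card (?P j)) * sqrt (card G))"
    unfolding sum_distrib_right[symmetric] by (rule mult_right_mono) simp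
  also have "\<dots> \<le> (\<Sum>j\<le>m. 2 ^ card G)"
    by (intro sum_mono signed_sum_anticoncentration assms) auto
  also have "\<dots> = (real m + 1) * 2 ^ card G" by simp
  also have "\<dots> \<le> (2 * r / \<Delta> + 1) * 2 ^ card G" using m by (intro mult_right_mono) auto
  finally show ?thesis .
qed

section \<open>Exponential moments and tails of centred subset sums\<close>

lemma cosh_le_exp_sq: "(exp x + exp (- x)) / 2 \<le> exp (x\<^sup>2 / 2)" for x :: real
proof -
  have pos: "cosh x \<le> exp (x\<^sup>2 / 2)" if "x \<ge> 0" for x :: real
  proof -
    define f where "f = (\<lambda>x::real. x\<^sup>2 / 2 - ln (cosh x))"
    have "f 0 \<le> f x"
    proof (rule DERIV_nonneg_imp_nondecreasing[OF that])
      fix y :: real assume y: "0 \<le> y" "y \<le> x"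
      have d: "(f has_real_derivative (y - sinh y / cosh y)) (at y)"
        unfolding f_def by (auto intro!: derivative_eq_intros simp: cosh_real_pos)
      \<comment> \<open>This yields \<open>y - tanh y \<ge> 0\<close>. It follows by differentiating
        once more, since \<open>y * cosh y - sinh y\<close> has derivative
        \<open>y * sinh y\<close>.\<close>
      have "sinh 0 - 0 * cosh 0 \<le> (y::real) * cosh y - sinh y"
      proof -
        define g where "g = (\<lambda>y::real. y * cosh y - sinh y)"
        have "g 0 \<le> g y"
        proof (rule DERIV_nonneg_imp_nondecreasing[OF y(1)])
          fix z :: real assume z: "0 \<le> z" "z \<le> y"
          have "(g has_real_derivative (z * sinh z)) (at z)"
            unfolding g_def by (auto intro!: derivative_eq_intros)
          moreover have "z * sinh z \<ge> 0" using z by simp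
          ultimately show "\<exists>l. (g has_real_derivative l) (at z) \<and> 0 \<le> l" by blast
        qed
        then show ?thesis by (simp add: g_def)
      qed
      then have "y - sinh y / cosh y \<ge> 0" using cosh_real_pos[of y] by (simp add: field_simps)
      with d show "\<exists>l. (f has_real_derivative l) (at y) \<and> 0 \<le> l" by blast
    qed
    then have "ln (cosh x) \<le> x\<^sup>2 / 2" by (simp add: f_def)
    then show ?thesis using cosh_real_pos[of x] by (metis exp_le_cancel_iff exp_ln)
  qed
  have "cosh x \<le> exp (x\<^sup>2 / 2)" using pos[of x] pos[of "-x"] by (cases "x \<ge> 0") auto
  then show ?thesis by (simp add: cosh_field_def)
qed

lemma csum_exp_moment:
  fixes t L :: real and d :: "'i \<Rightarrow> real"
  assumes "finite G" "\<And>i. i \<in> G \<Longrightarrow> \<bar>d i\<bar> \<le> L"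
  shows "(\<Sum>S\<in>Pow G. exp (t * csum d G S)) \<le> 2 ^ card G * exp (t\<^sup>2 * L\<^sup>2 / 8 * card G)"
proof -
  \<comment> \<open>A chosen index contributes \<open>d i / 2\<close> and an omitted one
    \<open>- d i / 2\<close>, so the moment factorises over \<open>G\<close>.\<close>
  have "(\<Sum>S\<in>Pow G. exp (t * csum d G S)) = (\<Sum>S\<in>Pow G. (\<Prod>i\<in>S. exp (t * d i / 2)) * (\<Prod>i\<in>G - S. exp (- (t * d i / 2))))"
  proof (intro sum.cong refl)
    fix S assume "S \<in> Pow G"
    then have S: "S \<subseteq> G" by simp
    then have fS: "finite S" using assms(1) finite_subset by blast
    have "sum d G = sum d S + sum d (G - S)" using sum.subset_diff[OF S assms(1), of d] by simp
    then have "t * csum d G S = (\<Sum>i\<in>S. t * d i / 2) + (\<Sum>i\<in>G - S. - (t * d i / 2))"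
      by (simp add: csum_def sum_negf sum_divide_distrib[symmetric] sum_distrib_left[symmetric] field_simps)
    then show "exp (t * csum d G S) = (\<Prod>i\<in>S. exp (t * d i / 2)) * (\<Prod>i\<in>G - S. exp (- (t * d i / 2)))"
      using fS assms(1) by (simp add: exp_add exp_sum)
  qed
  also have "\<dots> = (\<Prod>i\<in>G. exp (t * d i / 2) + exp (- (t * d i / 2)))"
    by (rule prod_add[OF assms(1), symmetric])
  also have "\<dots> \<le> (\<Prod>i\<in>G. 2 * exp (t\<^sup>2 * L\<^sup>2 / 8))"
  proof (intro prod_mono conjI)
    fix i assume i: "i \<in> G"
    have "(t * d i / 2)\<^sup>2 / 2 \<le> t\<^sup>2 * L\<^sup>2 / 8"
    proof -
      have "(d i)\<^sup>2 \<le> L\<^sup>2" using power_mono[OF assms(2)[OF i], of 2] by simp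
      then have "t\<^sup>2 * (d i)\<^sup>2 \<le> t\<^sup>2 * L\<^sup>2" by (intro mult_left_mono) auto
      then show ?thesis by (simp add: power_divide power_mult_distrib)
    qed
    then have "exp ((t * d i / 2)\<^sup>2 / 2) \<le> exp (t\<^sup>2 * L\<^sup>2 / 8)" by simp
    from order_trans[OF cosh_le_exp_sq this]
    show "exp (t * d i / 2) + exp (- (t * d i / 2)) \<le> 2 * exp (t\<^sup>2 * L\<^sup>2 / 8)" by simp
  qed (simp add: add_nonneg_nonneg)
  also have "\<dots> = 2 ^ card G * exp (t\<^sup>2 * L\<^sup>2 / 8 * card G)"
    by (simp add: power_mult_distrib exp_of_nat_mult[symmetric] mult.commute)
  finally show ?thesis .
qed

lemma csum_tail:
  fixes K L :: real and d :: "'i \<Rightarrow> real"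
  assumes "finite G" "card G > 0" "L > 0" "\<And>i. i \<in> G \<Longrightarrow> \<bar>d i\<bar> \<le> L" "K > 0"
  shows "real (card {S. S \<subseteq> G \<and> \<bar>csum d G S\<bar> > K * L * sqrt (card G)}) \<le> 2 * exp (- 2 * K\<^sup>2) * 2 ^ card G"
proof -
  let ?B = "{S. S \<subseteq> G \<and> \<bar>csum d G S\<bar> > K * L * sqrt (card G)}"
  define n where "n = real (card G)"
  have n: "n > 0" using assms by (simp add: n_def)
  \<comment> \<open>The minimiser of the Chernoff exponent; it turns the moment exponent into
    \<open>2 * K\<^sup>2\<close> and the threshold into \<open>4 * K\<^sup>2\<close>.\<close>
  define t where "t = 4 * K / (L * sqrt n)"
  have t: "t > 0" using assms n by (simp add: t_def)
  have tl: "t * (K * L * sqrt n) = 4 * K\<^sup>2" using n assms by (simp add: t_def power2_eq_square)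
  have t2: "t\<^sup>2 * L\<^sup>2 / 8 * n = 2 * K\<^sup>2" using n assms by (simp add: t_def power_divide power_mult_distrib)
  have "real (card ?B) * exp (4 * K\<^sup>2) = (\<Sum>S\<in>?B. exp (4 * K\<^sup>2))" by simp
  also have "\<dots> \<le> (\<Sum>S\<in>?B. exp (t * csum d G S) + exp (- t * csum d G S))"
  proof (intro sum_mono)
    fix S assume "S \<in> ?B"
    then have "t * \<bar>csum d G S\<bar> \<ge> t * (K * L * sqrt n)" using t by (auto simp: n_def)
    then have "4 * K\<^sup>2 \<le> t * csum d G S \<or> 4 * K\<^sup>2 \<le> - t * csum d G S" using tl by (auto simp: abs_if split: if_splits)
    then show "exp (4 * K\<^sup>2) \<le> exp (t * csum d G S) + exp (- t * csum d G S)"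
      by (smt (verit) exp_ge_zero exp_le_cancel_iff)
  qed
  also have "\<dots> \<le> (\<Sum>S\<in>Pow G. exp (t * csum d G S) + exp (- t * csum d G S))"
    using assms(1) by (intro sum_mono2) (auto simp: add_nonneg_nonneg)
  also have "\<dots> \<le> 2 * (2 ^ card G * exp (2 * K\<^sup>2))"
    using csum_exp_moment[OF assms(1), of d L t] csum_exp_moment[OF assms(1), of d L "-t"] assms(4) t2
    by (simp add: sum.distrib n_def)
  finally have "real (card ?B) * exp (4 * K\<^sup>2) \<le> 2 * (2 ^ card G * exp (2 * K\<^sup>2))" .
  then have "real (card ?B) * exp (4 * K\<^sup>2) * exp (- (4 * K\<^sup>2)) \<le> 2 * (2 ^ card G * exp (2 * K\<^sup>2)) * exp (- (4 * K\<^sup>2))"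
    by (intro mult_right_mono) auto
  moreover have "exp (2 * K\<^sup>2) * exp (- (4 * K\<^sup>2)) = exp (- 2 * K\<^sup>2)"
    unfolding exp_add[symmetric] by simp
  ultimately show ?thesis by (simp add: mult_exp_exp mult.assoc) (simp add: mult.commute)
qed

section \<open>Digits blurred by spread-out increments\<close>


lemma card_int_interval:
  fixes x r :: real
  assumes "r \<ge> 0"
  shows "real (card {i::int. \<bar>real_of_int i - x\<bar> \<le> r}) \<le> 2 * r + 1" "finite {i::int. \<bar>real_of_int i - x\<bar> \<le> r}"
proof -
  have e: "{i::int. \<bar>real_of_int i - x\<bar> \<le> r} = {\<lceil>x - r\<rceil>..\<lfloor>x + r\<rfloor>}"
    by (auto simp: abs_le_iff ceiling_le_iff le_floor_iff)
  show "finite {i::int. \<bar>real_of_int i - x\<bar> \<le> r}" unfolding e by simp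
  show "real (card {i::int. \<bar>real_of_int i - x\<bar> \<le> r}) \<le> 2 * r + 1"
    unfolding e using assms by (simp add: of_nat_nat) linarith
qed

text \<open>The increments indexed by \<open>k \<in> T\<close> blur the digits of \<open>a\<close> with index in
  \<open>{k + 1..k + M}\<close>, so only these digits remain free once the sum is prescribed.\<close>

lemma smoothing_count:
  fixes b :: int and g :: "nat \<Rightarrow> 'w \<Rightarrow> real" and K :: real
  assumes b: "b \<ge> 2" and K: "K \<ge> 0"
    and "finite T"
    and "\<And>k. k \<in> T \<Longrightarrow> finite (\<Omega> k)"
    and "\<And>k \<omega>. k \<in> T \<Longrightarrow> \<omega> \<in> \<Omega> k \<Longrightarrow> \<bar>g k \<omega>\<bar> \<le> K * b ^ (k + 1 + M)"
    and "\<And>k x. k \<in> T \<Longrightarrow> real (card {\<omega> \<in> \<Omega> k. \<bar>g k \<omega> - x\<bar> \<le> (1 + K * P) * b ^ (k + 1)}) \<le> \<sigma> k"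
    and "\<And>k k'. k \<in> T \<Longrightarrow> k' \<in> T \<Longrightarrow> k < k' \<Longrightarrow> k + M < k'"
    and "card T \<le> P" "\<And>k. k \<in> T \<Longrightarrow> k + 1 + M \<le> h"
    and "reg b h \<rho> A"
  shows "real (card {(a, \<xi>). a \<in> A \<and> \<xi> \<in> PiE T \<Omega> \<and> real_of_int a + (\<Sum>k\<in>T. g k (\<xi> k)) = w})
     \<le> (\<Prod>k\<in>T. (2 * K * P + 2 * K + 5) * \<sigma> k * (\<Prod>i\<in>{k + 1..k + M}. real (\<rho> i)))"
  using assms(3-)
proof (induction T arbitrary: h A w rule: finite_linorder_max_induct)
  case empty
  have "finite A" using reg_finite empty by blast
  have sub: "{(a, \<xi>). a \<in> A \<and> \<xi> \<in> PiE {} \<Omega> \<and> real_of_int a + (\<Sum>k\<in>{}. g k (\<xi> k)) = w} \<subseteq> {(\<lfloor>w\<rfloor>, \<lambda>_. undefined)}"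
    by auto
  show ?case using card_mono[OF _ sub] by simp
next
  case (insert k T)
  let ?S = "\<lambda>T A w. {(a, \<xi>). a \<in> A \<and> \<xi> \<in> PiE T \<Omega> \<and> real_of_int a + (\<Sum>k\<in>T. g k (\<xi> k)) = w}"
  let ?E = "\<Prod>k\<in>T. (2 * K * P + 2 * K + 5) * \<sigma> k * (\<Prod>i\<in>{k + 1..k + M}. real (\<rho> i))"
  have kT: "k \<notin> T" using insert.hyps by blast
  have b0: "b > 0" using b by simp
  have kh: "k + 1 + M \<le> h" using insert.prems by simp
  have fA: "finite A" using reg_finite insert.prems by blast
  have cT: "card T \<le> P" using insert.prems(5) insert.hyps(1) kT by simp
  have f\<Omega>: "finite (PiE T \<Omega>)" "finite (PiE (insert k T) \<Omega>)" using insert.prems(1) insert.hyps(1) by (auto intro!: finite_PiE)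
  \<comment> \<open>\<open>k\<close> is the largest index of the new set. Everything below digit
    \<open>k + 1\<close>, namely \<open>a mod q\<close> and the remaining increments, will have size
    at most \<open>(1 + K * P) * q\<close>.\<close>
  define q where "q = b ^ (k + 1)"
  have q: "q > 0" using b by (simp add: q_def)
  \<comment> \<open>The upper part \<open>y = a div q\<close> and the top increment must hit the
    target up to that error. \<open>A'\<close> records what this forces on \<open>y\<close> alone,
    the increment being at most \<open>K * b ^ (k + 1 + M)\<close> in size.\<close>
  define Q where "Q = {(y, \<omega>). y \<in> (\<lambda>a. a div q) ` A \<and> \<omega> \<in> \<Omega> k \<and> \<bar>w - g k \<omega> - real_of_int y * q\<bar> \<le> (1 + K * P) * q}"
  define A' where "A' = {y \<in> (\<lambda>a. a div q) ` A. \<bar>w - real_of_int y * q\<bar> \<le> (1 + K * P + K) * b ^ (k + 1 + M)}"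
  have qM: "real_of_int (b ^ (k + 1 + M)) = real_of_int q * real_of_int b ^ M" by (simp add: q_def power_add)
  have bM: "real_of_int b ^ M \<ge> 1" using b by simp
  have fQ: "finite Q" unfolding Q_def
    by (rule finite_subset[of _ "(\<lambda>a. a div q) ` A \<times> \<Omega> k"]) (use fA insert.prems(1) in auto)
  have Epos: "?E \<ge> 0"
  proof (intro prod_nonneg ballI mult_nonneg_nonneg)
    fix j assume "j \<in> T"
    then show "0 \<le> \<sigma> j" using insert.prems(3)[of j 0] by (meson insertCI of_nat_0_le_iff order_trans)
  qed (use K in auto)
  \<comment> \<open>Separation by more than \<open>M\<close> keeps the range
    \<open>b ^ (j + 1 + M)\<close> of every lower increment within \<open>q\<close>, and there are
    at most \<open>P\<close> of them.\<close>
  have rest: "\<bar>\<Sum>j\<in>T. g j (\<xi> j)\<bar> \<le> K * P * q" if "\<xi> \<in> PiE (insert k T) \<Omega>" for \<xi>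
  proof -
    have "\<bar>\<Sum>j\<in>T. g j (\<xi> j)\<bar> \<le> (\<Sum>j\<in>T. K * q)"
    proof (rule order_trans[OF sum_abs sum_mono])
      fix j assume j: "j \<in> T"
      then have "j + M < k" using insert.prems(4)[of j k] insert.hyps(2) by auto
      then have "real_of_int b ^ (j + 1 + M) \<le> real_of_int b ^ (k + 1)" using b by (intro power_increasing) auto
      then have "K * b ^ (j + 1 + M) \<le> K * q" using K unfolding q_def by (intro mult_left_mono) auto
      then show "\<bar>g j (\<xi> j)\<bar> \<le> K * q" using insert.prems(2)[of j "\<xi> j"] j that by (smt (verit) PiE_mem insertCI)
    qed
    also have "\<dots> = real (card T) * (K * q)" by simp
    also have "\<dots> \<le> real P * (K * q)" using cT K q by (intro mult_right_mono) auto
    finally show ?thesis by (simp add: mult_ac)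
  qed
  have cover: "?S (insert k T) A w \<subseteq> (\<Union>(y, \<omega>)\<in>Q. {(a, \<xi>) \<in> ?S (insert k T) A w. a div q = y \<and> \<xi> k = \<omega>})"
  proof
    fix p assume p: "p \<in> ?S (insert k T) A w"
    then obtain a \<xi> where pa: "p = (a, \<xi>)" and
      a: "a \<in> A" "\<xi> \<in> PiE (insert k T) \<Omega>" "w = real_of_int a + (\<Sum>k\<in>insert k T. g k (\<xi> k))" by auto
    have "real_of_int a = real_of_int (a div q) * q + real_of_int (a mod q)"
      by (metis div_mult_mod_eq of_int_add of_int_mult)
    then have "w - g k (\<xi> k) - real_of_int (a div q) * q = real_of_int (a mod q) + (\<Sum>k\<in>T. g k (\<xi> k))"
      using a(3) insert.hyps(1) kT by simp
    moreover have "real_of_int (a mod q) \<le> q" "0 \<le> real_of_int (a mod q)" using q by (auto simp: less_imp_le)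
    ultimately have "\<bar>w - g k (\<xi> k) - real_of_int (a div q) * q\<bar> \<le> (1 + K * P) * q"
      using rest[OF a(2)] by (simp add: algebra_simps; linarith?)
    then have "(a div q, \<xi> k) \<in> Q" using a unfolding Q_def by auto
    moreover have "p \<in> {(a, \<xi>) \<in> ?S (insert k T) A w. a div q = fst (a div q, \<xi> k) \<and> \<xi> k = snd (a div q, \<xi> k)}"
      using p pa by auto
    ultimately show "p \<in> (\<Union>(y, \<omega>)\<in>Q. {(a, \<xi>) \<in> ?S (insert k T) A w. a div q = y \<and> \<xi> k = \<omega>})"
      unfolding case_prod_beta pa by (auto intro!: bexI[of _ "(a div q, \<xi> k)"])
  qed
  \<comment> \<open>With the pair fixed, the low digits of \<open>a\<close> range over a single
    fibre, regular of height \<open>k + 1\<close>, and the induction hypothesis applies to it with a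
    shifted target.\<close>
  have piece: "real (card {(a, \<xi>) \<in> ?S (insert k T) A w. a div q = y \<and> \<xi> k = \<omega>}) \<le> ?E" if yQ: "(y, \<omega>) \<in> Q" for y \<omega>
  proof -
    obtain a0 where a0: "a0 \<in> A" "y = a0 div q" using yQ by (auto simp: Q_def)
    let ?B = "(\<lambda>x. x mod q) ` {x \<in> A. x div q = a0 div q}"
    have B: "reg b (k + 1) \<rho> ?B"
      using reg_sub[OF b0, of "h - (k + 1)" "k + 1" \<rho> A a0] insert.prems(7) kh a0 by (simp add: q_def)
    have IH: "real (card (?S T ?B (w - g k \<omega> - real_of_int y * q))) \<le> ?E"
    proof (rule insert.IH[OF _ _ _ _ cT _ B])
      show "j + 1 + M \<le> k + 1" if "j \<in> T" for j
        using insert.prems(4)[of j k] insert.hyps(2) that by auto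
    qed (use insert.prems in auto)
    have "card {(a, \<xi>) \<in> ?S (insert k T) A w. a div q = y \<and> \<xi> k = \<omega>} \<le> card (?S T ?B (w - g k \<omega> - real_of_int y * q))"
    proof (rule card_inj_on_le)
      show "inj_on (\<lambda>(a, \<xi>). (a mod q, restrict \<xi> T)) {(a, \<xi>) \<in> ?S (insert k T) A w. a div q = y \<and> \<xi> k = \<omega>}"
      proof (rule inj_onI, clarify)
        fix a \<xi> a' \<xi>' assume h: "restrict \<xi> T = restrict \<xi>' T" "a mod q = a' mod q" "y = a div q" "\<omega> = \<xi> k"
          "a' div q = a div q" "\<xi>' k = \<xi> k"
          "\<xi> \<in> PiE (insert k T) \<Omega>" "\<xi>' \<in> PiE (insert k T) \<Omega>"
        have "a = a'" using h(2,5) by (metis div_mult_mod_eq)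
        moreover have "\<xi> = \<xi>'"
        proof (rule PiE_ext[OF h(7,8)])
          fix i assume "i \<in> insert k T"
          then show "\<xi> i = \<xi>' i" using h(1,6) by (metis insertE restrict_apply')
        qed
        ultimately show "a = a' \<and> \<xi> = \<xi>'" by simp
      qed
      show "(\<lambda>(a, \<xi>). (a mod q, restrict \<xi> T)) ` {(a, \<xi>) \<in> ?S (insert k T) A w. a div q = y \<and> \<xi> k = \<omega>}
         \<subseteq> ?S T ?B (w - g k \<omega> - real_of_int y * q)"
      proof clarify
        fix a \<xi> assume h: "a \<in> A" "\<xi> \<in> PiE (insert k T) \<Omega>" "w = real_of_int a + (\<Sum>k\<in>insert k T. g k (\<xi> k))" "y = a div q" "\<omega> = \<xi> k"
        have "a mod q \<in> ?B" using h(1,4) a0 by auto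
        moreover have "restrict \<xi> T \<in> PiE T \<Omega>" using h(2) by (auto simp: PiE_iff)
        moreover have "real_of_int a = real_of_int (a div q) * q + real_of_int (a mod q)"
          by (metis div_mult_mod_eq of_int_add of_int_mult)
        ultimately show "a mod q \<in> ?B \<and> restrict \<xi> T \<in> PiE T \<Omega> \<and> real_of_int (a mod q) + (\<Sum>k\<in>T. g k (restrict \<xi> T k))
           = real_of_int a + (\<Sum>k\<in>insert k T. g k (\<xi> k)) - g k (\<xi> k) - real_of_int (a div q) * q"
          using insert.hyps(1) kT by simp
      qed
      show "finite (?S T ?B (w - g k \<omega> - real_of_int y * q))"
        by (rule finite_subset[of _ "?B \<times> PiE T \<Omega>"]) (use fA f\<Omega> in auto)
    qed
    then show ?thesis using IH by linarith
  qed
  have "real (card (?S (insert k T) A w)) \<le> (\<Sum>(y, \<omega>)\<in>Q. real (card {(a, \<xi>) \<in> ?S (insert k T) A w. a div q = y \<and> \<xi> k = \<omega>}))"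
  proof -
    have fin: "finite (?S (insert k T) A w)"
      by (rule finite_subset[of _ "A \<times> PiE (insert k T) \<Omega>"]) (use fA f\<Omega> in auto)
    have "card (?S (insert k T) A w) \<le> card (\<Union>(y, \<omega>)\<in>Q. {(a, \<xi>) \<in> ?S (insert k T) A w. a div q = y \<and> \<xi> k = \<omega>})"
      by (rule card_mono[OF _ cover]) (use fQ fin in \<open>auto intro: finite_subset[OF _ fin]\<close>)
    also have "\<dots> \<le> (\<Sum>(y, \<omega>)\<in>Q. card {(a, \<xi>) \<in> ?S (insert k T) A w. a div q = y \<and> \<xi> k = \<omega>})"
      unfolding case_prod_beta by (rule card_UN_le[OF fQ])
    finally show ?thesis
      by (subst (asm) of_nat_le_iff[where 'a=real, symmetric]) (simp only: of_nat_sum case_prod_unfold)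
  qed
  also have "\<dots> \<le> (\<Sum>(y, \<omega>)\<in>Q. ?E)" using piece by (intro sum_mono) auto
  also have "\<dots> = real (card Q) * ?E" by (simp add: case_prod_beta)
  \<comment> \<open>For given \<open>y\<close> the increment is confined to a window and has at most
    \<open>\<sigma> k\<close> choices, so it remains to count \<open>A'\<close>.\<close>
  also have "\<dots> \<le> ((2 * K * P + 2 * K + 5) * \<sigma> k * (\<Prod>i\<in>{k + 1..k + M}. real (\<rho> i))) * ?E"
  proof (rule mult_right_mono[OF _ Epos])
    have fA': "finite A'" using fA by (simp add: A'_def)
    have "Q \<subseteq> (SIGMA y:A'. {\<omega> \<in> \<Omega> k. \<bar>g k \<omega> - (w - real_of_int y * q)\<bar> \<le> (1 + K * P) * q})"
    proof
      fix p assume "p \<in> Q"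
      then obtain y \<omega> where pe: "p = (y, \<omega>)" and y: "(y, \<omega>) \<in> Q" by (cases p) auto
      have "\<bar>g k \<omega>\<bar> \<le> K * b ^ (k + 1 + M)" using insert.prems(2)[of k \<omega>] y by (auto simp: Q_def)
      moreover have "(1 + K * P) * q \<le> (1 + K * P) * b ^ (k + 1 + M)"
        unfolding qM using bM K q by (intro mult_left_mono) (auto simp: mult_le_cancel_left1)
      moreover have "\<bar>w - g k \<omega> - real_of_int y * q\<bar> \<le> (1 + K * P) * q" using y by (auto simp: Q_def)
      ultimately have "\<bar>w - real_of_int y * q\<bar> \<le> (1 + K * P + K) * b ^ (k + 1 + M)"
        by (simp add: distrib_right; linarith?)
      then have "y \<in> A'" using y by (auto simp: A'_def Q_def)
      moreover have "\<bar>g k \<omega> - (w - real_of_int y * q)\<bar> = \<bar>w - g k \<omega> - real_of_int y * q\<bar>" by linarith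
      ultimately show "p \<in> (SIGMA y:A'. {\<omega> \<in> \<Omega> k. \<bar>g k \<omega> - (w - real_of_int y * q)\<bar> \<le> (1 + K * P) * q})"
        using y unfolding pe by (simp add: Q_def)
    qed
    then have "card Q \<le> (\<Sum>y\<in>A'. card {\<omega> \<in> \<Omega> k. \<bar>g k \<omega> - (w - real_of_int y * q)\<bar> \<le> (1 + K * P) * q})"
      using card_mono[of "SIGMA y:A'. {\<omega> \<in> \<Omega> k. \<bar>g k \<omega> - (w - real_of_int y * q)\<bar> \<le> (1 + K * P) * q}" Q]
        fA' insert.prems(1) by (simp add: card_SigmaI)
    then have "real (card Q) \<le> (\<Sum>y\<in>A'. real (card {\<omega> \<in> \<Omega> k. \<bar>g k \<omega> - (w - real_of_int y * q)\<bar> \<le> (1 + K * P) * q}))"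
      unfolding of_nat_sum[symmetric] by (rule of_nat_mono)
    also have "\<dots> \<le> (\<Sum>y\<in>A'. \<sigma> k)"
      using insert.prems(3)[of k] unfolding q_def by (intro sum_mono) auto
    also have "\<dots> = real (card A') * \<sigma> k" by simp
    also have "\<dots> \<le> ((2 * K * P + 2 * K + 5) * (\<Prod>i\<in>{k + 1..k + M}. real (\<rho> i))) * \<sigma> k"
    proof (rule mult_right_mono)
      show "0 \<le> \<sigma> k" using insert.prems(3)[of k 0] by (meson insertCI of_nat_0_le_iff order_trans)
      \<comment> \<open>Indices of the cells of length \<open>b ^ (k + 1 + M)\<close> that can
        contain \<open>y * q\<close>: there are at most \<open>2 * (2 + K * P + K) + 1\<close> of
        them, the origin of the constant \<open>2 * K * P + 2 * K + 5\<close>. Within one cell only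
        the digits \<open>k + 1\<close> to \<open>k + M\<close> are free.\<close>
      let ?I = "{i::int. \<bar>real_of_int i - w / b ^ (k + 1 + M)\<bar> \<le> 2 + K * P + K}"
      have r0: "0 \<le> 2 + K * P + K" using K by simp
      have sub: "A' \<subseteq> (\<Union>i\<in>?I. {y \<in> (\<lambda>a. a div q) ` A. y div b ^ M = i})"
      proof
        fix y assume y: "y \<in> A'"
        let ?N = "real_of_int (b ^ (k + 1 + M))"
        have N: "?N > 0" using b by simp
        have "real_of_int y = real_of_int (y div b ^ M) * b ^ M + real_of_int (y mod b ^ M)"
          by (metis div_mult_mod_eq of_int_add of_int_mult)
        then have e: "real_of_int y * q = real_of_int (y div b ^ M) * ?N + real_of_int (y mod b ^ M) * q"
          unfolding qM by (simp add: algebra_simps)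
        have "real_of_int (y mod b ^ M) * q \<le> ?N" unfolding qM using q b
          by (subst mult.commute) (intro mult_left_mono, auto simp: less_imp_le simp flip: of_int_power)
        moreover have "0 \<le> real_of_int (y mod b ^ M) * q" using q b by simp
        moreover have "\<bar>w - real_of_int y * q\<bar> \<le> (1 + K * P + K) * ?N" using y by (auto simp: A'_def)
        ultimately have "\<bar>real_of_int (y div b ^ M) * ?N - w\<bar> \<le> (2 + K * P + K) * ?N"
          unfolding e by (simp add: distrib_right; linarith?)
        then have "\<bar>real_of_int (y div b ^ M) * ?N - w\<bar> / ?N \<le> 2 + K * P + K" using N by (simp only: pos_divide_le_eq)
        moreover have "\<bar>real_of_int (y div b ^ M) * ?N - w\<bar> / ?N = \<bar>real_of_int (y div b ^ M) - w / ?N\<bar>"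
        proof -
          have "real_of_int (y div b ^ M) - w / ?N = (real_of_int (y div b ^ M) * ?N - w) / ?N"
            using N by (metis less_irrefl diff_divide_distrib nonzero_mult_div_cancel_right)
          then show ?thesis using N by (simp only: abs_divide abs_of_pos)
        qed
        ultimately have "y div b ^ M \<in> ?I" by simp
        then show "y \<in> (\<Union>i\<in>?I. {y \<in> (\<lambda>a. a div q) ` A. y div b ^ M = i})" using y by (auto simp: A'_def)
      qed
      have top: "reg b (h - (k + 1) - M + M) (\<lambda>i. \<rho> (i + (k + 1))) ((\<lambda>a. a div q) ` A)"
        unfolding q_def using reg_top[OF b0, of "h - (k + 1) - M + M" "k + 1" \<rho> A] insert.prems(7) kh by simp
      have fib: "card {y \<in> (\<lambda>a. a div q) ` A. y div b ^ M = i} \<le> (\<Prod>i\<in>{k + 1..k + M}. \<rho> i)" for i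
      proof (cases "\<exists>y0\<in>(\<lambda>a. a div q) ` A. y0 div b ^ M = i")
        case True
        then obtain y0 where y0: "y0 \<in> (\<lambda>a. a div q) ` A" "y0 div b ^ M = i" by blast
        have "(\<Prod>j<M. \<rho> (j + (k + 1))) = (\<Prod>i\<in>{k + 1..k + M}. \<rho> i)"
          by (rule prod.reindex_bij_witness[of _ "\<lambda>i. i - (k + 1)" "\<lambda>j. j + (k + 1)"]) auto
        then show ?thesis using reg_card_fibre[OF b0 top y0(1)] y0(2) by simp
      next
        case False
        then have "{y \<in> (\<lambda>a. a div q) ` A. y div b ^ M = i} = {}" by blast
        then show ?thesis by (simp only: card.empty le0)
      qed
      have "card A' \<le> card (\<Union>i\<in>?I. {y \<in> (\<lambda>a. a div q) ` A. y div b ^ M = i})"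
        by (rule card_mono[OF _ sub], rule finite_UN_I[OF card_int_interval(2)[OF r0]]) (use fA in simp)
      also have "\<dots> \<le> (\<Sum>i\<in>?I. card {y \<in> (\<lambda>a. a div q) ` A. y div b ^ M = i})"
        by (rule card_UN_le[OF card_int_interval(2)[OF r0]])
      also have "\<dots> \<le> (\<Sum>i\<in>?I. \<Prod>i\<in>{k + 1..k + M}. \<rho> i)" using fib by (intro sum_mono)
      finally have "real (card A') \<le> real (card ?I) * (\<Prod>i\<in>{k + 1..k + M}. real (\<rho> i))"
        by (simp flip: of_nat_prod of_nat_mult)
      also have "\<dots> \<le> (2 * (2 + K * P + K) + 1) * (\<Prod>i\<in>{k + 1..k + M}. real (\<rho> i))"
        using card_int_interval(1)[OF r0] by (intro mult_right_mono prod_nonneg) auto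
      finally show "real (card A') \<le> (2 * K * P + 2 * K + 5) * (\<Prod>i\<in>{k + 1..k + M}. real (\<rho> i))"
        by (simp add: algebra_simps)
    qed
    finally show "real (card Q) \<le> (2 * K * P + 2 * K + 5) * \<sigma> k * (\<Prod>i\<in>{k + 1..k + M}. real (\<rho> i))"
      by (simp add: mult_ac)
  qed
  also have "\<dots> = (\<Prod>k\<in>insert k T. (2 * K * P + 2 * K + 5) * \<sigma> k * (\<Prod>i\<in>{k + 1..k + M}. real (\<rho> i)))"
    using insert.hyps(1) kT by simp
  finally show ?case .
qed

section \<open>Counting solutions in one block of levels\<close>


text \<open>The values of \<open>f\<close> are permuted cyclically, which moves each of them because
  there are at least two; equal fibre sizes allow this permutation to be lifted by bijections
  between fibres.\<close>

lemma ex_fibre_changing_bij: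
  assumes "finite X" "\<And>x. x \<in> X \<Longrightarrow> card {y \<in> X. f y = f x} = c" "card (f ` X) \<ge> 2"
  shows "\<exists>\<phi>. bij_betw \<phi> X X \<and> (\<forall>x\<in>X. f (\<phi> x) \<noteq> f x)"
proof -
  define n where "n = card (f ` X)"
  have n: "n \<ge> 2" using assms by (simp add: n_def)
  obtain e where e: "bij_betw e {0..<n} (f ` X)"
    using ex_bij_betw_nat_finite[of "f ` X"] assms(1) unfolding n_def by blast
  define p where "p y = e ((inv_into {0..<n} e y + 1) mod n)" for y
  have inv: "inv_into {0..<n} e y < n" "e (inv_into {0..<n} e y) = y" if "y \<in> f ` X" for y
    using that e by (metis atLeastLessThan_iff bij_betw_imp_surj_on inv_into_into,
        metis bij_betw_imp_surj_on f_inv_into_f that)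
  have pin: "p y \<in> f ` X" if "y \<in> f ` X" for y
    using e n unfolding p_def by (auto simp: bij_betw_def)
  have eq_iff: "e i = e j \<longleftrightarrow> i = j" if "i < n" "j < n" for i j
    using e that by (auto simp: bij_betw_def inj_on_def)
  have pne: "p y \<noteq> y" if "y \<in> f ` X" for y
  proof
    assume "p y = y"
    then have "(inv_into {0..<n} e y + 1) mod n = inv_into {0..<n} e y"
      using inv[OF that] eq_iff[of "(inv_into {0..<n} e y + 1) mod n" "inv_into {0..<n} e y"] n unfolding p_def by auto
    then show False using inv(1)[OF that] n
      by (metis Suc_eq_plus1 Suc_lessI mod_less mod_self n_not_Suc_n numeral_2_eq_2 le_less_trans not_less_eq_eq zero_less_Suc less_irrefl)
  qed
  have pinj: "y = y'" if y: "y \<in> f ` X" "y' \<in> f ` X" and eq: "p y = p y'" for y y'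
  proof -
    let ?i = "inv_into {0..<n} e y" and ?j = "inv_into {0..<n} e y'"
    have "(?i + 1) mod n = (?j + 1) mod n"
      using eq eq_iff[of "(?i + 1) mod n" "(?j + 1) mod n"] n unfolding p_def by auto
    then have "?i = ?j" using inv(1)[OF y(1)] inv(1)[OF y(2)]
      by (metis Suc_eq_plus1 Suc_lessI mod_less mod_self nat.distinct(1) nat.inject)
    then show ?thesis using inv(2)[OF y(1)] inv(2)[OF y(2)] by metis
  qed
  define F where "F y = {x \<in> X. f x = y}" for y
  have cF: "finite (F y)" "y \<in> f ` X \<Longrightarrow> card (F y) = c" for y
    using assms(1,2) unfolding F_def by auto
  have "\<exists>\<beta>. bij_betw \<beta> (F y) (F (p y))" if "y \<in> f ` X" for y
    using cF(1) cF(2)[OF that] cF(2)[OF pin[OF that]] by (intro finite_same_card_bij) auto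
  then obtain \<beta> where \<beta>: "\<And>y. y \<in> f ` X \<Longrightarrow> bij_betw (\<beta> y) (F y) (F (p y))" by metis
  define \<phi> where "\<phi> x = \<beta> (f x) x" for x
  have \<phi>: "\<phi> x \<in> X" "f (\<phi> x) = p (f x)" if "x \<in> X" for x
  proof -
    have "\<phi> x \<in> F (p (f x))" using \<beta>[of "f x"] that unfolding \<phi>_def bij_betw_def by (auto simp: F_def)
    then show "\<phi> x \<in> X" "f (\<phi> x) = p (f x)" by (auto simp: F_def)
  qed
  have inj: "inj_on \<phi> X"
  proof (rule inj_onI)
    fix x y assume xy: "x \<in> X" "y \<in> X" "\<phi> x = \<phi> y"
    then have "p (f x) = p (f y)" using \<phi>(2) by metis
    then have "f x = f y" using pinj xy by blast
    then show "x = y" using \<beta>[of "f x"] xy unfolding \<phi>_def bij_betw_def F_def by (auto dest: inj_onD)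
  qed
  have "\<phi> ` X \<subseteq> X" using \<phi> by auto
  then have "bij_betw \<phi> X X" using inj endo_inj_surj[OF assms(1)] by (simp add: bij_betw_def)
  moreover have "f (\<phi> x) \<noteq> f x" if "x \<in> X" for x using pne[of "f x"] \<phi>(2)[OF that] that by auto
  ultimately show ?thesis by blast
qed

text \<open>The pairing used for symmetrisation: it preserves uniform choice from \<open>X\<close>
  while altering digit \<open>k\<close> and no higher one. It is
  \<open>ex_fibre_changing_bij\<close> inside each node of level \<open>Suc k\<close>, with the
  \<open>\<rho> k\<close> children as values; regularity makes the children equally large.\<close>

lemma reg_sibling_bij:
  assumes b: "b > 0" and r: "reg b (h + k + 1) \<rho> X" and 2: "\<rho> k \<ge> 2"
  shows "\<exists>\<phi>. bij_betw \<phi> X X \<and> (\<forall>x\<in>X. \<phi> x div b ^ Suc k = x div b ^ Suc k \<and> \<phi> x div b ^ k \<noteq> x div b ^ k)"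
proof -
  have fX: "finite X" using r by (rule reg_finite)
  define F where "F y = {x \<in> X. x div b ^ Suc k = y}" for y
  have "\<exists>\<phi>. bij_betw \<phi> (F y) (F y) \<and> (\<forall>x\<in>F y. \<phi> x div b ^ k \<noteq> x div b ^ k)" if y: "y \<in> (\<lambda>x. x div b ^ Suc k) ` X" for y
  proof (rule ex_fibre_changing_bij)
    show "finite (F y)" using fX by (simp add: F_def)
    obtain x0 where x0: "x0 \<in> X" "y = x0 div b ^ Suc k" using y by auto
    have "card ((\<lambda>x. x div b ^ k) ` F y) = \<rho> k"
      using r x0 unfolding reg_def F_def x0(2) by (simp del: power_Suc)
    then show "2 \<le> card ((\<lambda>x. x div b ^ k) ` F y)" using 2 by simp
    fix x assume x: "x \<in> F y"
    have "z div b ^ Suc k = z div b ^ k div b" for z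
      using div_div_pow[OF b, of z k 1] by simp
    then have "{z \<in> F y. z div b ^ k = x div b ^ k} = {z \<in> X. z div b ^ k = x div b ^ k}"
      using x unfolding F_def by (auto simp del: power_Suc)
    then show "card {z \<in> F y. z div b ^ k = x div b ^ k} = (\<Prod>j<k. \<rho> j)"
      using reg_card_fibre[OF b, of "h + 1" k \<rho> X x] r x by (simp add: F_def add_ac)
  qed
  then obtain \<psi> where \<psi>: "\<And>y. y \<in> (\<lambda>x. x div b ^ Suc k) ` X \<Longrightarrow> bij_betw (\<psi> y) (F y) (F y) \<and> (\<forall>x\<in>F y. \<psi> y x div b ^ k \<noteq> x div b ^ k)"
    by metis
  define \<phi> where "\<phi> x = \<psi> (x div b ^ Suc k) x" for x
  have \<phi>: "\<phi> x \<in> F (x div b ^ Suc k)" "\<phi> x div b ^ k \<noteq> x div b ^ k" if "x \<in> X" for x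
    using \<psi>[of "x div b ^ Suc k"] that unfolding \<phi>_def bij_betw_def by (auto simp: F_def simp del: power_Suc)
  have inj: "inj_on \<phi> X"
  proof (rule inj_onI)
    fix x y assume xy: "x \<in> X" "y \<in> X" "\<phi> x = \<phi> y"
    then have e: "x div b ^ Suc k = y div b ^ Suc k" using \<phi>(1) unfolding F_def by (metis (mono_tags, lifting) mem_Collect_eq)
    have "inj_on (\<psi> (x div b ^ Suc k)) (F (x div b ^ Suc k))" using \<psi> xy unfolding bij_betw_def by blast
    moreover have "x \<in> F (x div b ^ Suc k)" "y \<in> F (x div b ^ Suc k)" using xy e by (simp_all add: F_def)
    moreover have "\<psi> (x div b ^ Suc k) x = \<psi> (x div b ^ Suc k) y" using xy(3) e unfolding \<phi>_def by metis
    ultimately show "x = y" by (meson inj_onD)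
  qed
  have "\<phi> ` X \<subseteq> X" using \<phi>(1) by (auto simp: F_def)
  then have "bij_betw \<phi> X X" using inj endo_inj_surj[OF fX] by (simp add: bij_betw_def)
  then show ?thesis using \<phi> unfolding F_def by (auto simp del: power_Suc)
qed

lemma same_node_dist:
  fixes x y :: int
  assumes "0 < q" "x div q = y div q" shows "\<bar>x - y\<bar> < q"
proof -
  have "x = y div q * q + x mod q" "y = y div q * q + y mod q" using assms(2) by (metis div_mult_mod_eq)+
  moreover have "0 \<le> x mod q" "x mod q < q" "0 \<le> y mod q" "y mod q < q" using assms(1) by auto
  ultimately show ?thesis by linarith
qed

text \<open>A point in the middle half of a node stays a quarter of the node length away from its
  ends, and two different nodes contribute two such quarters. Without centrality, siblings could be
  adjacent points and the steps of the walk arbitrarily small compared with their level.\<close>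

lemma central_dist:
  fixes x y :: int
  assumes b: "b > 0" and "central b h x" "central b h y" "k \<le> h" "x div b ^ k \<noteq> y div b ^ k"
  shows "b ^ k \<le> 2 * \<bar>x - y\<bar>"
proof (cases k)
  case 0
  then have "x \<noteq> y" using assms(5) by auto
  then have "1 \<le> 2 * \<bar>x - y\<bar>" by presburger
  then show ?thesis using 0 by simp
next
  case (Suc j)
  define q where "q = b ^ k"
  have q: "q > 0" using b by (simp add: q_def)
  have c: "q \<le> 4 * (x mod q)" "4 * (x mod q) < 3 * q" "q \<le> 4 * (y mod q)" "4 * (y mod q) < 3 * q"
    using assms(2-4) Suc unfolding central_def q_def by (auto simp del: power_Suc)
  have e: "x = x div q * q + x mod q" "y = y div q * q + y mod q" by simp_all
  have "x div q + 1 \<le> y div q \<or> y div q + 1 \<le> x div q" using assms(5) unfolding q_def by linarith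
  then have "(x div q + 1) * q \<le> y div q * q \<or> (y div q + 1) * q \<le> x div q * q"
    using q by (meson mult_right_mono less_imp_le)
  then have "x div q * q + q \<le> y div q * q \<or> y div q * q + q \<le> x div q * q" by (simp add: distrib_right)
  moreover have "q \<le> 2 * \<bar>(u + r) - (v + s)\<bar>"
    if "u + q \<le> v \<or> v + q \<le> u" "q \<le> 4 * r" "4 * r < 3 * q" "q \<le> 4 * s" "4 * s < 3 * q" for u v r s :: int
  proof -
    have "q \<le> 2 * ((v + s) - (u + r))" if "u + q \<le> v" using that \<open>q \<le> 4 * s\<close> \<open>4 * r < 3 * q\<close> by presburger
    moreover have "q \<le> 2 * ((u + r) - (v + s))" if "v + q \<le> u" using that \<open>q \<le> 4 * r\<close> \<open>4 * s < 3 * q\<close> by presburger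
    moreover have "(v + s) - (u + r) \<le> \<bar>(u + r) - (v + s)\<bar>" "(u + r) - (v + s) \<le> \<bar>(u + r) - (v + s)\<bar>" by simp_all
    ultimately show ?thesis using that(1) by (meson mult_left_mono order_trans zero_le_numeral)
  qed
  ultimately have "q \<le> 2 * \<bar>(x div q * q + x mod q) - (y div q * q + y mod q)\<bar>" using c by blast
  then show ?thesis unfolding q_def[symmetric] div_mult_mod_eq .
qed

text \<open>Divisibility by 4 makes the thresholds \<open>b ^ Suc k / 4\<close> and
  \<open>3 * b ^ Suc k / 4\<close> integers, and rounding down respects inequalities with integer
  thresholds.\<close>

lemma central_top:
  assumes b: "b > 0" "4 dvd b" and c: "central b (p + h) x"
  shows "central b p (x div b ^ h)"
  unfolding central_def
proof (intro allI impI)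
  fix k assume k: "k < p"
  define q where "q = b ^ h"
  define r where "r = b ^ Suc k"
  have q: "q > 0" "r > 0" using b by (auto simp: q_def r_def)
  obtain r' where r': "r = 4 * r'" using b(2) unfolding r_def by (metis dvd_def dvd_mult2 power_Suc)
  have rq: "b ^ Suc (k + h) = q * r" by (simp add: q_def r_def power_add mult_ac)
  have e: "x div q mod r = (x mod (q * r)) div q"
  proof -
    have "x mod (q * r) = q * (x div q mod r) + x mod q" using q by (simp add: zmod_zmult2_eq)
    then show ?thesis using q by simp
  qed
  have c': "q * r \<le> 4 * (x mod (q * r))" "4 * (x mod (q * r)) < 3 * (q * r)"
    using c k unfolding central_def rq[symmetric] by auto
  have m: "x mod (q * r) = q * (x div q mod r) + x mod q" using q by (simp add: zmod_zmult2_eq)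
  have mq: "0 \<le> x mod q" "x mod q < q" using q by auto
  have qr: "q * r = 4 * (q * r')" "q * (3 * r') = 3 * (q * r')" "q * (x div q mod r + 1) = q * (x div q mod r) + q"
    unfolding r' by (simp_all add: algebra_simps)
  have "q * r' < q * (x div q mod r + 1)"
    using c'(1) m mq qr by linarith
  then have "r' < x div q mod r + 1" using q by (simp add: mult_less_cancel_left_pos)
  moreover have "q * (x div q mod r) < q * (3 * r')"
    using c'(2) m mq qr by linarith
  then have "x div q mod r < 3 * r'" using q by (simp add: mult_less_cancel_left_pos)
  ultimately show "b ^ Suc k \<le> 4 * (x div b ^ h mod b ^ Suc k) \<and> 4 * (x div b ^ h mod b ^ Suc k) < 3 * b ^ Suc k"
    unfolding q_def[symmetric] r_def[symmetric] r' by simp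
qed

lemma central_sub:
  assumes "central b (p + h) x"
  shows "central b h (x mod b ^ h)"
  unfolding central_def
proof (intro allI impI)
  fix k assume k: "k < h"
  then have "b ^ Suc k dvd b ^ h" by (intro le_imp_power_dvd) simp
  then have "x mod b ^ h mod b ^ Suc k = x mod b ^ Suc k" by (rule mod_mod_cancel)
  then show "b ^ Suc k \<le> 4 * (x mod b ^ h mod b ^ Suc k) \<and> 4 * (x mod b ^ h mod b ^ Suc k) < 3 * b ^ Suc k"
    using assms k unfolding central_def by (simp del: power_Suc)
qed

lemma bij_betw_PiE_map:
  assumes "finite I" "\<And>i. i \<in> I \<Longrightarrow> finite (B i)" "\<And>i. i \<in> I \<Longrightarrow> bij_betw (\<psi> i) (B i) (B i)"
  shows "bij_betw (\<lambda>x. \<lambda>i\<in>I. \<psi> i (x i)) (PiE I B) (PiE I B)"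
proof -
  have f: "finite (PiE I B)" using assms by (intro finite_PiE) auto
  have inj: "inj_on (\<lambda>x. \<lambda>i\<in>I. \<psi> i (x i)) (PiE I B)"
  proof (rule inj_onI)
    fix x y assume xy: "x \<in> PiE I B" "y \<in> PiE I B" "(\<lambda>i\<in>I. \<psi> i (x i)) = (\<lambda>i\<in>I. \<psi> i (y i))"
    show "x = y"
    proof (rule PiE_ext[OF xy(1,2)])
      fix i assume i: "i \<in> I"
      then have "\<psi> i (x i) = \<psi> i (y i)" using xy(3) by (metis restrict_apply')
      then show "x i = y i" using assms(3)[OF i] xy(1,2) i by (meson PiE_mem bij_betw_def inj_onD)
    qed
  qed
  have "(\<lambda>x. \<lambda>i\<in>I. \<psi> i (x i)) ` PiE I B \<subseteq> PiE I B"
  proof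
    fix y assume "y \<in> (\<lambda>x. \<lambda>i\<in>I. \<psi> i (x i)) ` PiE I B"
    then obtain x where x: "x \<in> PiE I B" "y = (\<lambda>i\<in>I. \<psi> i (x i))" by blast
    have "\<psi> i (x i) \<in> B i" if "i \<in> I" for i
      using assms(3)[OF that] x(1) that by (meson PiE_mem bij_betwE)
    then show "y \<in> PiE I B" unfolding x(2) by auto
  qed
  then show ?thesis using inj endo_inj_surj[OF f] by (simp add: bij_betw_def)
qed

text \<open>Each variable of group \<open>k\<close> is paired with a sibling at level \<open>k\<close>; averaging over all choices between a
  point and its sibling, with the points frozen, turns the group into a signed subset sum.\<close>

lemma local_count:
  fixes b :: int and K :: real and e :: "'i \<Rightarrow> int" and \<kappa> :: "'i \<Rightarrow> nat"
  assumes b: "b \<ge> 2" "even b" and M: "M \<ge> 1" and I: "finite I"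
    and G: "\<And>k. k < P \<Longrightarrow> card {i \<in> I. \<kappa> i = k} = nat (b ^ (2 * M))"
    and e: "\<And>i. i \<in> I \<Longrightarrow> \<bar>e i\<bar> = 1"
    and A: "reg b P \<rho> A"
    and B: "\<And>i. i \<in> I \<Longrightarrow> reg b P \<tau> (B i)" "\<And>i x. i \<in> I \<Longrightarrow> x \<in> B i \<Longrightarrow> central b P x"
    and T: "\<And>k. k \<in> T \<Longrightarrow> \<tau> k \<ge> 2" "\<And>k k'. k \<in> T \<Longrightarrow> k' \<in> T \<Longrightarrow> k < k' \<Longrightarrow> k + M < k'"
      "\<And>k. k \<in> T \<Longrightarrow> k + 1 + M \<le> P"
    and K: "K > 0"
  shows "real (card {(a, x). a \<in> A \<and> x \<in> PiE I B \<and> a + (\<Sum>i\<in>I. e i * x i) = w})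
    \<le> ((\<Prod>k\<in>T. (2 * K * P + 2 * K + 5) * ((4 * (1 + K * P) * b + 1) / b ^ M) * (\<Prod>i\<in>{k + 1..k + M}. real (\<rho> i)))
        + 2 * real P * exp (- 2 * K\<^sup>2) * b ^ P) * (\<Prod>i\<in>I. real (card (B i)))"
proof -
  have b0: "b > 0" using b by simp
  \<comment> \<open>With \<open>N = b ^ (2 * M)\<close> steps in a group, the fluctuation is about
    \<open>sqrt N = b ^ M\<close> times a single step, so steps of level \<open>k\<close> reach
    \<open>M\<close> levels further up.\<close>
  define N where "N = nat (b ^ (2 * M))"
  have N: "real N = real_of_int b ^ (2 * M)" "even N" "N > 0"
    using b M by (simp_all add: N_def even_nat_iff)
  have sqN: "sqrt (real N) = real_of_int b ^ M"
    using b0 by (simp add: N(1) power_mult real_sqrt_power)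
  define G where "G k = {i \<in> I. \<kappa> i = k}" for k
  have TP: "T \<subseteq> {..<P}" using T(3) by fastforce
  then have fT: "finite T" using finite_subset by blast
  have cT: "card T \<le> P" using card_mono[OF _ TP] by simp
  have cG: "card (G k) = N" if "k \<in> T" for k using assms(5)[of k] TP that by (auto simp: G_def N_def)
  have fG: "finite (G k)" for k using I by (simp add: G_def)
  have fB: "finite (B i)" if "i \<in> I" for i using B(1)[OF that] by (rule reg_finite)
  have fA: "finite A" using A by (rule reg_finite)
  have "\<exists>\<phi>. bij_betw \<phi> (B i) (B i) \<and> (\<forall>x\<in>B i. \<phi> x div b ^ Suc k = x div b ^ Suc k \<and> \<phi> x div b ^ k \<noteq> x div b ^ k)"
    if "i \<in> I" "k \<in> T" for i k
  proof -
    have kP: "P - (k + 1) + k + 1 = P" using T(3)[OF that(2)] by simp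
    show ?thesis
      by (rule reg_sibling_bij[where h = "P - (k + 1)" and \<rho> = \<tau>])
        (use b0 T(1)[OF that(2)] B(1)[OF that(1)] kP in simp_all)
  qed
  then obtain \<phi>0 where \<phi>0: "\<And>i k. i \<in> I \<Longrightarrow> k \<in> T \<Longrightarrow> bij_betw (\<phi>0 i k) (B i) (B i) \<and>
      (\<forall>x\<in>B i. \<phi>0 i k x div b ^ Suc k = x div b ^ Suc k \<and> \<phi>0 i k x div b ^ k \<noteq> x div b ^ k)" by metis
  define \<phi> where "\<phi> i = \<phi>0 i (\<kappa> i)" for i
  define X where "X = PiE I B"
  define \<Xi> where "\<Xi> = PiE T (\<lambda>k. Pow (G k))"
  have fX: "finite X" using I fB by (auto simp: X_def intro!: finite_PiE)
  have f\<Xi>: "finite \<Xi>" using fT fG by (auto simp: \<Xi>_def intro!: finite_PiE)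
  have c\<Xi>: "card \<Xi> = (2 ^ N) ^ card T" using fT fG cG by (simp add: \<Xi>_def card_PiE card_Pow)
  \<comment> \<open>\<open>\<xi>\<close> selects, for each \<open>k \<in> T\<close>, which variables
    of group \<open>k\<close> move to their sibling; groups outside \<open>T\<close> never
    move.\<close>
  define fl where "fl \<xi> x = (\<lambda>i\<in>I. if \<kappa> i \<in> T \<and> i \<in> \<xi> (\<kappa> i) then \<phi> i (x i) else x i)" for \<xi> x
  have bij: "bij_betw (fl \<xi>) X X" for \<xi>
  proof -
    have "bij_betw (\<lambda>x. \<lambda>i\<in>I. (if \<kappa> i \<in> T \<and> i \<in> \<xi> (\<kappa> i) then \<phi> i else (\<lambda>x. x)) (x i)) X X"
      unfolding X_def
    proof (rule bij_betw_PiE_map[OF I fB])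
      fix i assume "i \<in> I"
      then show "bij_betw (if \<kappa> i \<in> T \<and> i \<in> \<xi> (\<kappa> i) then \<phi> i else (\<lambda>x. x)) (B i) (B i)"
        using \<phi>0[of i "\<kappa> i"] by (auto simp: \<phi>_def bij_betw_def)
    qed
    moreover have "(\<lambda>x. \<lambda>i\<in>I. (if \<kappa> i \<in> T \<and> i \<in> \<xi> (\<kappa> i) then \<phi> i else (\<lambda>x. x)) (x i)) = fl \<xi>"
      unfolding fl_def by (intro ext) auto
    ultimately show ?thesis by simp
  qed
  define \<Lambda> where "\<Lambda> = (\<Prod>k\<in>T. (2 * K * P + 2 * K + 5) * ((4 * (1 + K * P) * b + 1) / b ^ M) * (\<Prod>i\<in>{k + 1..k + M}. real (\<rho> i)))
        + 2 * real P * exp (- 2 * K\<^sup>2) * b ^ P"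
  let ?F = "\<lambda>a x. if a + (\<Sum>i\<in>I. e i * x i) = w then 1 else 0 :: real"
  \<comment> \<open>The count over the flips alone, with the points \<open>x\<close> frozen.\<close>
  have fixed: "(\<Sum>a\<in>A. \<Sum>\<xi>\<in>\<Xi>. ?F a (fl \<xi> x)) \<le> \<Lambda> * (2 ^ N) ^ card T" if x: "x \<in> X" for x
  proof -
    define d where "d i = real_of_int (e i * (\<phi> i (x i) - x i))" for i
    \<comment> \<open>Steps of comparable size: centrality gives the lower bound that
      anticoncentration uses, the common parent gives the upper bound for the tail.\<close>
    have dbd: "b ^ k / 2 \<le> \<bar>d i\<bar>" "\<bar>d i\<bar> \<le> b ^ (k + 1)" if ik: "k \<in> T" "i \<in> G k" for i k
    proof -
      have i: "i \<in> I" "\<kappa> i = k" using ik by (auto simp: G_def)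
      have xi: "x i \<in> B i" using x i by (auto simp: X_def)
      note p = \<phi>0[OF i(1) ik(1)]
      have pB: "\<phi> i (x i) \<in> B i" using p xi unfolding \<phi>_def i(2) bij_betw_def by blast
      have pe: "\<phi> i (x i) div b ^ Suc k = x i div b ^ Suc k" "\<phi> i (x i) div b ^ k \<noteq> x i div b ^ k"
        using p xi unfolding \<phi>_def i(2) by auto
      have "\<bar>e i\<bar> = 1" using e i by blast
      then have dd: "\<bar>d i\<bar> = real_of_int \<bar>\<phi> i (x i) - x i\<bar>"
        unfolding d_def by (simp add: abs_mult flip: of_int_abs of_int_mult)
      have "b ^ k \<le> 2 * \<bar>\<phi> i (x i) - x i\<bar>"
        using central_dist[OF b0 B(2)[OF i(1) pB] B(2)[OF i(1) xi] _ pe(2)] T(3)[OF ik(1)] by simp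
      then have "real_of_int (b ^ k) \<le> 2 * \<bar>d i\<bar>" unfolding dd by linarith
      then show "b ^ k / 2 \<le> \<bar>d i\<bar>" by simp
      have "\<bar>\<phi> i (x i) - x i\<bar> < b ^ Suc k" using same_node_dist[OF _ pe(1)] b0 by simp
      then show "\<bar>d i\<bar> \<le> b ^ (k + 1)" unfolding dd by (simp del: power_Suc of_int_abs of_int_diff)
    qed
    define g where "g k S = csum d (G k) S" for k S
    \<comment> \<open>Flips without a large deviation, since \<open>b ^ (k + 1)\<close> bounds one
      step and \<open>b ^ M\<close> is \<open>sqrt N\<close>. Only these meet the size hypothesis of
      \<open>smoothing_count\<close>; all others go into the tail term.\<close>
    define \<Omega> where "\<Omega> k = {S. S \<subseteq> G k \<and> \<bar>g k S\<bar> \<le> K * b ^ (k + 1 + M)}" for k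
    define w' where "w' = real_of_int (w - (\<Sum>i\<in>I. e i * x i)) - (\<Sum>k\<in>T. sum d (G k) / 2)"
    have flsum: "real_of_int (\<Sum>i\<in>I. e i * fl \<xi> x i) = real_of_int (\<Sum>i\<in>I. e i * x i) + (\<Sum>k\<in>T. sum d (\<xi> k))"
      if \<xi>: "\<xi> \<in> \<Xi>" for \<xi>
    proof -
      have "(\<Sum>k\<in>T. sum d (\<xi> k)) = (\<Sum>k\<in>T. \<Sum>i\<in>G k. if i \<in> \<xi> k then d i else 0)"
      proof (rule sum.cong[OF refl])
        fix k assume "k \<in> T"
        then have "\<xi> k \<subseteq> G k" using \<xi> by (auto simp: \<Xi>_def)
        then show "sum d (\<xi> k) = (\<Sum>i\<in>G k. if i \<in> \<xi> k then d i else 0)"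
          using fG by (simp add: sum.If_cases Int_absorb1)
      qed
      also have "\<dots> = (\<Sum>k\<in>T. \<Sum>i\<in>{i \<in> {i \<in> I. \<kappa> i \<in> T}. \<kappa> i = k}. if i \<in> \<xi> (\<kappa> i) then d i else 0)"
        by (intro sum.cong) (auto simp: G_def)
      also have "\<dots> = (\<Sum>i\<in>{i \<in> I. \<kappa> i \<in> T}. if i \<in> \<xi> (\<kappa> i) then d i else 0)"
        using I fT by (intro sum.group) auto
      also have "\<dots> = (\<Sum>i\<in>I. if \<kappa> i \<in> T \<and> i \<in> \<xi> (\<kappa> i) then d i else 0)"
        using I by (subst sum.inter_filter) (auto intro!: sum.cong)
      finally have r: "(\<Sum>k\<in>T. sum d (\<xi> k)) = (\<Sum>i\<in>I. if \<kappa> i \<in> T \<and> i \<in> \<xi> (\<kappa> i) then d i else 0)" .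
      show ?thesis unfolding r of_int_sum sum.distrib[symmetric]
        by (rule sum.cong[OF refl]) (simp add: fl_def d_def algebra_simps)
    qed
    have iff: "a + (\<Sum>i\<in>I. e i * fl \<xi> x i) = w \<longleftrightarrow> real_of_int a + (\<Sum>k\<in>T. g k (\<xi> k)) = w'" if "\<xi> \<in> \<Xi>" for a \<xi>
    proof -
      have "(\<Sum>k\<in>T. g k (\<xi> k)) = (\<Sum>k\<in>T. sum d (\<xi> k)) - (\<Sum>k\<in>T. sum d (G k) / 2)"
        by (simp add: g_def csum_def sum_subtractf)
      then have "real_of_int a + (\<Sum>k\<in>T. g k (\<xi> k)) = w' \<longleftrightarrow> real_of_int a + real_of_int (\<Sum>i\<in>I. e i * fl \<xi> x i) = real_of_int w"
        using flsum[OF that] unfolding w'_def of_int_diff by linarith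
      then show ?thesis by (metis of_int_add of_int_eq_iff)
    qed
    let ?S = "{(a, \<xi>). a \<in> A \<and> \<xi> \<in> PiE T \<Omega> \<and> real_of_int a + (\<Sum>k\<in>T. g k (\<xi> k)) = w'}"
    let ?bad = "\<lambda>k. PiE T ((\<lambda>k. Pow (G k))(k := Pow (G k) - \<Omega> k))"
    have fO: "finite (\<Omega> k)" for k using fG by (simp add: \<Omega>_def)
    have "(\<Sum>a\<in>A. \<Sum>\<xi>\<in>\<Xi>. ?F a (fl \<xi> x)) = (\<Sum>(a, \<xi>)\<in>A \<times> \<Xi>. if real_of_int a + (\<Sum>k\<in>T. g k (\<xi> k)) = w' then 1 else 0)"
      using iff by (simp add: sum.cartesian_product[symmetric] cong: sum.cong)
    also have "\<dots> = (\<Sum>p\<in>A \<times> \<Xi>. if real_of_int (fst p) + (\<Sum>k\<in>T. g k (snd p k)) = w' then 1 else 0)"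
      by (simp add: case_prod_unfold)
    also have "\<dots> = real (card {p \<in> A \<times> \<Xi>. real_of_int (fst p) + (\<Sum>k\<in>T. g k (snd p k)) = w'})"
      using fA f\<Xi> by (simp add: sum.inter_filter[symmetric])
    also have "\<dots> \<le> real (card (?S \<union> A \<times> (\<Union>k\<in>T. ?bad k)))"
    proof (intro of_nat_mono card_mono)
      show "finite (?S \<union> A \<times> (\<Union>k\<in>T. ?bad k))"
        using fA fT fG fO by (intro finite_UnI finite_subset[of ?S "A \<times> PiE T \<Omega>"] finite_cartesian_product finite_UN_I finite_PiE) auto
      show "{p \<in> A \<times> \<Xi>. real_of_int (fst p) + (\<Sum>k\<in>T. g k (snd p k)) = w'} \<subseteq> ?S \<union> A \<times> (\<Union>k\<in>T. ?bad k)"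
      proof
        fix p assume p: "p \<in> {p \<in> A \<times> \<Xi>. real_of_int (fst p) + (\<Sum>k\<in>T. g k (snd p k)) = w'}"
        obtain a \<xi> where pe: "p = (a, \<xi>)" by (cases p)
        show "p \<in> ?S \<union> A \<times> (\<Union>k\<in>T. ?bad k)"
        proof (cases "\<forall>k\<in>T. \<xi> k \<in> \<Omega> k")
          case True
          then have "\<xi> \<in> PiE T \<Omega>" using p pe by (auto simp: \<Xi>_def PiE_iff)
          then show ?thesis using p pe by auto
        next
          case False
          then obtain k where "k \<in> T" "\<xi> k \<notin> \<Omega> k" by blast
          then have "\<xi> \<in> ?bad k" using p pe by (auto simp: \<Xi>_def PiE_iff)
          then show ?thesis using p pe \<open>k \<in> T\<close> by auto
        qed
      qed
    qed
    also have "\<dots> \<le> real (card ?S) + real (card A * (\<Sum>k\<in>T. card (?bad k)))"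
    proof -
      have "card (?S \<union> A \<times> (\<Union>k\<in>T. ?bad k)) \<le> card ?S + card (A \<times> (\<Union>k\<in>T. ?bad k))" by (rule card_Un_le)
      also have "card (A \<times> (\<Union>k\<in>T. ?bad k)) \<le> card A * (\<Sum>k\<in>T. card (?bad k))"
        unfolding card_cartesian_product using card_UN_le[OF fT, of ?bad] by (intro mult_left_mono) auto
      finally show ?thesis by (simp flip: of_nat_add of_nat_mult)
    qed
    also have "real (card ?S) \<le> (\<Prod>k\<in>T. (2 * K * P + 2 * K + 5) * ((4 * (1 + K * P) * b + 1) / b ^ M * 2 ^ N) * (\<Prod>i\<in>{k + 1..k + M}. real (\<rho> i)))"
    proof (rule smoothing_count[OF b(1) _ fT fO _ _ T(2) cT T(3) A])
      fix k :: nat and x :: real assume k: "k \<in> T"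
      have "real (card {S. S \<subseteq> G k \<and> \<bar>csum d (G k) S - x\<bar> \<le> (1 + K * P) * b ^ (k + 1)}) * sqrt (card (G k))
         \<le> (2 * ((1 + K * P) * b ^ (k + 1)) / (b ^ k / 2) + 1) * 2 ^ card (G k)"
        using dbd(1)[OF k] cG[OF k] N b0 K by (intro csum_anticoncentration fG) auto
      moreover have "2 * ((1 + K * P) * b ^ (k + 1)) / (b ^ k / 2) = 4 * (1 + K * P) * b" using b0 by simp
      ultimately have "real (card {S. S \<subseteq> G k \<and> \<bar>csum d (G k) S - x\<bar> \<le> (1 + K * P) * b ^ (k + 1)}) * real_of_int (b ^ M)
         \<le> (4 * (1 + K * P) * b + 1) * 2 ^ N"
        unfolding cG[OF k] sqN of_int_power by (simp only:)
      then have "real (card {S. S \<subseteq> G k \<and> \<bar>csum d (G k) S - x\<bar> \<le> (1 + K * P) * b ^ (k + 1)})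
         \<le> (4 * (1 + K * P) * b + 1) * 2 ^ N / b ^ M"
        by (subst pos_le_divide_eq) (use b0 in auto)
      moreover have "real (card {\<omega> \<in> \<Omega> k. \<bar>g k \<omega> - x\<bar> \<le> (1 + K * P) * b ^ (k + 1)})
         \<le> real (card {S. S \<subseteq> G k \<and> \<bar>csum d (G k) S - x\<bar> \<le> (1 + K * P) * b ^ (k + 1)})"
        using fG by (intro of_nat_mono card_mono) (auto simp: \<Omega>_def g_def)
      ultimately show "real (card {\<omega> \<in> \<Omega> k. \<bar>g k \<omega> - x\<bar> \<le> (1 + K * P) * b ^ (k + 1)})
         \<le> (4 * (1 + K * P) * b + 1) / b ^ M * 2 ^ N" by simp
    qed (use K in \<open>auto simp: \<Omega>_def\<close>)
    also have "\<dots> = (\<Prod>k\<in>T. (2 * K * P + 2 * K + 5) * ((4 * (1 + K * P) * b + 1) / b ^ M) * (\<Prod>i\<in>{k + 1..k + M}. real (\<rho> i))) * (2 ^ N) ^ card T"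
      unfolding prod_constant[symmetric] prod.distrib[symmetric] by (rule prod.cong[OF refl]) simp
    \<comment> \<open>The tail is paid for with the trivial bound \<open>b ^ P\<close> on
      \<open>card A\<close>, so the exponentially small factor will have to outweigh this.\<close>
    also have "real (card A * (\<Sum>k\<in>T. card (?bad k))) \<le> (2 * real P * exp (- 2 * K\<^sup>2) * b ^ P) * (2 ^ N) ^ card T"
    proof -
      have bad: "real (card (?bad k)) \<le> 2 * exp (- 2 * K\<^sup>2) * (2 ^ N) ^ card T" if k: "k \<in> T" for k
      proof -
        have "Pow (G k) - \<Omega> k = {S. S \<subseteq> G k \<and> \<bar>csum d (G k) S\<bar> > K * b ^ (k + 1) * sqrt (card (G k))}"
          using cG[OF k] sqN by (auto simp: \<Omega>_def g_def power_add mult_ac)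
        then have t: "real (card (Pow (G k) - \<Omega> k)) \<le> 2 * exp (- 2 * K\<^sup>2) * 2 ^ N"
          using csum_tail[of "G k" "b ^ (k + 1)" d K] fG cG[OF k] N(3) b0 dbd(2)[OF k] K by simp
        have "card (?bad k) = (\<Prod>j\<in>T. card (((\<lambda>k. Pow (G k))(k := Pow (G k) - \<Omega> k)) j))"
          by (rule card_PiE[OF fT])
        also have "\<dots> = card (Pow (G k) - \<Omega> k) * (\<Prod>j\<in>T - {k}. 2 ^ N)"
          unfolding prod.remove[OF fT k] by (intro arg_cong2[where f = "(*)"] prod.cong) (auto simp: card_Pow cG fG)
        also have "\<dots> = card (Pow (G k) - \<Omega> k) * (2 ^ N) ^ (card T - 1)" by (simp only: prod_constant card_Diff_singleton[OF k])
        finally have "real (card (?bad k)) = real (card (Pow (G k) - \<Omega> k)) * (2 ^ N) ^ (card T - 1)" by simp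
        also have "\<dots> \<le> (2 * exp (- 2 * K\<^sup>2) * 2 ^ N) * (2 ^ N) ^ (card T - 1)" using t by (intro mult_right_mono) auto
        also have "\<dots> = 2 * exp (- 2 * K\<^sup>2) * (2 ^ N) ^ Suc (card T - 1)" by simp
        also have "Suc (card T - 1) = card T" using k fT by (metis Suc_diff_1 card_gt_0_iff empty_iff)
        finally show ?thesis .
      qed
      have "A \<subseteq> {0..<b ^ P}" using A by (simp add: reg_def)
      then have "card A \<le> nat (b ^ P)" using card_mono[of "{0..<b ^ P}" A] by simp
      then have cA: "real (card A) \<le> b ^ P" using b0 by (simp add: le_nat_iff flip: of_int_power)
      have "real (\<Sum>k\<in>T. card (?bad k)) = (\<Sum>k\<in>T. real (card (?bad k)))" by simp
      also have "\<dots> \<le> (\<Sum>k\<in>T. 2 * exp (- 2 * K\<^sup>2) * (2 ^ N) ^ card T)" using bad by (intro sum_mono)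
      also have "\<dots> \<le> P * (2 * exp (- 2 * K\<^sup>2) * (2 ^ N) ^ card T)" using cT by (simp add: mult_right_mono)
      finally have "real (card A) * real (\<Sum>k\<in>T. card (?bad k)) \<le> b ^ P * (P * (2 * exp (- 2 * K\<^sup>2) * (2 ^ N) ^ card T))"
        using cA b0 by (intro mult_mono of_nat_0_le_iff) auto
      then show ?thesis by (simp add: mult_ac)
    qed
    finally show ?thesis by (simp add: \<Lambda>_def distrib_right)
  qed
  let ?C = "real (card {(a, x). a \<in> A \<and> x \<in> X \<and> a + (\<Sum>i\<in>I. e i * x i) = w})"
  have set_eq: "{(a, x). a \<in> A \<and> x \<in> X \<and> a + (\<Sum>i\<in>I. e i * x i) = w}
      = {p \<in> A \<times> X. fst p + (\<Sum>i\<in>I. e i * snd p i) = w}" by auto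
  have "?C = (\<Sum>p\<in>A \<times> X. ?F (fst p) (snd p))"
    unfolding set_eq using fA fX by (simp add: sum.inter_filter[symmetric])
  also have "\<dots> = (\<Sum>a\<in>A. \<Sum>x\<in>X. ?F a x)" by (simp only: sum.cartesian_product case_prod_unfold)
  finally have C: "?C = (\<Sum>a\<in>A. \<Sum>x\<in>X. ?F a x)" .
  \<comment> \<open>Each flip permutes the product set and leaves the count of solutions unchanged.
    Averaging over all \<open>\<xi>\<close> and exchanging the sums reduces the claim to
    \<open>fixed\<close>.\<close>
  have "?C * (2 ^ N) ^ card T = (\<Sum>\<xi>\<in>\<Xi>. \<Sum>a\<in>A. \<Sum>x\<in>X. ?F a x)" unfolding C using c\<Xi> by simp
  also have "\<dots> = (\<Sum>\<xi>\<in>\<Xi>. \<Sum>a\<in>A. \<Sum>x\<in>X. ?F a (fl \<xi> x))"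
    by (rule sum.cong[OF refl], rule sum.cong[OF refl], rule sum.reindex_bij_betw[OF bij, symmetric])
  also have "\<dots> = (\<Sum>\<xi>\<in>\<Xi>. \<Sum>x\<in>X. \<Sum>a\<in>A. ?F a (fl \<xi> x))" by (rule sum.cong[OF refl], rule sum.swap)
  also have "\<dots> = (\<Sum>x\<in>X. \<Sum>\<xi>\<in>\<Xi>. \<Sum>a\<in>A. ?F a (fl \<xi> x))" by (rule sum.swap)
  also have "\<dots> = (\<Sum>x\<in>X. \<Sum>a\<in>A. \<Sum>\<xi>\<in>\<Xi>. ?F a (fl \<xi> x))" by (rule sum.cong[OF refl], rule sum.swap)
  also have "\<dots> \<le> (\<Sum>x\<in>X. \<Lambda> * (2 ^ N) ^ card T)" using fixed by (intro sum_mono)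
  also have "\<dots> = \<Lambda> * (\<Prod>i\<in>I. real (card (B i))) * (2 ^ N) ^ card T"
    using I by (simp add: X_def card_PiE)
  finally have "?C \<le> \<Lambda> * (\<Prod>i\<in>I. real (card (B i)))"
    by (rule mult_right_le_imp_le) simp
  then show ?thesis by (simp add: \<Lambda>_def X_def)
qed

section \<open>Counting solutions over all levels\<close>


text \<open>Greedy choice in increasing order: an index is taken unless it lies among the
  \<open>M\<close> indices above one already taken.\<close>

lemma ex_separated_subset:
  assumes "finite (U :: nat set)"
  shows "\<exists>T\<subseteq>U. (\<forall>k\<in>T. \<forall>k'\<in>T. k < k' \<longrightarrow> k + M < k') \<and> U \<subseteq> T \<union> (\<Union>k\<in>T. {k + 1..k + M})"
  using assms
proof (induction U rule: finite_linorder_max_induct)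
  case empty
  then show ?case by simp
next
  case (insert u U)
  then obtain T where T: "T \<subseteq> U" "\<forall>k\<in>T. \<forall>k'\<in>T. k < k' \<longrightarrow> k + M < k'" "U \<subseteq> T \<union> (\<Union>k\<in>T. {k + 1..k + M})"
    by auto
  show ?case
  proof (cases "u \<in> (\<Union>k\<in>T. {k + 1..k + M})")
    case True
    then show ?thesis using T by (intro exI[of _ T]) auto
  next
    case False
    have lt: "k + M < u" if "k \<in> T" for k
    proof -
      have "k < u" using that T(1) insert.hyps by auto
      moreover have "\<not> (k + 1 \<le> u \<and> u \<le> k + M)" using False that by auto
      ultimately show ?thesis by simp
    qed
    have "\<not> u < k'" if "k' \<in> T" for k' using lt[OF that] by simp
    then have "\<forall>k\<in>insert u T. \<forall>k'\<in>insert u T. k < k' \<longrightarrow> k + M < k'" using T(2) lt by auto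
    then show ?thesis using T(1,3) by (intro exI[of _ "insert u T"]) auto
  qed
qed

lemma prod_separated:
  assumes "finite T" "\<And>k k'. k \<in> T \<Longrightarrow> k' \<in> T \<Longrightarrow> k < k' \<Longrightarrow> k + M < k'"
  shows "(\<Prod>k\<in>T. \<Prod>i\<in>{k + 1..k + M}. f i) = (\<Prod>i\<in>(\<Union>k\<in>T. {k + 1..k + (M::nat)}). f i :: real)"
    and "card (\<Union>k\<in>T. {k + 1..k + M}) = card T * M"
proof -
  have d: "{k + 1..k + M} \<inter> {k' + 1..k' + M} = {}" if "k \<in> T" "k' \<in> T" "k \<noteq> k'" for k k'
    using assms(2)[of k k'] assms(2)[of k' k] that by (cases "k < k'") auto
  show "(\<Prod>k\<in>T. \<Prod>i\<in>{k + 1..k + M}. f i) = (\<Prod>i\<in>(\<Union>k\<in>T. {k + 1..k + M}). f i)"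
    by (rule prod.UNION_disjoint[symmetric]) (use assms(1) d in auto)
  have "card (\<Union>k\<in>T. {k + 1..k + M}) = (\<Sum>k\<in>T. card {k + 1..k + M})"
    by (rule card_UN_disjoint) (use assms(1) d in auto)
  then show "card (\<Union>k\<in>T. {k + 1..k + M}) = card T * M" by simp
qed

lemma card_div_block: "c > 0 \<Longrightarrow> k < P \<Longrightarrow> card {i \<in> {..<P * c}. i div c = k} = (c::nat)"
proof -
  assume c: "c > 0" and k: "k < P"
  have "{i \<in> {..<P * c}. i div c = k} = {k * c..<k * c + c}"
  proof (intro equalityI subsetI)
    fix i assume "i \<in> {i \<in> {..<P * c}. i div c = k}"
    then have "k = i div c" by simp
    then show "i \<in> {k * c..<k * c + c}"
      using c dividend_less_div_times[of c i] times_div_less_eq_dividend[of i c] div_times_less_eq_dividend[of i c] by (simp add: add.commute)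
  next
    fix i assume i: "i \<in> {k * c..<k * c + c}"
    then have "i div c = k" by (intro div_nat_eqI) (auto simp: mult.commute)
    moreover have "Suc k * c \<le> P * c" using k by (intro mult_right_mono) auto
    ultimately show "i \<in> {i \<in> {..<P * c}. i div c = k}" using i by auto
  qed
  then show ?thesis by simp
qed

text \<open>The starting point \<open>a\<close> is kept apart from the steps \<open>x\<close>,
  because it comes from a different tree and has no sign.\<close>

definition solutions :: "int set \<Rightarrow> 'i set \<Rightarrow> ('i \<Rightarrow> int set) \<Rightarrow> ('i \<Rightarrow> int) \<Rightarrow> int \<Rightarrow> (int \<times> ('i \<Rightarrow> int)) set" where
  "solutions A I B e w = {(a, x). a \<in> A \<and> x \<in> PiE I B \<and> a + (\<Sum>i\<in>I. e i * x i) = w}"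

lemma finite_solutions:
  assumes "finite A" "finite I" "\<And>i. i \<in> I \<Longrightarrow> finite (B i)"
  shows "finite (solutions A I B e w)"
  by (rule finite_subset[of _ "A \<times> PiE I B"]) (use assms in \<open>auto simp: solutions_def intro!: finite_PiE\<close>)

text \<open>\<open>1 / b ^ P\<close> is a lower bound for any product of at most \<open>P\<close>
  ratios \<open>\<rho> k / b\<close> with \<open>\<rho> k \<ge> 1\<close>, so this \<open>K\<close>
  makes the tail harmless beside the main term. The proof compares exponents, using
  \<open>2 * P \<le> 2 ^ P\<close>, \<open>2 \<le> exp 1\<close> and
  \<open>P + 2 * D * P \<le> 2 * K\<^sup>2\<close>.\<close>

lemma tail_negligible:
  fixes D P :: nat
  assumes "D \<ge> 1" "P \<ge> 1" "K = 2 * real P * D"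
  shows "2 * real P * exp (- 2 * K\<^sup>2) * (2 ^ D) ^ P \<le> 1 / (2 ^ D) ^ P"
proof -
  have "(2 * real P) * (2 ^ D) ^ P * (2 ^ D) ^ P \<le> 2 ^ P * 2 ^ (D * P) * 2 ^ (D * P)"
  proof -
    have "2 * P \<le> 2 ^ P"
    proof -
      obtain r where r: "P = Suc r" using assms(2) by (cases P) auto
      have "Suc r \<le> 2 ^ r" using less_exp[of r] by (simp add: Suc_le_eq)
      then show ?thesis by (simp add: r)
    qed
    then have "2 * real P \<le> 2 ^ P" using of_nat_le_iff[where 'a=real, of "2 * P" "2 ^ P"] by simp
    then show ?thesis by (simp add: power_mult mult_right_mono)
  qed
  also have "\<dots> = 2 ^ (P + D * P + D * P)" by (simp add: power_add)
  also have "\<dots> \<le> exp (1::real) ^ (P + D * P + D * P)"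
    using exp_ge_add_one_self[of 1] by (intro power_mono) auto
  also have "\<dots> = exp (real (P + D * P + D * P))" by (simp add: exp_of_nat_mult[symmetric])
  also have "\<dots> \<le> exp (2 * K\<^sup>2)"
  proof -
    have "P + D * P + D * P \<le> 3 * ((D * P) * (D * P))"
    proof -
      have "1 \<le> D * P" using assms by simp
      then have "D * P \<le> (D * P) * (D * P)" by simp
      moreover have "P \<le> D * P" using assms by simp
      ultimately show ?thesis by linarith
    qed
    then have "real (P + D * P + D * P) \<le> real (3 * ((D * P) * (D * P)))" by (rule of_nat_mono)
    then have "real (P + D * P + D * P) \<le> 2 * K\<^sup>2" by (simp add: assms(3) power2_eq_square)
      (smt (verit) mult.assoc mult.commute mult_nonneg_nonneg of_nat_0_le_iff)
    then show ?thesis by simp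
  qed
  finally have "(2 * real P) * (2 ^ D) ^ P * (2 ^ D) ^ P \<le> exp (2 * K\<^sup>2)" .
  then show ?thesis by (simp add: exp_minus field_simps)
qed

text \<open>A block of \<open>P\<close> levels comes with one group of \<open>b ^ (2 * M)\<close>
  variables per level, which gives \<open>n\<close>. The assumption \<open>large\<close> lets one
  factor \<open>b\<close> absorb the constants that a single level costs in
  \<open>local_count\<close>, with \<open>K = 2 * P * D\<close> as in
  \<open>tail_negligible\<close>.\<close>

locale scales =
  fixes D M :: nat and b :: int and P n :: nat
  defines "b \<equiv> 2 ^ D" and "P \<equiv> M * M" and "n \<equiv> P * (2 ^ D) ^ (2 * M)"
  assumes D: "D \<ge> 2" and M: "M \<ge> 1"
    and large: "(2 * (2 * real P * D) * P + 2 * (2 * real P * D) + 5) * (4 * (1 + (2 * real P * D) * P) + 1) \<le> 2 ^ D"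
begin

lemma b: "b \<ge> 2" "b > 0" "even b" "4 dvd b"
proof -
  have "(2::int) ^ 1 \<le> 2 ^ D" using D by (intro power_increasing) auto
  then show "b \<ge> 2" "b > 0" by (auto simp: b_def)
  show 4: "4 dvd b" using le_imp_power_dvd[OF D, of "2::int"] by (simp add: b_def)
  show "even b" using D by (simp add: b_def)
qed

lemma P1: "P \<ge> 1" using M by (simp add: P_def)

text \<open>Only a separated set \<open>T\<close> of branching levels acts, and \<open>F\<close>
  consists of the \<open>M\<close> levels above each of them. These windows are disjoint and fit
  into \<open>M * M\<close> levels, so \<open>card T \<le> M\<close>; branching levels missed by
  \<open>F\<close> lie in \<open>T\<close> or among the top \<open>M\<close> levels.
  \<open>F\<close> depends on \<open>\<tau>\<close> alone, so one choice serves all trees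
  \<open>A\<close> and all fibres.\<close>

lemma local_bound:
  "\<exists>F\<subseteq>{..<P}. card ({k\<in>{..<P}. \<tau> k \<ge> 2} - F) \<le> 2 * M \<and>
    (\<forall>\<rho> A B e w. (\<forall>i<n. \<bar>e i\<bar> = 1) \<longrightarrow> reg b P \<rho> A \<longrightarrow> (\<forall>i<n. reg b P \<tau> (B i) \<and> (\<forall>x\<in>B i. central b P x)) \<longrightarrow>
      real (card (solutions A {..<n} B e w)) \<le> b ^ (2 * M + 1) * (\<Prod>k\<in>F. \<rho> k / b) * (\<Prod>i<n. real (card (B i))))"
proof -
  define U where "U = {k. \<tau> k \<ge> 2 \<and> k + 1 + M \<le> P}"
  have "finite U" by (rule finite_subset[of _ "{..P}"]) (auto simp: U_def)
  then obtain T where T: "T \<subseteq> U" "\<forall>k\<in>T. \<forall>k'\<in>T. k < k' \<longrightarrow> k + M < k'" "U \<subseteq> T \<union> (\<Union>k\<in>T. {k + 1..k + M})"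
    using ex_separated_subset[OF \<open>finite U\<close>, of M] by (elim exE conjE) (rule that)
  have fT: "finite T" using T(1) \<open>finite U\<close> finite_subset by blast
  define F where "F = (\<Union>k\<in>T. {k + 1..k + M})"
  have FP: "F \<subseteq> {..<P}" using T(1) by (fastforce simp: F_def U_def)
  have cF: "card F = card T * M" unfolding F_def using T(2) fT by (intro prod_separated(2)) auto
  have "card F \<le> P" using card_mono[OF _ FP] by simp
  then have cT: "card T \<le> M" using cF M by (simp add: P_def)
  have "{k\<in>{..<P}. \<tau> k \<ge> 2} - F \<subseteq> T \<union> {P - M..<P}"
  proof
    fix k assume k: "k \<in> {k\<in>{..<P}. \<tau> k \<ge> 2} - F"
    show "k \<in> T \<union> {P - M..<P}"
    proof (cases "k + 1 + M \<le> P")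
      case True
      then have "k \<in> U" using k by (simp add: U_def)
      then show ?thesis using T(3) k unfolding F_def by blast
    qed (use k in auto)
  qed
  then have "card ({k\<in>{..<P}. \<tau> k \<ge> 2} - F) \<le> card (T \<union> {P - M..<P})"
    using fT by (intro card_mono) auto
  also have "\<dots> \<le> card T + card {P - M..<P}" by (rule card_Un_le)
  also have "\<dots> \<le> 2 * M" using cT by simp
  finally have unf: "card ({k\<in>{..<P}. \<tau> k \<ge> 2} - F) \<le> 2 * M" .
  have main: "real (card (solutions A {..<n} B e w)) \<le> b ^ (2 * M + 1) * (\<Prod>k\<in>F. \<rho> k / b) * (\<Prod>i<n. real (card (B i)))"
    if e: "\<forall>i<n. \<bar>e i\<bar> = 1" and A: "reg b P \<rho> A" and B: "\<forall>i<n. reg b P \<tau> (B i) \<and> (\<forall>x\<in>B i. central b P x)" for \<rho> A B e w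
  proof -
    define K where "K = 2 * real P * D"
    have K: "K > 0" using P1 D by (simp add: K_def)
    let ?c = "nat (b ^ (2 * M))"
    have ne: "n = P * ?c" by (simp add: n_def b_def nat_power_eq)
    have L: "real (card (solutions A {..<n} B e w))
      \<le> ((\<Prod>k\<in>T. (2 * K * P + 2 * K + 5) * ((4 * (1 + K * P) * b + 1) / b ^ M) * (\<Prod>i\<in>{k + 1..k + M}. real (\<rho> i)))
        + 2 * real P * exp (- 2 * K\<^sup>2) * b ^ P) * (\<Prod>i<n. real (card (B i)))"
      unfolding solutions_def
    proof (rule local_count[OF b(1,3) M _ _ _ A])
      show "card {i \<in> {..<n}. i div ?c = k} = ?c" if "k < P" for k
        unfolding ne using b(2) that by (intro card_div_block) auto
    qed (use e B T K in \<open>auto simp: U_def\<close>)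
    have \<rho>1: "real (\<rho> k) \<ge> 1" if "k < P" for k using reg_pos[OF b(2) A that] by simp
    have bpos: "real_of_int b \<ge> 2" using b(1) by simp
    have prodF: "(\<Prod>k\<in>F. \<rho> k / b) \<ge> 1 / b ^ P"
    proof -
      have "(1 / real_of_int b) ^ P \<le> (1 / real_of_int b) ^ card F" using bpos \<open>card F \<le> P\<close> by (intro power_decreasing) auto
      also have "\<dots> = (\<Prod>k\<in>F. 1 / b)" by simp
      also have "\<dots> \<le> (\<Prod>k\<in>F. \<rho> k / b)" using \<rho>1 FP bpos by (intro prod_mono) (auto simp: divide_right_mono)
      finally show ?thesis by (simp add: power_divide)
    qed
    \<comment> \<open>Each level of \<open>T\<close> costs at most \<open>b\<^sup>2\<close>: one
      \<open>b\<close> from the width of the anticoncentration window, the other for the constants,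
      by \<open>large\<close>.\<close>
    have step: "(2 * K * P + 2 * K + 5) * ((4 * (1 + K * P) * b + 1) / b ^ M) * (\<Prod>i\<in>{k + 1..k + M}. real (\<rho> i))
      \<le> b ^ 2 * (\<Prod>i\<in>{k + 1..k + M}. \<rho> i / b)" for k
    proof -
      have "(2 * K * P + 2 * K + 5) * (4 * (1 + K * P) * b + 1) \<le> (2 * K * P + 2 * K + 5) * ((4 * (1 + K * P) + 1) * b)"
        using K bpos by (intro mult_left_mono) (auto simp: distrib_right)
      also have "\<dots> = ((2 * K * P + 2 * K + 5) * (4 * (1 + K * P) + 1)) * b" by (simp only: mult.assoc)
      also have "\<dots> \<le> real_of_int b * real_of_int b" using large bpos by (intro mult_right_mono) (auto simp: K_def b_def)
      finally have "(2 * K * P + 2 * K + 5) * (4 * (1 + K * P) * b + 1) * ((\<Prod>i\<in>{k + 1..k + M}. real (\<rho> i)) / b ^ M)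
        \<le> real_of_int b * real_of_int b * ((\<Prod>i\<in>{k + 1..k + M}. real (\<rho> i)) / b ^ M)"
        using bpos by (intro mult_right_mono divide_nonneg_nonneg prod_nonneg) auto
      also have "(\<Prod>i\<in>{k + 1..k + M}. real (\<rho> i)) / b ^ M = (\<Prod>i\<in>{k + 1..k + M}. \<rho> i / b)"
        by (simp add: prod_dividef)
      finally show ?thesis by (simp add: prod_dividef power2_eq_square mult_ac)
    qed
    have "(\<Prod>k\<in>T. (2 * K * P + 2 * K + 5) * ((4 * (1 + K * P) * b + 1) / b ^ M) * (\<Prod>i\<in>{k + 1..k + M}. real (\<rho> i)))
      \<le> (\<Prod>k\<in>T. b ^ 2 * (\<Prod>i\<in>{k + 1..k + M}. \<rho> i / b))"
      using step K bpos by (intro prod_mono conjI mult_nonneg_nonneg divide_nonneg_nonneg prod_nonneg) auto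
    also have "\<dots> = (b ^ 2) ^ card T * (\<Prod>k\<in>F. \<rho> k / b)"
      using prod_separated(1)[OF fT, of M "\<lambda>i. \<rho> i / b"] T(2) by (simp add: prod.distrib F_def)
    also have "\<dots> \<le> b ^ (2 * M) * (\<Prod>k\<in>F. \<rho> k / b)"
    proof (rule mult_right_mono)
      have "(real_of_int b ^ 2) ^ card T \<le> real_of_int b ^ (2 * M)"
        unfolding power_mult[symmetric] using bpos cT by (intro power_increasing) auto
      then show "real_of_int ((b ^ 2) ^ card T) \<le> real_of_int (b ^ (2 * M))" by simp
    qed (use bpos in \<open>auto intro!: prod_nonneg\<close>)
    finally have 1: "(\<Prod>k\<in>T. (2 * K * P + 2 * K + 5) * ((4 * (1 + K * P) * b + 1) / b ^ M) * (\<Prod>i\<in>{k + 1..k + M}. real (\<rho> i)))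
      \<le> b ^ (2 * M) * (\<Prod>k\<in>F. \<rho> k / b)" .
    have "2 * real P * exp (- 2 * K\<^sup>2) * b ^ P \<le> 1 / b ^ P"
      using tail_negligible[of D P K] D P1 by (simp add: b_def K_def)
    also have "\<dots> \<le> (\<Prod>k\<in>F. \<rho> k / b)" by (rule prodF)
    also have "\<dots> \<le> b ^ (2 * M) * (\<Prod>k\<in>F. \<rho> k / b)"
    proof -
      have "1 * (\<Prod>k\<in>F. \<rho> k / b) \<le> real_of_int b ^ (2 * M) * (\<Prod>k\<in>F. \<rho> k / b)"
        using bpos by (intro mult_right_mono prod_nonneg one_le_power) auto
      then show ?thesis by simp
    qed
    finally have 2: "2 * real P * exp (- 2 * K\<^sup>2) * b ^ P \<le> b ^ (2 * M) * (\<Prod>k\<in>F. \<rho> k / b)" .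
    have "2 * (real_of_int b ^ (2 * M) * (\<Prod>k\<in>F. \<rho> k / b)) \<le> b * (real_of_int b ^ (2 * M) * (\<Prod>k\<in>F. \<rho> k / b))"
      using bpos by (intro mult_right_mono mult_nonneg_nonneg prod_nonneg) auto
    then have "(\<Prod>k\<in>T. (2 * K * P + 2 * K + 5) * ((4 * (1 + K * P) * b + 1) / b ^ M) * (\<Prod>i\<in>{k + 1..k + M}. real (\<rho> i)))
        + 2 * real P * exp (- 2 * K\<^sup>2) * b ^ P \<le> b ^ (2 * M + 1) * (\<Prod>k\<in>F. \<rho> k / b)"
      using 1 2 by simp
    then have "((\<Prod>k\<in>T. (2 * K * P + 2 * K + 5) * ((4 * (1 + K * P) * b + 1) / b ^ M) * (\<Prod>i\<in>{k + 1..k + M}. real (\<rho> i)))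
        + 2 * real P * exp (- 2 * K\<^sup>2) * b ^ P) * (\<Prod>i<n. real (card (B i))) \<le> (b ^ (2 * M + 1) * (\<Prod>k\<in>F. \<rho> k / b)) * (\<Prod>i<n. real (card (B i)))"
      by (intro mult_right_mono prod_nonneg) auto
    with L show ?thesis by linarith
  qed
  show ?thesis using FP unf main by (intro exI[of _ F]) blast
qed

text \<open>Induction removes the top block. Fixing the leading digits of \<open>a\<close> and of
  every variable leaves the same problem of height \<open>h - P\<close>, with the same
  \<open>n\<close> variables and, by regularity, the same \<open>\<tau>\<close>; hence the losses
  multiply block by block. The fewer than \<open>P\<close> levels remaining at the end are all
  counted as missed.\<close>

lemma global_count:
  "\<exists>F\<subseteq>{..<h}. card ({k\<in>{..<h}. \<tau> k \<ge> 2} - F) \<le> (h div P) * (2 * M) + P \<and>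
    (\<forall>\<rho> A B e w. (\<forall>i<n. \<bar>e i\<bar> = 1) \<longrightarrow> reg b h \<rho> A \<longrightarrow> (\<forall>i<n. reg b h \<tau> (B i) \<and> (\<forall>x\<in>B i. central b h x)) \<longrightarrow>
      real (card (solutions A {..<n} B e w))
        \<le> (b ^ (2 * M + 1) * (2 * real n + 3)) ^ (h div P) * (\<Prod>k\<in>F. \<rho> k / b) * (\<Prod>i<n. real (card (B i))))"
proof (induction h arbitrary: \<tau> rule: less_induct)
  case (less h)
  show ?case
  proof (cases "h < P")
    case True
    \<comment> \<open>Trivial bound for an incomplete block: \<open>a\<close> is determined by the
      variables, and \<open>F\<close> is empty.\<close>
    have "real (card (solutions A {..<n} B e w)) \<le> (\<Prod>i<n. real (card (B i)))"
      if A: "reg b h \<rho> A" and B: "\<forall>i<n. reg b h \<tau> (B i) \<and> (\<forall>x\<in>B i. central b h x)" for \<rho> A B e w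
    proof -
      have fB: "finite (PiE {..<n} B)" using B reg_finite by (intro finite_PiE) auto
      have "card (solutions A {..<n} B e w) \<le> card (PiE {..<n} B)"
      proof (rule card_inj_on_le[of snd])
        show "inj_on snd (solutions A {..<n} B e w)"
        proof (rule inj_onI)
          fix p p' assume "p \<in> solutions A {..<n} B e w" "p' \<in> solutions A {..<n} B e w" "snd p = snd p'"
          then show "p = p'" by (cases p; cases p') (simp add: solutions_def)
        qed
        show "snd ` solutions A {..<n} B e w \<subseteq> PiE {..<n} B"
          by (rule image_subsetI) (simp add: solutions_def case_prod_unfold)
      qed (rule fB)
      then have "real (card (solutions A {..<n} B e w)) \<le> real (\<Prod>i<n. card (B i))" by (simp add: card_PiE del: of_nat_prod)
      then show ?thesis by simp
    qed
    moreover have "card ({k\<in>{..<h}. \<tau> k \<ge> 2} - {}) \<le> P"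
    proof -
      have "card {k\<in>{..<h}. \<tau> k \<ge> 2} \<le> card {..<h}" by (rule card_mono) auto
      then show ?thesis using True by simp
    qed
    moreover have "h div P = 0" using True by simp
    ultimately show ?thesis
      by (intro exI[of _ "{}"] conjI allI impI) (simp_all only: power_0 prod.empty mult_1 empty_subsetI mult_0 add_0)
  next
    case False
    define g where "g = h - P"
    have h: "h = P + g" and gh: "g < h" using False P1 by (auto simp: g_def)
    have hd: "h div P = Suc (g div P)" using P1 by (simp add: h)
    obtain F1 where F1: "F1 \<subseteq> {..<g}" "card ({k\<in>{..<g}. \<tau> k \<ge> 2} - F1) \<le> (g div P) * (2 * M) + P"
      and IH: "\<And>\<rho> A B e w. \<forall>i<n. \<bar>e i\<bar> = 1 \<Longrightarrow> reg b g \<rho> A \<Longrightarrow> \<forall>i<n. reg b g \<tau> (B i) \<and> (\<forall>x\<in>B i. central b g x) \<Longrightarrow>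
      real (card (solutions A {..<n} B e w))
        \<le> (b ^ (2 * M + 1) * (2 * real n + 3)) ^ (g div P) * (\<Prod>k\<in>F1. \<rho> k / b) * (\<Prod>i<n. real (card (B i)))"
      using less.IH[OF gh, of \<tau>] by (elim exE conjE) (rule that, assumption, assumption, blast)
    obtain F2 where F2: "F2 \<subseteq> {..<P}" "card ({k\<in>{..<P}. \<tau> (k + g) \<ge> 2} - F2) \<le> 2 * M"
      and LB: "\<And>\<rho> A B e w. \<forall>i<n. \<bar>e i\<bar> = 1 \<Longrightarrow> reg b P \<rho> A \<Longrightarrow> \<forall>i<n. reg b P (\<lambda>k. \<tau> (k + g)) (B i) \<and> (\<forall>x\<in>B i. central b P x) \<Longrightarrow>
      real (card (solutions A {..<n} B e w)) \<le> b ^ (2 * M + 1) * (\<Prod>k\<in>F2. \<rho> k / b) * (\<Prod>i<n. real (card (B i)))"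
      using local_bound[of "\<lambda>k. \<tau> (k + g)"] by (elim exE conjE) (rule that, assumption, assumption, blast)
    define F where "F = F1 \<union> (\<lambda>k. k + g) ` F2"
    have disj: "F1 \<inter> (\<lambda>k. k + g) ` F2 = {}" using F1(1) by auto
    have fin: "finite F1" "finite F2" using F1(1) F2(1) finite_subset by blast+
    have FP: "F \<subseteq> {..<h}" using F1(1) F2(1) by (auto simp: F_def h)
    have "{k\<in>{..<h}. \<tau> k \<ge> 2} - F \<subseteq> ({k\<in>{..<g}. \<tau> k \<ge> 2} - F1) \<union> (\<lambda>k. k + g) ` ({k\<in>{..<P}. \<tau> (k + g) \<ge> 2} - F2)"
    proof
      fix k assume k: "k \<in> {k\<in>{..<h}. \<tau> k \<ge> 2} - F"
      show "k \<in> ({k\<in>{..<g}. \<tau> k \<ge> 2} - F1) \<union> (\<lambda>k. k + g) ` ({k\<in>{..<P}. \<tau> (k + g) \<ge> 2} - F2)"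
      proof (cases "k < g")
        case True
        then show ?thesis using k by (auto simp: F_def)
      next
        case False
        then have "k = (k - g) + g" by simp
        moreover from this have "k - g \<notin> F2" using k imageI[of "k - g" F2 "\<lambda>k. k + g"] by (auto simp: F_def)
        then have "k - g \<in> {k\<in>{..<P}. \<tau> (k + g) \<ge> 2} - F2" using k False by (auto simp: h)
        ultimately show ?thesis by blast
      qed
    qed
    then have "card ({k\<in>{..<h}. \<tau> k \<ge> 2} - F)
      \<le> card (({k\<in>{..<g}. \<tau> k \<ge> 2} - F1) \<union> (\<lambda>k. k + g) ` ({k\<in>{..<P}. \<tau> (k + g) \<ge> 2} - F2))"
      by (intro card_mono) auto
    also have "\<dots> \<le> card ({k\<in>{..<g}. \<tau> k \<ge> 2} - F1) + card ((\<lambda>k. k + g) ` ({k\<in>{..<P}. \<tau> (k + g) \<ge> 2} - F2))"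
      by (rule card_Un_le)
    also have "card ((\<lambda>k. k + g) ` ({k\<in>{..<P}. \<tau> (k + g) \<ge> 2} - F2)) = card ({k\<in>{..<P}. \<tau> (k + g) \<ge> 2} - F2)"
      by (rule card_image) (auto simp: inj_on_def)
    finally have cU: "card ({k\<in>{..<h}. \<tau> k \<ge> 2} - F) \<le> (h div P) * (2 * M) + P"
      using F1(2) F2(2) by (simp add: hd)
    have main: "real (card (solutions A {..<n} B e w))
        \<le> (b ^ (2 * M + 1) * (2 * real n + 3)) ^ (h div P) * (\<Prod>k\<in>F. \<rho> k / b) * (\<Prod>i<n. real (card (B i)))"
      if e: "\<forall>i<n. \<bar>e i\<bar> = 1" and A: "reg b h \<rho> A" and B: "\<forall>i<n. reg b h \<tau> (B i) \<and> (\<forall>x\<in>B i. central b h x)" for \<rho> A B e w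
    proof -
      define q where "q = b ^ g"
      have q: "q > 0" using b by (simp add: q_def)
      let ?I = "{..<n}"
      define At where "At = (\<lambda>x. x div q) ` A"
      define Bt where "Bt i = (\<lambda>x. x div q) ` B i" for i
      have fA: "finite A" using A by (rule reg_finite)
      have fB: "finite (B i)" if "i < n" for i using B that reg_finite by blast
      have fs: "finite (solutions A ?I B e w)" using fA fB by (intro finite_solutions) auto
      have fst': "finite (solutions At ?I Bt e v)" for v using fA fB by (intro finite_solutions) (auto simp: At_def Bt_def)
      have At: "reg b P (\<lambda>k. \<rho> (k + g)) At" unfolding At_def q_def using A h by (intro reg_top b(2)) simp
      have Bt: "\<forall>i<n. reg b P (\<lambda>k. \<tau> (k + g)) (Bt i) \<and> (\<forall>x\<in>Bt i. central b P x)"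
        unfolding Bt_def q_def using B h b by (auto intro!: reg_top central_top)
      define c where "c = (\<Prod>k<g. \<tau> k)"
      have cB: "card (B i) = card (Bt i) * c" if "i < n" for i
      proof -
        have "card (B i) = (\<Prod>k<h. \<tau> k)" by (rule reg_card[OF b(2)]) (use B that in blast)
        also have "\<dots> = (\<Prod>k<g. \<tau> k) * (\<Prod>k<P. \<tau> (k + g))"
        proof -
          have "{..<h} = {..<g} \<union> (\<lambda>k. k + g) ` {..<P}"
          proof (intro equalityI subsetI)
            fix k assume "k \<in> {..<h}"
            then show "k \<in> {..<g} \<union> (\<lambda>k. k + g) ` {..<P}"
              by (cases "k < g") (auto simp: h image_iff intro!: bexI[of _ "k - g"])
          qed (auto simp: h)
          moreover have "{..<g} \<inter> (\<lambda>k. k + g) ` {..<P} = {}" by auto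
          ultimately have "(\<Prod>k<h. \<tau> k) = (\<Prod>k<g. \<tau> k) * (\<Prod>k\<in>(\<lambda>k. k + g) ` {..<P}. \<tau> k)"
            by (simp add: prod.union_disjoint)
          also have "(\<Prod>k\<in>(\<lambda>k. k + g) ` {..<P}. \<tau> k) = (\<Prod>k<P. \<tau> (k + g))"
            by (subst prod.reindex) (auto simp: inj_on_def)
          finally show ?thesis .
        qed
        also have "(\<Prod>k<P. \<tau> (k + g)) = card (Bt i)" using reg_card[OF b(2)] Bt that by metis
        finally show ?thesis by (simp add: c_def)
      qed
      define E where "E = (b ^ (2 * M + 1) * (2 * real n + 3)) ^ (g div P) * (\<Prod>k\<in>F1. \<rho> k / b) * real c ^ n"
      have E0: "E \<ge> 0" unfolding E_def using b by (intro mult_nonneg_nonneg prod_nonneg) auto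
      \<comment> \<open>Possible targets for the leading digits: the discarded remainders add up to
        at most \<open>(n + 1) * q\<close> in absolute value, so at most \<open>2 * n + 3\<close>
        values remain.\<close>
      define W where "W = {v::int. \<bar>real_of_int v - w / q\<bar> \<le> real n + 1}"
      have fW: "finite W" unfolding W_def by (rule card_int_interval(2)) simp
      have cW: "real (card W) \<le> 2 * real n + 3" using card_int_interval(1)[of "real n + 1" "w / q"] by (simp add: W_def)
      define tp where "tp = (\<lambda>(a, x). (a div q, \<lambda>i\<in>?I. x i div q))"
      have tpin: "tp p \<in> (\<Union>v\<in>W. solutions At ?I Bt e v)" if p: "p \<in> solutions A ?I B e w" for p
      proof -
        obtain a x where px: "p = (a, x)" by (cases p)
        have a: "a \<in> A" "x \<in> PiE ?I B" "a + (\<Sum>i<n. e i * x i) = w" using p px by (auto simp: solutions_def)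
        define v where "v = a div q + (\<Sum>i<n. e i * (x i div q))"
        have "w - v * q = a mod q + (\<Sum>i<n. e i * (x i mod q))"
          unfolding a(3)[symmetric] v_def distrib_right sum_distrib_right
          by (simp add: minus_div_mult_eq_mod[symmetric] sum_subtractf algebra_simps)
        moreover have "\<bar>\<Sum>i<n. e i * (x i mod q)\<bar> \<le> (\<Sum>i<n. q)"
        proof (rule order_trans[OF sum_abs sum_mono])
          fix i assume "i \<in> {..<n}"
          then show "\<bar>e i * (x i mod q)\<bar> \<le> q" using e q by (simp add: abs_mult less_imp_le)
        qed
        moreover have "0 \<le> a mod q" "a mod q \<le> q" using q by (auto simp: less_imp_le)
        ultimately have "\<bar>w - v * q\<bar> \<le> (int n + 1) * q" by (simp add: distrib_right)
        then have "real_of_int \<bar>w - v * q\<bar> \<le> real_of_int ((int n + 1) * q)" by (simp only: of_int_le_iff)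
        then have "\<bar>real_of_int v * q - w\<bar> \<le> (real n + 1) * q" by (simp add: abs_minus_commute)
        moreover have "real_of_int v * q - w = (real_of_int v - w / q) * q" using q by (simp add: left_diff_distrib)
        ultimately have "\<bar>real_of_int v - w / q\<bar> * q \<le> (real n + 1) * q" using q by (simp add: abs_mult)
        then have "v \<in> W" unfolding W_def using q by simp
        moreover have "tp p \<in> solutions At ?I Bt e v"
          using a by (auto simp: solutions_def tp_def px At_def Bt_def v_def PiE_iff)
        ultimately show ?thesis by blast
      qed
      \<comment> \<open>Solutions with prescribed leading digits are solutions in the fibres, where
        the induction hypothesis applies; every fibre of \<open>B i\<close> has the same size
        \<open>c\<close>.\<close>
      have piece: "real (card {p \<in> solutions A ?I B e w. tp p = t}) \<le> E" if t: "t \<in> solutions At ?I Bt e v" for t v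
      proof -
        obtain ya xt where te: "t = (ya, xt)" by (cases t)
        have tt: "ya \<in> At" "xt \<in> PiE ?I Bt" "ya + (\<Sum>i<n. e i * xt i) = v" using t te by (auto simp: solutions_def)
        obtain a0 where a0: "a0 \<in> A" "ya = a0 div q" using tt(1) by (auto simp: At_def)
        define As where "As = (\<lambda>x. x mod q) ` {x \<in> A. x div q = ya}"
        define Bs where "Bs i = (\<lambda>x. x mod q) ` {x \<in> B i. x div q = xt i}" for i
        have As: "reg b g \<rho> As" unfolding As_def a0(2) q_def using A h a0(1) by (intro reg_sub[OF b(2)]) auto
        have Bs: "reg b g \<tau> (Bs i)" "\<forall>x\<in>Bs i. central b g x" "card (Bs i) = c" if i: "i < n" for i
        proof -
          have "xt i \<in> Bt i" using tt(2) i by auto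
          then obtain x0 where x0: "x0 \<in> B i" "xt i = x0 div q" by (auto simp: Bt_def)
          have r: "reg b (P + g) \<tau> (B i)" using B i h by simp
          show s: "reg b g \<tau> (Bs i)" unfolding Bs_def x0(2) q_def by (rule reg_sub[OF b(2) r x0(1)])
          show "\<forall>x\<in>Bs i. central b g x" using B i h unfolding Bs_def q_def by (auto intro: central_sub)
          show "card (Bs i) = c" unfolding c_def by (rule reg_card[OF b(2) s])
        qed
        have fs': "finite (solutions As ?I Bs e (w - v * q))" using fA fB by (intro finite_solutions) (auto simp: As_def Bs_def)
        have "card {p \<in> solutions A ?I B e w. tp p = t} \<le> card (solutions As ?I Bs e (w - v * q))"
        proof (rule card_inj_on_le[OF _ _ fs'])
          show "inj_on (\<lambda>(a, x). (a mod q, \<lambda>i\<in>?I. x i mod q)) {p \<in> solutions A ?I B e w. tp p = t}"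
          proof (rule inj_onI)
            fix p p' assume p: "p \<in> {p \<in> solutions A ?I B e w. tp p = t}" "p' \<in> {p \<in> solutions A ?I B e w. tp p = t}"
              and eq: "(\<lambda>(a, x). (a mod q, \<lambda>i\<in>?I. x i mod q)) p = (\<lambda>(a, x). (a mod q, \<lambda>i\<in>?I. x i mod q)) p'"
            obtain a x a' x' where pp: "p = (a, x)" "p' = (a', x')" by (cases p, cases p')
            have d: "a div q = a' div q" "(\<lambda>i\<in>?I. x i div q) = (\<lambda>i\<in>?I. x' i div q)" using p pp by (auto simp: tp_def)
            have m: "a mod q = a' mod q" "(\<lambda>i\<in>?I. x i mod q) = (\<lambda>i\<in>?I. x' i mod q)" using eq pp by auto
            have "a = a'" using d(1) m(1) by (metis div_mult_mod_eq)
            moreover have "x = x'"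
            proof (rule PiE_ext[of x ?I B x'])
              fix i assume "i \<in> ?I"
              then have "x i div q = x' i div q" "x i mod q = x' i mod q" using d(2) m(2) by (metis restrict_apply')+
              then show "x i = x' i" by (metis div_mult_mod_eq)
            qed (use p pp in \<open>auto simp: solutions_def\<close>)
            ultimately show "p = p'" using pp by simp
          qed
          show "(\<lambda>(a, x). (a mod q, \<lambda>i\<in>?I. x i mod q)) ` {p \<in> solutions A ?I B e w. tp p = t} \<subseteq> solutions As ?I Bs e (w - v * q)"
          proof (rule image_subsetI)
            fix p assume p: "p \<in> {p \<in> solutions A ?I B e w. tp p = t}"
            obtain a x where pp: "p = (a, x)" by (cases p)
            have a: "a \<in> A" "x \<in> PiE ?I B" "a + (\<Sum>i<n. e i * x i) = w" using p pp by (auto simp: solutions_def)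
            have d: "a div q = ya" "(\<lambda>i\<in>?I. x i div q) = xt" using p pp te by (auto simp: tp_def)
            have dx: "x i div q = xt i" if "i < n" for i using d(2) that by (metis lessThan_iff restrict_apply')
            have v: "v = a div q + (\<Sum>i<n. e i * (x i div q))" using tt(3) d(1) dx by auto
            have "w - v * q = a mod q + (\<Sum>i<n. e i * (x i mod q))"
              unfolding a(3)[symmetric] v distrib_right sum_distrib_right
              by (simp add: minus_div_mult_eq_mod[symmetric] sum_subtractf algebra_simps)
            then show "(\<lambda>(a, x). (a mod q, \<lambda>i\<in>?I. x i mod q)) p \<in> solutions As ?I Bs e (w - v * q)"
              using a(1,2) d(1) dx unfolding pp by (auto simp: solutions_def As_def Bs_def PiE_iff)
          qed
        qed
        then have "real (card {p \<in> solutions A ?I B e w. tp p = t}) \<le> real (card (solutions As ?I Bs e (w - v * q)))" by simp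
        also have "\<dots> \<le> (b ^ (2 * M + 1) * (2 * real n + 3)) ^ (g div P) * (\<Prod>k\<in>F1. \<rho> k / b) * (\<Prod>i<n. real (card (Bs i)))"
          using Bs by (intro IH e As) auto
        also have "(\<Prod>i<n. real (card (Bs i))) = real c ^ n" using Bs(3) by simp
        finally show ?thesis by (simp add: E_def)
      qed
      let ?St = "\<Union>v\<in>W. solutions At ?I Bt e v"
      have fSt: "finite ?St" using fW fst' by auto
      have "card (solutions A ?I B e w) = (\<Sum>t\<in>?St. card {p \<in> solutions A ?I B e w. tp p = t})"
        using sum.group[OF fs fSt, of tp "\<lambda>_. 1::nat"] tpin by (simp add: image_subset_iff)
      then have "real (card (solutions A ?I B e w)) = (\<Sum>t\<in>?St. real (card {p \<in> solutions A ?I B e w. tp p = t}))" by simp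
      also have "\<dots> \<le> (\<Sum>t\<in>?St. E)" by (rule sum_mono) (use piece in blast)
      also have "\<dots> = real (card ?St) * E" by simp
      also have "\<dots> \<le> (\<Sum>v\<in>W. real (card (solutions At ?I Bt e v))) * E"
        using card_UN_le[OF fW, of "\<lambda>v. solutions At ?I Bt e v"] E0
        by (intro mult_right_mono) (simp_all flip: of_nat_sum)
      also have "\<dots> \<le> (\<Sum>v\<in>W. b ^ (2 * M + 1) * (\<Prod>k\<in>F2. \<rho> (k + g) / b) * (\<Prod>i<n. real (card (Bt i)))) * E"
        using E0 by (intro mult_right_mono sum_mono LB e At Bt)
      also have "\<dots> = real (card W) * (b ^ (2 * M + 1) * (\<Prod>k\<in>F2. \<rho> (k + g) / b) * (\<Prod>i<n. real (card (Bt i))) * E)" by simp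
      also have "\<dots> \<le> (2 * real n + 3) * (b ^ (2 * M + 1) * (\<Prod>k\<in>F2. \<rho> (k + g) / b) * (\<Prod>i<n. real (card (Bt i))) * E)"
        using cW E0 b by (intro mult_right_mono mult_nonneg_nonneg prod_nonneg) auto
      also have "\<dots> = (b ^ (2 * M + 1) * (2 * real n + 3)) ^ (h div P) * ((\<Prod>k\<in>F1. \<rho> k / b) * (\<Prod>k\<in>F2. \<rho> (k + g) / b)) *
          ((\<Prod>i<n. real (card (Bt i))) * real c ^ n)"
        by (simp add: E_def hd mult_ac)
      also have "(\<Prod>k\<in>F1. \<rho> k / b) * (\<Prod>k\<in>F2. \<rho> (k + g) / b) = (\<Prod>k\<in>F. \<rho> k / b)"
        unfolding F_def using fin disj by (subst prod.union_disjoint) (auto simp: prod.reindex inj_on_def)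
      also have "(\<Prod>i<n. real (card (Bt i))) * real c ^ n = (\<Prod>i<n. real (card (B i)))"
        using cB by (simp add: prod.distrib)
      finally show ?thesis .
    qed
    show ?thesis using FP cU main by (intro exI[of _ F]) blast
  qed
qed

end

section \<open>Translates, regular subsets and iterated convolution\<close>


text \<open>With \<open>b = 4 * c\<close>, a leading digit in \<open>{c..<3 * c}\<close> puts the
  point into the middle half of the root whatever its lower digits are, so each level costs a factor
  2.\<close>

lemma card_central:
  fixes b :: int
  assumes b: "b > 0" "4 dvd b"
  shows "b ^ h \<le> 2 ^ h * int (card {x \<in> {0..<b ^ h}. central b h x})"
proof (induction h)
  case 0
  have "{x \<in> {0..<b ^ 0}. central b 0 x} = {0}" by (auto simp: central_def)
  then show ?case by simp
next
  case (Suc h)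
  obtain c where c: "b = 4 * c" using b(2) by blast
  have c0: "c > 0" using b(1) c by simp
  let ?C = "\<lambda>h. {x \<in> {0..<b ^ h}. central b h x}"
  let ?f = "\<lambda>(y, z). y * b ^ h + z"
  have bh: "b ^ h > 0" using b by simp
  have "card ({c..<3 * c} \<times> ?C h) \<le> card (?C (Suc h))"
  proof (rule card_inj_on_le[of ?f])
    show "inj_on ?f ({c..<3 * c} \<times> ?C h)"
    proof (rule inj_onI)
      fix p p' assume p: "p \<in> {c..<3 * c} \<times> ?C h" "p' \<in> {c..<3 * c} \<times> ?C h" "?f p = ?f p'"
      obtain y z y' z' where e: "p = (y, z)" "p' = (y', z')" by (cases p, cases p')
      have z: "0 \<le> z" "z < b ^ h" "0 \<le> z'" "z' < b ^ h" using p e by auto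
      have eq: "y * b ^ h + z = y' * b ^ h + z'" using p(3) e by simp
      have "(y * b ^ h + z) div b ^ h = y" using z by (intro int_div_pos_eq[of _ _ _ z]) auto
      moreover have "(y' * b ^ h + z') div b ^ h = y'" using z by (intro int_div_pos_eq[of _ _ _ z']) auto
      ultimately have "y = y'" using eq by simp
      then show "p = p'" using p(3) e by simp
    qed
    show "?f ` ({c..<3 * c} \<times> ?C h) \<subseteq> ?C (Suc h)"
    proof (rule image_subsetI)
      fix p assume p: "p \<in> {c..<3 * c} \<times> ?C h"
      obtain y z where e: "p = (y, z)" by (cases p)
      have y: "c \<le> y" "y + 1 \<le> 3 * c" and z: "0 \<le> z" "z < b ^ h" "central b h z" using p e by auto
      define x where "x = y * b ^ h + z"
      have 1: "c * b ^ h \<le> y * b ^ h" using y bh by (intro mult_right_mono) auto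
      have 2: "(y + 1) * b ^ h \<le> (3 * c) * b ^ h" using y bh by (intro mult_right_mono) auto
      have bs: "b ^ Suc h = 4 * (c * b ^ h)" by (simp add: c)
      have x: "0 \<le> x" "b ^ Suc h \<le> 4 * x" "4 * x < 3 * b ^ Suc h" "x < b ^ Suc h"
      proof -
        have "c * b ^ h \<le> x" using 1 z(1) unfolding x_def by simp
        then show "b ^ Suc h \<le> 4 * x" unfolding bs by simp
        have "x < 3 * (c * b ^ h)" using 2 z unfolding x_def by (simp add: distrib_right)
        then have "4 * x < 4 * (3 * (c * b ^ h))" by (intro mult_strict_left_mono) auto
        then show "4 * x < 3 * b ^ Suc h" unfolding bs by (simp only: mult.left_commute)
        show "0 \<le> x" using \<open>b ^ Suc h \<le> 4 * x\<close> b by (smt (verit) zero_less_power)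
        then show "x < b ^ Suc h" using \<open>4 * x < 3 * b ^ Suc h\<close> by linarith
      qed
      have "central b (Suc h) x"
        unfolding central_def
      proof (intro allI impI)
        fix k assume k: "k < Suc h"
        show "b ^ Suc k \<le> 4 * (x mod b ^ Suc k) \<and> 4 * (x mod b ^ Suc k) < 3 * b ^ Suc k"
        proof (cases "k = h")
          case True
          then show ?thesis using x by (simp del: power_Suc)
        next
          case False
          then have kh: "k < h" using k by simp
          then have "b ^ Suc k dvd b ^ h" by (intro le_imp_power_dvd) simp
          then obtain d where d: "b ^ h = b ^ Suc k * d" by (rule dvdE)
          have "x = z + b ^ Suc k * (d * y)" unfolding x_def d by (simp add: mult_ac)
          then have "x mod b ^ Suc k = z mod b ^ Suc k" by (metis mod_mult_self2)
          then show ?thesis using z(3) kh by (simp add: central_def del: power_Suc)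
        qed
      qed
      then show "?f p \<in> ?C (Suc h)" using x unfolding e x_def by simp
    qed
    show "finite (?C (Suc h))" by (rule finite_subset[of _ "{0..<b ^ Suc h}"]) auto
  qed
  moreover have "card ({c..<3 * c} \<times> ?C h) = nat (2 * c) * card (?C h)" by (simp add: card_cartesian_product)
  ultimately have "nat (2 * c) * card (?C h) \<le> card (?C (Suc h))" by simp
  then have "int (nat (2 * c) * card (?C h)) \<le> int (card (?C (Suc h)))" by (simp only: of_nat_le_iff)
  then have "2 * c * int (card (?C h)) \<le> int (card (?C (Suc h)))" using c0 by simp
  have "b ^ Suc h = 4 * c * b ^ h" by (simp add: c)
  also have "\<dots> \<le> 4 * c * (2 ^ h * int (card (?C h)))" using Suc c0 by (intro mult_left_mono) auto
  also have "\<dots> = 2 ^ Suc h * (2 * c * int (card (?C h)))" by simp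
  also have "\<dots> \<le> 2 ^ Suc h * int (card (?C (Suc h)))"
    using \<open>2 * c * int (card (?C h)) \<le> int (card (?C (Suc h)))\<close> by (intro mult_left_mono) auto
  finally show ?case .
qed

lemma bij_betw_add_mod:
  assumes "N > 0"
  shows "bij_betw (\<lambda>z::int. (z + c) mod N) {0..<N} {0..<N}"
proof (rule bij_betw_byWitness[of _ "\<lambda>z. (z - c) mod N"])
  show "\<forall>a\<in>{0..<N}. ((a + c) mod N - c) mod N = a" by (auto simp: mod_diff_left_eq)
  show "\<forall>a\<in>{0..<N}. ((a - c) mod N + c) mod N = a" by (auto simp: mod_add_left_eq)
qed (use assms in auto)

text \<open>Averaging over all \<open>t\<close> modulo \<open>b ^ h\<close>: every point becomes
  central for as many \<open>t\<close> as there are central residues.\<close>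

lemma ex_central_translate:
  fixes b :: int
  assumes b: "b > 0" "4 dvd b" and X: "finite X"
  shows "\<exists>t. card X \<le> 2 ^ h * card {x \<in> X. central b h ((x + t) mod b ^ h)}"
proof (rule ccontr)
  assume "\<not> ?thesis"
  then have lt: "2 ^ h * card {x \<in> X. central b h ((x + t) mod b ^ h)} < card X" for t by (simp add: not_le)
  define N where "N = b ^ h"
  have N: "N > 0" using b by (simp add: N_def)
  let ?Z = "{0..<N}"
  let ?C = "{x \<in> ?Z. central b h x}"
  have "(\<Sum>t\<in>?Z. card {x \<in> X. central b h ((x + t) mod N)}) = (\<Sum>t\<in>?Z. \<Sum>x\<in>X. if central b h ((x + t) mod N) then 1 else 0)"
    using X by (simp add: sum.inter_filter[symmetric])
  also have "\<dots> = (\<Sum>x\<in>X. \<Sum>t\<in>?Z. if central b h ((x + t) mod N) then 1 else 0)" by (rule sum.swap)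
  also have "\<dots> = (\<Sum>x\<in>X. \<Sum>t\<in>?Z. if central b h t then 1 else 0)"
  proof (rule sum.cong[OF refl])
    fix x
    show "(\<Sum>t\<in>?Z. if central b h ((x + t) mod N) then 1 else 0) = (\<Sum>t\<in>?Z. if central b h t then 1 else 0 :: nat)"
      using sum.reindex_bij_betw[OF bij_betw_add_mod[OF N, of x], of "\<lambda>t. if central b h t then 1 else 0 :: nat"]
      by (simp add: add.commute)
  qed
  also have "\<dots> = card X * card ?C" by (simp add: sum.inter_filter[symmetric])
  finally have eq: "(\<Sum>t\<in>?Z. card {x \<in> X. central b h ((x + t) mod N)}) = card X * card ?C" .
  have "(\<Sum>t\<in>?Z. 2 ^ h * card {x \<in> X. central b h ((x + t) mod N)}) < (\<Sum>t\<in>?Z. card X)"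
    using lt N unfolding N_def by (intro sum_strict_mono) auto
  then have "2 ^ h * (card X * card ?C) < nat N * card X" unfolding sum_distrib_left[symmetric] eq by simp
  then have "(2 ^ h * card ?C) * card X < nat N * card X" by (simp add: mult_ac)
  then have "2 ^ h * card ?C < nat N" by simp
  then have "int (2 ^ h * card ?C) < N" using N by linarith
  then show False using card_central[OF b, of h] unfolding N_def by simp
qed

text \<open>Centrality is arranged first, because it passes to subsets, and regularity afterwards.
  The losses per level are 2 and \<open>2 * (D + 1)\<close>.\<close>

lemma ex_regular_subset:
  fixes D h :: nat
  defines "b \<equiv> (2::int) ^ D"
  assumes D: "D \<ge> 2" and X: "X \<subseteq> {0..<b ^ h}" "X \<noteq> {}"
  shows "\<exists>Y\<subseteq>X. \<exists>t \<rho>. reg b h \<rho> ((\<lambda>x. (x + t) mod b ^ h) ` Y) \<and> (\<forall>x\<in>Y. central b h ((x + t) mod b ^ h)) \<and>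
    Y \<noteq> {} \<and> card X \<le> (4 * (D + 1)) ^ h * card Y"
proof -
  have b: "b > 0" "4 dvd b" using le_imp_power_dvd[OF D, of "2::int"] by (auto simp: b_def)
  define N where "N = b ^ h"
  have N: "N > 0" using b by (simp add: N_def)
  have fX: "finite X" using X finite_subset by blast
  obtain t where t: "card X \<le> 2 ^ h * card {x \<in> X. central b h ((x + t) mod N)}"
    using ex_central_translate[OF b fX, of h] unfolding N_def by blast
  define X1 where "X1 = {x \<in> X. central b h ((x + t) mod N)}"
  let ?f = "\<lambda>x. (x + t) mod N"
  have inj: "inj_on ?f X" using bij_betw_imp_inj_on[OF bij_betw_add_mod[OF N, of t]] X(1) unfolding N_def by (rule inj_on_subset)
  have "card X > 0" using fX X by (simp add: card_gt_0_iff)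
  then have "card X1 \<noteq> 0" using t unfolding X1_def[symmetric] by (metis mult_0_right not_le)
  then have X1: "X1 \<noteq> {}" "X1 \<subseteq> X" by (metis card.empty, simp add: X1_def)
  obtain Z \<rho> where Z: "Z \<subseteq> ?f ` X1" "reg b h \<rho> Z" "card (?f ` X1) \<le> (2 * (D + 1)) ^ h * card Z"
  proof -
    have "1 \<le> D" "?f ` X1 \<subseteq> {0..<b ^ h}" "?f ` X1 \<noteq> {}" using D X1 N by (auto simp: N_def)
    from reg_uniformize[OF this[unfolded b_def], folded b_def] show ?thesis
      by (elim exE conjE) (rule that)
  qed
  obtain Y where Y: "Y \<subseteq> X1" "Z = ?f ` Y" using Z(1) by (meson subset_imageE)
  have "Y \<noteq> {}" using Z(2) Y by (auto simp: reg_def)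
  have cY: "card Z = card Y" unfolding Y(2) using inj_on_subset[OF inj] Y(1) X1(2) by (intro card_image) blast
  have cX1: "card (?f ` X1) = card X1" using inj_on_subset[OF inj X1(2)] by (rule card_image)
  have "card X \<le> 2 ^ h * card X1" using t by (simp add: X1_def)
  also have "\<dots> \<le> 2 ^ h * ((2 * (D + 1)) ^ h * card Y)" using Z(3) cY cX1 by simp
  also have "\<dots> = (4 * (D + 1)) ^ h * card Y"
  proof -
    have "2 ^ h * (2 * (D + 1)) ^ h = (4 * (D + 1)) ^ h" unfolding power_mult_distrib[symmetric] mult.assoc[symmetric] by (simp only: numeral_times_numeral num.simps mult_num_simps)
    then show ?thesis by (simp only: mult.assoc[symmetric])
  qed
  finally show ?thesis using Y X1 Z(2) \<open>Y \<noteq> {}\<close> unfolding N_def X1_def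
    by (intro exI[of _ Y] conjI exI[of _ t] exI[of _ \<rho>]) auto
qed

section \<open>Correlation operators on the integers modulo N\<close>

definition shift_sum :: "int set \<Rightarrow> int \<Rightarrow> (int \<Rightarrow> real) \<Rightarrow> int \<Rightarrow> real" where
  "shift_sum B e f z = (\<Sum>x\<in>B. f (z + e * x))"

definition inner_mod :: "int \<Rightarrow> (int \<Rightarrow> real) \<Rightarrow> (int \<Rightarrow> real) \<Rightarrow> real" where
  "inner_mod N f g = (\<Sum>z\<in>{0..<N}. f z * g z)"

text \<open>Functions on the cyclic group are represented by periodic functions on
  \<open>int\<close>, so that shifts need no reduction.\<close>

definition periodic :: "int \<Rightarrow> (int \<Rightarrow> real) \<Rightarrow> bool" where
  "periodic N f \<longleftrightarrow> (\<forall>x. f (x mod N) = f x)"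

lemma sum_periodic_shift:
  assumes "N > 0" "periodic N h"
  shows "(\<Sum>z\<in>{0..<N}. h (z + c)) = (\<Sum>z\<in>{0..<N}. h z)"
  using sum.reindex_bij_betw[OF bij_betw_add_mod[OF assms(1), of c], of h] assms(2) by (simp add: periodic_def)

lemma periodic_shift: "periodic N f \<Longrightarrow> periodic N (\<lambda>z. f (z + c))"
  unfolding periodic_def by (metis mod_add_left_eq)

lemma periodic_shift_sum: "periodic N f \<Longrightarrow> periodic N (shift_sum B e f)"
  unfolding periodic_def shift_sum_def by (metis (no_types, lifting) mod_add_left_eq sum.cong)

lemma inner_shift_sum:
  assumes N: "N > 0" and f: "periodic N f" and g: "periodic N g"
  shows "inner_mod N (shift_sum B e f) g = inner_mod N f (shift_sum B (- e) g)"
proof -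
  have "inner_mod N (shift_sum B e f) g = (\<Sum>z\<in>{0..<N}. \<Sum>x\<in>B. f (z + e * x) * g z)"
    by (simp add: inner_mod_def shift_sum_def sum_distrib_right)
  also have "\<dots> = (\<Sum>x\<in>B. \<Sum>z\<in>{0..<N}. f (z + e * x) * g z)" by (rule sum.swap)
  also have "\<dots> = (\<Sum>x\<in>B. \<Sum>z\<in>{0..<N}. f z * g (z + - e * x))"
  proof (rule sum.cong[OF refl])
    fix x
    have "periodic N (\<lambda>z. f z * g (z + - e * x))"
      using f periodic_shift[OF g, of "- e * x"] by (simp add: periodic_def)
    from sum_periodic_shift[OF N this, of "e * x"]
    show "(\<Sum>z\<in>{0..<N}. f (z + e * x) * g z) = (\<Sum>z\<in>{0..<N}. f z * g (z + - e * x))" by simp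
  qed
  also have "\<dots> = (\<Sum>z\<in>{0..<N}. \<Sum>x\<in>B. f z * g (z + - e * x))" by (rule sum.swap)
  also have "\<dots> = inner_mod N f (shift_sum B (- e) g)"
    by (simp add: inner_mod_def shift_sum_def sum_distrib_left)
  finally show ?thesis .
qed

lemma inner_mod_CS: "(inner_mod N f g)\<^sup>2 \<le> inner_mod N f f * inner_mod N g g"
proof (cases "inner_mod N g g = 0")
  case True
  then have "\<forall>z\<in>{0..<N}. g z * g z = 0"
    unfolding inner_mod_def by (subst (asm) sum_nonneg_eq_0_iff) auto
  then have "inner_mod N f g = 0" by (simp add: inner_mod_def)
  then show ?thesis using True by simp
next
  case False
  have "0 \<le> inner_mod N g g" unfolding inner_mod_def by (intro sum_nonneg) simp
  then have g: "inner_mod N g g > 0" using False by simp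
  define t where "t = inner_mod N f g / inner_mod N g g"
  have "0 \<le> (\<Sum>z\<in>{0..<N}. (f z - t * g z)\<^sup>2)" by (intro sum_nonneg) simp
  also have "\<dots> = inner_mod N f f - 2 * t * inner_mod N f g + t\<^sup>2 * inner_mod N g g"
    unfolding inner_mod_def sum_distrib_left sum_subtractf[symmetric] sum.distrib[symmetric]
    by (intro sum.cong) (auto simp: power2_eq_square algebra_simps)
  also have "\<dots> = inner_mod N f f - (inner_mod N f g)\<^sup>2 / inner_mod N g g"
    using g by (simp add: t_def power2_eq_square field_simps)
  finally show ?thesis using g by (simp add: field_simps)
qed

text \<open>By \<open>inner_shift_sum\<close> the two factors are adjoint to each other, so this is
  a positive operator. It is not normalised: total mass is multiplied by the square of
  \<open>card B\<close>.\<close>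

definition walk :: "int set \<Rightarrow> (int \<Rightarrow> real) \<Rightarrow> int \<Rightarrow> real" where
  "walk B f = shift_sum B 1 (shift_sum B (- 1) f)"

lemma periodic_walk: "periodic N f \<Longrightarrow> periodic N ((walk B ^^ k) f)"
  by (induction k) (auto simp: walk_def intro: periodic_shift_sum)

lemma inner_walk:
  assumes "N > 0" "periodic N f" "periodic N g"
  shows "inner_mod N ((walk B ^^ k) f) g = inner_mod N f ((walk B ^^ k) g)"
  using assms(3)
proof (induction k arbitrary: g)
  case (Suc k)
  have "inner_mod N ((walk B ^^ Suc k) f) g = inner_mod N ((walk B ^^ k) f) (walk B g)"
    using inner_shift_sum[OF assms(1), of _ _ B] assms(2) Suc.prems
    by (simp add: walk_def periodic_shift_sum periodic_walk)
  also have "\<dots> = inner_mod N f ((walk B ^^ k) (walk B g))"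
    using Suc.prems by (intro Suc.IH) (auto simp: walk_def intro: periodic_shift_sum)
  finally show ?case by (simp add: funpow_swap1)
qed simp

text \<open>Cauchy--Schwarz for the self-adjoint walk operator makes the correlation of an even power
  at least the square of that of its half.\<close>

lemma walk_correlation:
  assumes N: "N > 0" and f: "periodic N f" and c: "inner_mod N f f > 0" "c \<ge> 0"
    and E: "inner_mod N (walk B f) f \<ge> c * inner_mod N f f"
  shows "inner_mod N ((walk B ^^ (2 ^ j)) f) f \<ge> c ^ (2 ^ j) * inner_mod N f f"
proof (induction j)
  case 0
  then show ?case using E by simp
next
  case (Suc j)
  let ?g = "(walk B ^^ (2 ^ j)) f"
  have "(c ^ (2 ^ j) * inner_mod N f f)\<^sup>2 \<le> (inner_mod N ?g f)\<^sup>2"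
    using Suc c by (intro power_mono) auto
  also have "\<dots> \<le> inner_mod N ?g ?g * inner_mod N f f" by (rule inner_mod_CS)
  also have "inner_mod N ?g ?g = inner_mod N ((walk B ^^ (2 ^ j)) ?g) f"
    using inner_walk[OF N periodic_walk[OF f] f] by simp
  also have "(walk B ^^ (2 ^ j)) ?g = (walk B ^^ (2 ^ Suc j)) f"
    by (simp add: funpow_add mult_2)
  finally have "(c ^ (2 ^ j) * inner_mod N f f)\<^sup>2 \<le> inner_mod N ((walk B ^^ (2 ^ Suc j)) f) f * inner_mod N f f" .
  then have "(c ^ (2 ^ Suc j) * inner_mod N f f) * inner_mod N f f \<le> inner_mod N ((walk B ^^ (2 ^ Suc j)) f) f * inner_mod N f f"
    by (simp add: power2_eq_square power_mult_distrib mult_ac power_add[symmetric] mult_2)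
  then show ?case using c(1) by simp
qed

lemma sum_PiE_Suc:
  fixes F :: "(nat \<Rightarrow> int) \<Rightarrow> real"
  assumes "finite B"
  shows "(\<Sum>x\<in>PiE {..<Suc m} (\<lambda>_. B). F x) = (\<Sum>x\<in>PiE {..<m} (\<lambda>_. B). \<Sum>y\<in>B. F (x(m := y)))"
proof -
  have "PiE {..<Suc m} (\<lambda>_. B) = (\<lambda>(y, x). x(m := y)) ` (B \<times> PiE {..<m} (\<lambda>_. B))"
    by (simp add: lessThan_Suc PiE_insert_eq)
  moreover have "inj_on (\<lambda>(y, x). x(m := y)) (B \<times> PiE {..<m} (\<lambda>_. B))"
    by (rule inj_combinator) simp
  ultimately have "(\<Sum>x\<in>PiE {..<Suc m} (\<lambda>_. B). F x) = (\<Sum>p\<in>B \<times> PiE {..<m} (\<lambda>_. B). F ((snd p)(m := fst p)))"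
    by (simp add: sum.reindex case_prod_unfold)
  also have "\<dots> = (\<Sum>y\<in>B. \<Sum>x\<in>PiE {..<m} (\<lambda>_. B). F (x(m := y)))"
    by (simp only: sum.cartesian_product case_prod_unfold)
  also have "\<dots> = (\<Sum>x\<in>PiE {..<m} (\<lambda>_. B). \<Sum>y\<in>B. F (x(m := y)))" by (rule sum.swap)
  finally show ?thesis .
qed

definition alt :: "nat \<Rightarrow> int" where "alt i = (if even i then 1 else - 1)"

text \<open>The link between the operator and the solution counts: a power of the operator is a walk
  whose steps from \<open>B\<close> carry alternating signs.\<close>

lemma walk_expand:
  assumes B: "finite B"
  shows "(walk B ^^ k) f z = (\<Sum>x\<in>PiE {..<2 * k} (\<lambda>_. B). f (z + (\<Sum>i<2 * k. alt i * x i)))"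
proof (induction k arbitrary: f)
  case 0
  then show ?case by simp
next
  case (Suc k)
  have e: "2 * Suc k = Suc (Suc (2 * k))" by simp
  have upd: "(\<Sum>i<Suc (Suc (2 * k)). alt i * ((x(2 * k := y))(Suc (2 * k) := y')) i) = (\<Sum>i<2 * k. alt i * x i) + y - y'"
    for x :: "nat \<Rightarrow> int" and y y'
    by (simp add: alt_def)
  have "(walk B ^^ Suc k) f z = (\<Sum>x\<in>PiE {..<2 * k} (\<lambda>_. B). walk B f (z + (\<Sum>i<2 * k. alt i * x i)))"
    unfolding funpow_Suc_right o_def by (rule Suc)
  also have "\<dots> = (\<Sum>x\<in>PiE {..<2 * k} (\<lambda>_. B). \<Sum>y\<in>B. \<Sum>y'\<in>B. f (z + ((\<Sum>i<2 * k. alt i * x i) + y - y')))"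
    by (simp add: walk_def shift_sum_def algebra_simps)
  also have "\<dots> = (\<Sum>x\<in>PiE {..<2 * Suc k} (\<lambda>_. B). f (z + (\<Sum>i<2 * Suc k. alt i * x i)))"
    unfolding e sum_PiE_Suc[OF B] upd ..
  finally show ?case .
qed

definition ind_mod :: "int \<Rightarrow> int set \<Rightarrow> int \<Rightarrow> real" where
  "ind_mod N A z = (if z mod N \<in> A then 1 else 0)"

lemma periodic_ind_mod: "periodic N (ind_mod N A)"
  by (simp add: periodic_def ind_mod_def)

lemma inner_ind_mod:
  assumes "A \<subseteq> {0..<N}"
  shows "inner_mod N f (ind_mod N A) = (\<Sum>z\<in>A. f z)"
proof -
  have "inner_mod N f (ind_mod N A) = (\<Sum>z\<in>{0..<N}. if z \<in> A then f z else 0)"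
    by (auto simp: inner_mod_def ind_mod_def intro!: sum.cong)
  also have "\<dots> = (\<Sum>z\<in>{0..<N} \<inter> A. f z)" by (rule sum.inter_restrict[symmetric]) simp
  also have "{0..<N} \<inter> A = A" using assms by auto
  finally show ?thesis .
qed

text \<open>A reverse Markov inequality: points below half of the guaranteed average contribute at
  most half of the guaranteed total.\<close>

lemma popular_subset:
  fixes w :: "'a \<Rightarrow> real"
  assumes "finite X" "\<And>x. x \<in> X \<Longrightarrow> w x \<le> W" "W > 0" "(\<Sum>x\<in>X. w x) \<ge> r * W * card X"
  shows "r / 2 * card X \<le> card {x \<in> X. w x \<ge> r / 2 * W}"
proof (cases "r \<ge> 0")
  case True
  let ?Y = "{x \<in> X. w x \<ge> r / 2 * W}"
  have "r * W * card X \<le> (\<Sum>x\<in>?Y. w x) + (\<Sum>x\<in>X - ?Y. w x)"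
    using assms(4) sum.subset_diff[of ?Y X w] assms(1) by simp
  also have "\<dots> \<le> (\<Sum>x\<in>?Y. W) + (\<Sum>x\<in>X - ?Y. r / 2 * W)"
    using assms(2) by (intro add_mono sum_mono) auto
  also have "\<dots> \<le> card ?Y * W + card X * (r / 2 * W)"
    using assms(1,3) True by (auto intro!: mult_right_mono card_mono)
  finally have "(r / 2 * card X) * W \<le> card ?Y * W" by (simp add: field_simps)
  then show ?thesis using assms(3) by simp
next
  case False
  then have "r / 2 * card X \<le> 0" by (simp add: mult_nonpos_nonneg)
  then show ?thesis by (smt (verit) of_nat_0_le_iff)
qed

text \<open>The energy is the correlation of \<open>A\<close> with its image under one application
  of \<open>walk B\<close>. Doubling the exponent \<open>j\<close> times by
  \<open>walk_correlation\<close> and then using \<open>popular_subset\<close> gives many starting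
  points from which the long walk often ends in \<open>A\<close>.\<close>

lemma ex_popular_differences:
  fixes j :: nat and \<sigma> :: real
  assumes N: "N > 0" and A: "A \<subseteq> {0..<N}" "A \<noteq> {}" and B: "finite B" "B \<noteq> {}" and \<sigma>: "\<sigma> \<ge> 0"
    and E: "inner_mod N (shift_sum B (- 1) (ind_mod N A)) (shift_sum B (- 1) (ind_mod N A)) \<ge> \<sigma> * card A * (card B)\<^sup>2"
  defines "r \<equiv> \<sigma> ^ (2 ^ j)" and "w \<equiv> (walk B ^^ (2 ^ j)) (ind_mod N A)"
  shows "r / 2 * card A \<le> card {a \<in> A. w a \<ge> r / 2 * card B ^ (2 ^ Suc j)}"
proof (rule popular_subset)
  let ?f = "ind_mod N A"
  have fA: "finite A" using A finite_subset by blast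
  show "finite A" by fact
  have ff: "inner_mod N ?f ?f = card A"
    unfolding inner_ind_mod[OF A(1)] using A by (subst sum.cong[of A A ?f "\<lambda>_. 1"]) (auto simp: ind_mod_def)
  have cA: "card A > 0" using fA A by (simp add: card_gt_0_iff)
  have cB: "card B > 0" using B by (simp add: card_gt_0_iff)
  have "inner_mod N (walk B ?f) ?f = inner_mod N (shift_sum B (- 1) ?f) (shift_sum B (- 1) ?f)"
    unfolding walk_def
    using inner_shift_sum[OF N periodic_shift_sum[OF periodic_ind_mod] periodic_ind_mod, of B 1 B "-1" A A] by simp
  then have "inner_mod N (walk B ?f) ?f \<ge> (\<sigma> * (card B)\<^sup>2) * inner_mod N ?f ?f" using E ff by (simp add: mult_ac)
  then have "inner_mod N w ?f \<ge> (\<sigma> * (card B)\<^sup>2) ^ (2 ^ j) * inner_mod N ?f ?f"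
    unfolding w_def using ff cA \<sigma> by (intro walk_correlation N periodic_ind_mod) auto
  then have "(\<Sum>a\<in>A. w a) \<ge> (\<sigma> * (card B)\<^sup>2) ^ (2 ^ j) * card A" unfolding inner_ind_mod[OF A(1)] ff[unfolded inner_ind_mod[OF A(1)]] .
  also have "(\<sigma> * real ((card B)\<^sup>2)) ^ (2 ^ j) = r * card B ^ (2 ^ Suc j)"
    by (simp add: r_def power_mult_distrib power_mult[symmetric])
  finally show "r * real (card B ^ 2 ^ Suc j) * card A \<le> (\<Sum>a\<in>A. w a)" by simp
  show "real (card B ^ 2 ^ Suc j) > 0" using cB by simp
  fix a assume "a \<in> A"
  have "w a \<le> (\<Sum>x\<in>PiE {..<2 * 2 ^ j :: nat} (\<lambda>_. B). 1)"
    unfolding w_def walk_expand[OF B(1)] by (intro sum_mono) (simp add: ind_mod_def)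
  also have "\<dots> = card B ^ 2 ^ Suc j" by (simp add: card_PiE)
  finally show "w a \<le> real (card B ^ 2 ^ Suc j)" by simp
qed

text \<open>Every returning walk is a solution for one of finitely many integer targets, given by an
  endpoint in \<open>A0\<close> and by the multiple of \<open>N\<close> lost in reducing. The
  separate translations of \<open>A\<close> and \<open>B\<close> merely shift the target by the
  constant \<open>s\<close>.\<close>

lemma walk_count_bound:
  fixes tA tB :: int
  assumes N: "N > 0" and A0: "A0 \<subseteq> {0..<N}" and A: "A \<subseteq> {0..<N}" and B: "B \<subseteq> {0..<N}"
  defines "As \<equiv> (\<lambda>x. (x + tA) mod N) ` A" and "Bs \<equiv> (\<lambda>x. (x + tB) mod N) ` B"
  assumes L: "\<And>v. real (card (solutions As {..<2 * k} (\<lambda>_. Bs) alt v)) \<le> \<Lambda>"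
  shows "(\<Sum>a\<in>A. (walk B ^^ k) (ind_mod N A0) a) \<le> card A0 * (2 * real (2 * k) + 3) * \<Lambda>"
proof -
  let ?I = "{..<2 * k}"
  have fin: "finite A0" "finite A" "finite B" using A0 A B finite_subset by blast+
  define X where "X = PiE ?I (\<lambda>_. B)"
  have fX: "finite X" using fin by (auto simp: X_def intro!: finite_PiE)
  define Q where "Q = {p \<in> A \<times> X. (fst p + (\<Sum>i\<in>?I. alt i * snd p i)) mod N \<in> A0}"
  have "(\<Sum>a\<in>A. (walk B ^^ k) (ind_mod N A0) a) = (\<Sum>a\<in>A. \<Sum>x\<in>X. if (a + (\<Sum>i\<in>?I. alt i * x i)) mod N \<in> A0 then 1 else 0)"
    unfolding walk_expand[OF fin(3)] X_def ind_mod_def ..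
  also have "\<dots> = (\<Sum>p\<in>A \<times> X. if (fst p + (\<Sum>i\<in>?I. alt i * snd p i)) mod N \<in> A0 then 1 else 0)"
    by (simp only: sum.cartesian_product case_prod_unfold)
  also have "\<dots> = real (card Q)" unfolding Q_def using fin fX by (simp add: sum.inter_filter[symmetric])
  finally have Q: "(\<Sum>a\<in>A. (walk B ^^ k) (ind_mod N A0) a) = real (card Q)" .
  define s where "s = tA + (\<Sum>i\<in>?I. alt i * tB)"
  define \<phi> where "\<phi> = (\<lambda>p :: int \<times> (nat \<Rightarrow> int). ((fst p + tA) mod N, \<lambda>i\<in>?I. (snd p i + tB) mod N))"
  \<comment> \<open>Each of the \<open>2 * k + 1\<close> reduced terms is below \<open>N\<close> in
    absolute value, so the wrap-around is one of \<open>4 * k + 3\<close> integers.\<close>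
  define U where "U = {- int (2 * k + 1)..int (2 * k + 1)}"
  let ?R = "\<Union>(c, u)\<in>A0 \<times> U. solutions As ?I (\<lambda>_. Bs) alt ((c + s) mod N + N * u)"
  have inj0: "inj_on (\<lambda>x. (x + t) mod N) {0..<N}" for t by (rule bij_betw_imp_inj_on[OF bij_betw_add_mod[OF N]])
  have fS: "finite (solutions As ?I (\<lambda>_. Bs) alt v)" for v
    using fin by (intro finite_solutions) (auto simp: As_def Bs_def)
  have fR: "finite ?R" using fin fS by (intro finite_UN_I) (auto simp: U_def)
  have "card Q \<le> card ?R"
  proof (rule card_inj_on_le[OF _ _ fR])
    show "inj_on \<phi> Q"
    proof (rule inj_onI)
      fix p p' assume p: "p \<in> Q" "p' \<in> Q" "\<phi> p = \<phi> p'"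
      have f: "fst p \<in> A" "fst p' \<in> A" "snd p \<in> X" "snd p' \<in> X" using p by (auto simp: Q_def)
      have "(fst p + tA) mod N = (fst p' + tA) mod N" using p(3) by (simp add: \<phi>_def)
      then have "fst p = fst p'" using inj_onD[OF inj0] f A by blast
      moreover have "snd p = snd p'"
      proof (rule PiE_ext)
        show "snd p \<in> PiE ?I (\<lambda>_. B)" "snd p' \<in> PiE ?I (\<lambda>_. B)" using f by (auto simp: X_def)
        fix i assume i: "i \<in> ?I"
        then have "snd p i \<in> B" "snd p' i \<in> B" using f by (auto simp: X_def)
        moreover have "(snd p i + tB) mod N = (snd p' i + tB) mod N"
          using p(3) i unfolding \<phi>_def by (metis (no_types, lifting) prod.inject restrict_apply')
        ultimately show "snd p i = snd p' i" using inj_onD[OF inj0] B by blast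
      qed
      ultimately show "p = p'" by (rule prod_eqI)
    qed
    show "\<phi> ` Q \<subseteq> ?R"
    proof (rule image_subsetI)
      fix p assume p: "p \<in> Q"
      obtain a x where px: "p = (a, x)" by (cases p)
      have ax: "a \<in> A" "x \<in> PiE ?I (\<lambda>_. B)" "(a + (\<Sum>i\<in>?I. alt i * x i)) mod N \<in> A0"
        using p px by (auto simp: Q_def X_def)
      define c where "c = (a + (\<Sum>i\<in>?I. alt i * x i)) mod N"
      define v where "v = (a + tA) mod N + (\<Sum>i\<in>?I. alt i * ((x i + tB) mod N))"
      have "v mod N = (a + tA + (\<Sum>i\<in>?I. alt i * (x i + tB))) mod N"
      proof -
        have "(\<Sum>i\<in>?I. alt i * ((x i + tB) mod N)) mod N = (\<Sum>i\<in>?I. alt i * (x i + tB)) mod N"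
          by (subst (1 2) mod_sum_eq[symmetric]) (simp add: mod_mult_right_eq)
        then show ?thesis unfolding v_def by (rule mod_add_cong[OF mod_mod_trivial])
      qed
      also have "a + tA + (\<Sum>i\<in>?I. alt i * (x i + tB)) = (a + (\<Sum>i\<in>?I. alt i * x i)) + s"
        by (simp add: s_def distrib_left sum.distrib)
      also have "\<dots> mod N = (c + s) mod N" unfolding c_def by (simp add: mod_add_left_eq)
      finally have vm: "v = (c + s) mod N + N * (v div N)" by (metis mod_mult_div_eq)
      have "\<bar>\<Sum>i\<in>?I. alt i * ((x i + tB) mod N)\<bar> \<le> (\<Sum>i\<in>?I. N)"
      proof (rule order_trans[OF sum_abs sum_mono])
        fix i
        show "\<bar>alt i * ((x i + tB) mod N)\<bar> \<le> N" using N by (simp add: alt_def less_imp_le)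
      qed
      moreover have "0 \<le> (a + tA) mod N" "(a + tA) mod N < N" using N by auto
      ultimately have "\<bar>v\<bar> \<le> int (2 * k + 1) * N" unfolding v_def by (simp add: algebra_simps)
      then have "- int (2 * k + 1) * N \<le> v" "v \<le> int (2 * k + 1) * N" by (simp_all only: mult_minus_left abs_le_iff) linarith
      then have "- int (2 * k + 1) \<le> v div N" "v div N \<le> int (2 * k + 1)"
        using N zdiv_mono1[of "- int (2 * k + 1) * N" v N] zdiv_mono1[of v "int (2 * k + 1) * N" N] by auto
      then have "v div N \<in> U" by (simp add: U_def)
      moreover have "\<phi> p \<in> solutions As ?I (\<lambda>_. Bs) alt v"
      proof -
        have "(a + tA) mod N \<in> As" using ax(1) by (simp add: As_def)
        moreover have "(\<lambda>i\<in>?I. (x i + tB) mod N) \<in> PiE ?I (\<lambda>_. Bs)"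
        proof (rule restrict_PiE_iff[THEN iffD2], rule ballI)
          fix i assume "i \<in> ?I"
          then have "x i \<in> B" using ax(2) by (rule PiE_mem[rotated])
          then show "(x i + tB) mod N \<in> Bs" by (simp add: Bs_def)
        qed
        ultimately show ?thesis by (simp add: solutions_def \<phi>_def px v_def)
      qed
      ultimately show "\<phi> p \<in> ?R" using ax(3) vm unfolding c_def[symmetric]
        by (intro UN_I[of "(c, v div N)"]) auto
    qed
  qed
  also have "\<dots> \<le> (\<Sum>cu\<in>A0 \<times> U. card (solutions As ?I (\<lambda>_. Bs) alt ((fst cu + s) mod N + N * snd cu)))"
    unfolding case_prod_unfold using fin by (intro card_UN_le) (auto simp: U_def)
  finally have "real (card Q) \<le> (\<Sum>cu\<in>A0 \<times> U. real (card (solutions As ?I (\<lambda>_. Bs) alt ((fst cu + s) mod N + N * snd cu))))"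
    by (simp flip: of_nat_sum)
  also have "\<dots> \<le> (\<Sum>cu\<in>A0 \<times> U. \<Lambda>)" using L by (intro sum_mono)
  also have "\<dots> = card A0 * (2 * real (2 * k) + 3) * \<Lambda>" by (simp add: card_cartesian_product U_def)
  finally show ?thesis using Q by simp
qed

section \<open>From the q-norm of a convolution to its energy\<close>

lemma powr_threshold:
  fixes r \<beta> \<tau> q :: real
  assumes "0 \<le> r" "r \<le> \<beta>" "0 < \<tau>" "1 < q"
  shows "r powr q \<le> \<tau> powr (q - 1) * \<beta> powr (q - 1) * r + \<beta> powr (q - 2) * r\<^sup>2 / \<tau>"
proof (cases "r = 0")
  case False
  then have r: "r > 0" "\<beta> > 0" using assms by auto
  have rq: "r powr q = r powr (q - 1) * r" using r by (simp add: powr_diff)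
  show ?thesis
  \<comment> \<open>Small values are charged to the linear term and large ones to the quadratic
    term; splitting at a threshold treats \<open>q < 2\<close> and \<open>q > 2\<close>
    alike.\<close>
  proof (cases "r \<le> \<tau> * \<beta>")
    case True
    then have "r powr (q - 1) \<le> (\<tau> * \<beta>) powr (q - 1)" using assms r by (intro powr_mono2) auto
    then have "r powr q \<le> \<tau> powr (q - 1) * \<beta> powr (q - 1) * r"
      unfolding rq using assms r by (simp add: powr_mult)
    then show ?thesis using assms r by (smt (verit) divide_nonneg_pos mult_nonneg_nonneg powr_ge_zero zero_le_power2)
  next
    case False
    have "r powr (q - 1) \<le> \<beta> powr (q - 1)" using assms r by (intro powr_mono2) auto
    also have "\<dots> = \<beta> powr (q - 2) * \<beta>" using r by (simp add: powr_diff powr_add power2_eq_square)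
    also have "\<dots> \<le> \<beta> powr (q - 2) * (r / \<tau>)" using False assms r by (intro mult_left_mono) (auto simp: field_simps)
    finally have "r powr q \<le> \<beta> powr (q - 2) * (r / \<tau>) * r" unfolding rq using r by (intro mult_right_mono) auto
    then have "r powr q \<le> \<beta> powr (q - 2) * r\<^sup>2 / \<tau>" by (simp add: power2_eq_square)
    moreover have "0 \<le> \<tau> powr (q - 1) * \<beta> powr (q - 1) * r" using r by simp
    ultimately show ?thesis by linarith
  qed
qed (use assms in simp)

lemma energy_from_q_norm:
  fixes r :: "'a \<Rightarrow> real"
  assumes "finite Z" "\<And>z. z \<in> Z \<Longrightarrow> 0 \<le> r z" "\<And>z. z \<in> Z \<Longrightarrow> r z \<le> \<beta>" "(\<Sum>z\<in>Z. r z) = \<alpha> * \<beta>" "1 < q" "\<beta> > 0" "\<eta> > 0"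
    and "(\<Sum>z\<in>Z. r z powr q) \<ge> \<eta> * \<alpha> * \<beta> powr q"
  shows "(\<Sum>z\<in>Z. (r z)\<^sup>2) \<ge> (\<eta> / 2) powr (1 / (q - 1)) * (\<eta> / 2) * \<alpha> * \<beta>\<^sup>2"
proof -
  \<comment> \<open>Chosen so that the linear terms sum to exactly half of the assumed lower bound;
    the quadratic terms must supply the rest.\<close>
  define \<tau> where "\<tau> = (\<eta> / 2) powr (1 / (q - 1))"
  have \<tau>: "\<tau> > 0" "\<tau> powr (q - 1) = \<eta> / 2" using assms by (auto simp: \<tau>_def powr_powr)
  have b: "\<beta> powr (q - 1) * \<beta> = \<beta> powr q" "\<beta> powr (q - 2) * \<beta>\<^sup>2 = \<beta> powr q"
    using assms(6) by (auto simp: powr_diff powr_numeral[symmetric] simp del: powr_numeral)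
  have "\<eta> * \<alpha> * \<beta> powr q \<le> (\<Sum>z\<in>Z. \<tau> powr (q - 1) * \<beta> powr (q - 1) * r z + \<beta> powr (q - 2) * (r z)\<^sup>2 / \<tau>)"
    using assms(8) powr_threshold[OF assms(2,3) \<tau>(1) assms(5)] by (meson order_trans sum_mono)
  also have "\<dots> = \<eta> / 2 * \<alpha> * (\<beta> powr (q - 1) * \<beta>) + \<beta> powr (q - 2) * (\<Sum>z\<in>Z. (r z)\<^sup>2) / \<tau>"
    by (simp add: sum.distrib sum_distrib_left[symmetric] sum_divide_distrib[symmetric] assms(4) \<tau>(2))
  finally have "\<eta> / 2 * \<alpha> * (\<beta> powr (q - 2) * \<beta>\<^sup>2) \<le> \<beta> powr (q - 2) * (\<Sum>z\<in>Z. (r z)\<^sup>2) / \<tau>"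
    unfolding b by (simp add: field_simps)
  then have "\<beta> powr (q - 2) * (\<tau> * (\<eta> / 2) * \<alpha> * \<beta>\<^sup>2) \<le> \<beta> powr (q - 2) * (\<Sum>z\<in>Z. (r z)\<^sup>2)"
    using \<tau>(1) by (simp add: field_simps)
  then show ?thesis using assms(6) unfolding \<tau>_def by simp
qed

lemma sum_ind_mod:
  assumes N: "N > 0" and A: "A \<subseteq> {0..<N}"
  shows "(\<Sum>z\<in>{0..<N}. ind_mod N A (z + c)) = card A"
proof -
  have "(\<Sum>z\<in>{0..<N}. ind_mod N A (z + c)) = (\<Sum>z\<in>{0..<N}. ind_mod N A z)"
    by (rule sum_periodic_shift[OF N periodic_ind_mod])
  also have "\<dots> = (\<Sum>z\<in>{0..<N}. if z \<in> A then 1 else 0)"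
    by (intro sum.cong) (auto simp: ind_mod_def)
  also have "\<dots> = real (card ({0..<N} \<inter> A))" by (simp add: sum.inter_restrict[symmetric])
  also have "{0..<N} \<inter> A = A" using A by auto
  finally show ?thesis .
qed

lemma shift_sum_ind_bounds:
  assumes N: "N > 0" and A: "A \<subseteq> {0..<N}" and B: "finite B"
  shows "0 \<le> shift_sum B e (ind_mod N A) z" "shift_sum B e (ind_mod N A) z \<le> card B"
    "(\<Sum>z\<in>{0..<N}. shift_sum B e (ind_mod N A) z) = real (card A) * card B"
    "inner_mod N (shift_sum B e (ind_mod N A)) (shift_sum B e (ind_mod N A)) \<le> card A * (card B)\<^sup>2"
proof -
  let ?r = "shift_sum B e (ind_mod N A)"
  show 0: "0 \<le> ?r z" for z by (simp add: shift_sum_def ind_mod_def sum_nonneg)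
  have "?r z \<le> (\<Sum>x\<in>B. 1)" for z unfolding shift_sum_def by (intro sum_mono) (simp add: ind_mod_def)
  then show 1: "?r z \<le> card B" for z by simp
  have "(\<Sum>z\<in>{0..<N}. ?r z) = (\<Sum>x\<in>B. \<Sum>z\<in>{0..<N}. ind_mod N A (z + e * x))"
    unfolding shift_sum_def by (rule sum.swap)
  also have "\<dots> = real (card A) * card B" unfolding sum_ind_mod[OF N A] by simp
  finally show 2: "(\<Sum>z\<in>{0..<N}. ?r z) = real (card A) * card B" .
  have "inner_mod N ?r ?r \<le> (\<Sum>z\<in>{0..<N}. ?r z * card B)"
    unfolding inner_mod_def using 0 1 by (intro sum_mono mult_left_mono) auto
  also have "\<dots> = real (card A) * card B * card B" unfolding sum_distrib_right[symmetric] 2 ..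
  finally show "inner_mod N ?r ?r \<le> card A * (card B)\<^sup>2" by (simp add: power2_eq_square)
qed

text \<open>Regularisation selects a subset \<open>Y\<close> without any control, and in general
  energy need not survive. It does when every single \<open>y \<in> Y\<close> correlates well with
  the full convolution: sum over \<open>Y\<close> and apply Cauchy-Schwarz against the convolution
  with \<open>B\<close>, whose energy is at most \<open>card A * (card B)\<^sup>2\<close>.\<close>

lemma energy_of_popular_subset:
  fixes \<sigma> :: real
  assumes N: "N > 0" and A: "A \<subseteq> {0..<N}" "A \<noteq> {}" and B: "finite B" "B \<noteq> {}" and Y: "Y \<subseteq> B" and \<sigma>: "\<sigma> > 0"
    and pop: "\<And>y. y \<in> Y \<Longrightarrow> inner_mod N (\<lambda>z. ind_mod N A (z - y)) (shift_sum B (- 1) (ind_mod N A)) \<ge> \<sigma> / 2 * (card A * card B)"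
  shows "inner_mod N (shift_sum Y (- 1) (ind_mod N A)) (shift_sum Y (- 1) (ind_mod N A)) \<ge> \<sigma>\<^sup>2 / 4 * card A * (card Y)\<^sup>2"
proof -
  let ?rB = "shift_sum B (- 1) (ind_mod N A)" and ?rY = "shift_sum Y (- 1) (ind_mod N A)"
  define \<alpha> \<beta> where "\<alpha> = real (card A)" and "\<beta> = real (card B)"
  have fA: "finite A" using A finite_subset by blast
  have ab: "\<alpha> > 0" "\<beta> > 0" using A B fA by (auto simp: \<alpha>_def \<beta>_def card_gt_0_iff)
  have "inner_mod N ?rY ?rB = (\<Sum>y\<in>Y. inner_mod N (\<lambda>z. ind_mod N A (z - y)) ?rB)"
    unfolding inner_mod_def shift_sum_def[of Y] sum_distrib_right by (subst sum.swap) simp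
  also have "\<dots> \<ge> (\<Sum>y\<in>Y. \<sigma> / 2 * (\<alpha> * \<beta>))" using pop unfolding \<alpha>_def \<beta>_def by (intro sum_mono) simp
  finally have "card Y * (\<sigma> / 2 * (\<alpha> * \<beta>)) \<le> inner_mod N ?rY ?rB" by simp
  then have "(card Y * (\<sigma> / 2 * (\<alpha> * \<beta>)))\<^sup>2 \<le> (inner_mod N ?rY ?rB)\<^sup>2"
    using \<sigma> ab by (intro power_mono) auto
  also have "\<dots> \<le> inner_mod N ?rY ?rY * inner_mod N ?rB ?rB" by (rule inner_mod_CS)
  also have "\<dots> \<le> inner_mod N ?rY ?rY * (\<alpha> * \<beta>\<^sup>2)"
    using shift_sum_ind_bounds(4)[OF N A(1) B(1)] unfolding \<alpha>_def \<beta>_def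
    by (intro mult_left_mono) (auto simp: inner_mod_def intro!: sum_nonneg)
  finally have "(\<sigma>\<^sup>2 / 4 * \<alpha> * (card Y)\<^sup>2) * (\<alpha> * \<beta>\<^sup>2) \<le> inner_mod N ?rY ?rY * (\<alpha> * \<beta>\<^sup>2)"
    by (simp add: power_mult_distrib power_divide power2_eq_square mult_ac)
  then have "\<sigma>\<^sup>2 / 4 * \<alpha> * (card Y)\<^sup>2 \<le> inner_mod N ?rY ?rY"
    by (rule mult_right_le_imp_le) (use ab in simp)
  then show ?thesis by (simp add: \<alpha>_def)
qed

section \<open>Extraction of a regular pair from large energy\<close>

context scales
begin

text \<open>The order matters: \<open>B\<close> is regularised first, since the walk is built from
  it, and \<open>A\<close> is then taken among the starting points popular for that walk, a property
  that passes to subsets. The quantity \<open>r / 2\<close> enters twice, as the share of popular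
  points and as their rate of return, hence the square in the last bound.\<close>

lemma structured_pair:
  fixes \<sigma> :: real
  assumes n2: "n = 2 ^ Suc j" and A0: "A0 \<subseteq> {0..<b ^ l}" "A0 \<noteq> {}" and B0: "B0 \<subseteq> {0..<b ^ l}" "B0 \<noteq> {}"
    and \<sigma>: "\<sigma> > 0"
    and E: "inner_mod (b ^ l) (shift_sum B0 (- 1) (ind_mod (b ^ l) A0)) (shift_sum B0 (- 1) (ind_mod (b ^ l) A0))
      \<ge> \<sigma> * card A0 * (card B0)\<^sup>2"
  defines "r \<equiv> (\<sigma>\<^sup>2 / 4) ^ (2 ^ j)"
  shows "\<exists>A\<subseteq>A0. \<exists>B\<subseteq>B0. \<exists>tA tB \<rho> \<tau> F.
    reg b l \<rho> ((\<lambda>x. (x + tA) mod b ^ l) ` A) \<and> (\<forall>x\<in>A. central b l ((x + tA) mod b ^ l)) \<and>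
    reg b l \<tau> ((\<lambda>x. (x + tB) mod b ^ l) ` B) \<and> (\<forall>x\<in>B. central b l ((x + tB) mod b ^ l)) \<and>
    r / 2 * card A0 \<le> (4 * (D + 1)) ^ l * card A \<and> \<sigma> / 2 * card B0 \<le> (4 * (D + 1)) ^ l * card B \<and>
    F \<subseteq> {..<l} \<and> card ({k\<in>{..<l}. \<tau> k \<ge> 2} - F) \<le> (l div P) * (2 * M) + P \<and>
    (\<Prod>k\<in>F. b / \<rho> k) \<le> (4 * (D + 1)) ^ l * (2 / r)\<^sup>2 * (2 * real n + 3) * (b ^ (2 * M + 1) * (2 * real n + 3)) ^ (l div P)"
proof -
  define N where "N = b ^ l"
  have N: "N > 0" using b by (simp add: N_def)
  have fA0: "finite A0" and fB0: "finite B0" using A0 B0 finite_subset by blast+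
  have cA0: "card A0 > 0" and cB0: "card B0 > 0" using A0 B0 fA0 fB0 by (auto simp: card_gt_0_iff)
  let ?f = "ind_mod N A0"
  let ?rB = "shift_sum B0 (- 1) ?f"
  have r0: "r > 0" using \<sigma> by (simp add: r_def)
  note A0N = A0(1)[folded N_def] and B0N = B0(1)[folded N_def]
  define W where "W y = inner_mod N (\<lambda>z. ?f (z - y)) ?rB" for y
  \<comment> \<open>Elements whose translate of \<open>A0\<close> correlates with the whole
    convolution at half of the guaranteed average or better, so that any subset of \<open>X\<close>
    keeps its energy by \<open>energy_of_popular_subset\<close>.\<close>
  define X where "X = {y \<in> B0. W y \<ge> \<sigma> / 2 * (card A0 * card B0)}"
  have X: "\<sigma> / 2 * card B0 \<le> card X"
    unfolding X_def
  proof (rule popular_subset[OF fB0])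
    fix y
    have "W y \<le> (\<Sum>z\<in>{0..<N}. ?f (z + (- y)) * card B0)"
      unfolding W_def inner_mod_def using shift_sum_ind_bounds(2)[OF N A0N fB0]
      by (simp, intro sum_mono mult_left_mono) (auto simp: ind_mod_def)
    also have "\<dots> = card A0 * card B0" unfolding sum_distrib_right[symmetric] sum_ind_mod[OF N A0N] by simp
    finally show "W y \<le> real (card A0 * card B0)" .
    show "real (card A0 * card B0) > 0" using cA0 cB0 by simp
    have "(\<Sum>y\<in>B0. W y) = (\<Sum>z\<in>{0..<N}. \<Sum>y\<in>B0. ?f (z - y) * ?rB z)"
      unfolding W_def inner_mod_def by (rule sum.swap)
    also have "\<dots> = inner_mod N ?rB ?rB"
      by (simp add: inner_mod_def sum_distrib_right[symmetric]) (simp add: shift_sum_def)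
    finally have "(\<Sum>y\<in>B0. W y) = inner_mod N ?rB ?rB" .
    then show "\<sigma> * real (card A0 * card B0) * card B0 \<le> (\<Sum>y\<in>B0. W y)"
      using E unfolding N_def[symmetric] by (simp add: power2_eq_square mult_ac)
  qed
  then have "real (card X) > 0" using \<sigma> cB0 by (smt (verit) divide_pos_pos mult_pos_pos of_nat_0_less_iff)
  then have Xne: "X \<noteq> {}" by auto
  have XB: "X \<subseteq> B0" by (auto simp: X_def)
  obtain B tB \<tau> where B: "B \<subseteq> X" "B \<noteq> {}" "card X \<le> (4 * (D + 1)) ^ l * card B"
    and Bs: "reg b l \<tau> ((\<lambda>x. (x + tB) mod N) ` B)" "\<forall>x\<in>B. central b l ((x + tB) mod N)"
    using ex_regular_subset[OF D, of X l, folded b_def, folded N_def, OF order_trans[OF XB B0N] Xne]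
    by (elim exE conjE) (rule that, assumption+)
  have BB0: "B \<subseteq> B0" using B(1) XB by blast
  have fB: "finite B" using BB0 fB0 finite_subset by blast
  have EB: "inner_mod N (shift_sum B (- 1) ?f) (shift_sum B (- 1) ?f) \<ge> \<sigma>\<^sup>2 / 4 * card A0 * (card B)\<^sup>2"
    by (rule energy_of_popular_subset[OF N A0N A0(2) fB0 B0(2) BB0 \<sigma>]) (use B(1) in \<open>auto simp: X_def W_def\<close>)
  define w where "w = (walk B ^^ (2 ^ j)) ?f"
  define XA where "XA = {a \<in> A0. w a \<ge> r / 2 * card B ^ (2 ^ Suc j)}"
  have XA: "r / 2 * card A0 \<le> card XA"
    unfolding XA_def w_def r_def using \<sigma> by (intro ex_popular_differences N A0N A0(2) fB B(2) EB) auto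
  then have "real (card XA) > 0" using r0 cA0 by (smt (verit) divide_pos_pos mult_pos_pos of_nat_0_less_iff)
  then have XAne: "XA \<noteq> {}" by auto
  have XAA: "XA \<subseteq> A0" by (auto simp: XA_def)
  obtain A tA \<rho> where A: "A \<subseteq> XA" "A \<noteq> {}" "card XA \<le> (4 * (D + 1)) ^ l * card A"
    and As: "reg b l \<rho> ((\<lambda>x. (x + tA) mod N) ` A)" "\<forall>x\<in>A. central b l ((x + tA) mod N)"
    using ex_regular_subset[OF D, of XA l, folded b_def, folded N_def, OF order_trans[OF XAA A0N] XAne]
    by (elim exE conjE) (rule that, assumption+)
  have AA0: "A \<subseteq> A0" using A(1) XAA by blast
  have fA: "finite A" using AA0 fA0 finite_subset by blast
  have cA: "card A > 0" and cB: "card B > 0" using A(2) B(2) fA fB by (auto simp: card_gt_0_iff)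
  have lA: "r / 2 * card A0 \<le> (4 * (D + 1)) ^ l * card A" using XA of_nat_mono[OF A(3), where 'a=real] by simp
  have lB: "\<sigma> / 2 * card B0 \<le> (4 * (D + 1)) ^ l * card B" using X of_nat_mono[OF B(3), where 'a=real] by simp
  obtain F where F: "F \<subseteq> {..<l}" "card ({k\<in>{..<l}. \<tau> k \<ge> 2} - F) \<le> (l div P) * (2 * M) + P"
    and GC: "\<And>\<rho> A B e w. \<forall>i<n. \<bar>e i\<bar> = 1 \<Longrightarrow> reg b l \<rho> A \<Longrightarrow> \<forall>i<n. reg b l \<tau> (B i) \<and> (\<forall>x\<in>B i. central b l x) \<Longrightarrow>
      real (card (solutions A {..<n} B e w))
        \<le> (b ^ (2 * M + 1) * (2 * real n + 3)) ^ (l div P) * (\<Prod>k\<in>F. \<rho> k / b) * (\<Prod>i<n. real (card (B i)))"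
    using global_count[of l \<tau>] by (elim exE conjE) (rule that, assumption, assumption, blast)
  define \<Lambda> where "\<Lambda> = (b ^ (2 * M + 1) * (2 * real n + 3)) ^ (l div P)"
  define p where "p = (\<Prod>k\<in>F. \<rho> k / b)"
  have bpos: "real_of_int b > 0" using b by simp
  have \<rho>1: "real (\<rho> k) > 0" if "k \<in> F" for k using reg_pos[OF b(2) As(1), of k] that F(1) by auto
  have p0: "p > 0" unfolding p_def using \<rho>1 bpos by (intro prod_pos) auto
  have \<Lambda>0: "\<Lambda> > 0" unfolding \<Lambda>_def using bpos by simp
  have nk: "n = 2 * 2 ^ j" using n2 by simp
  have cBs: "card ((\<lambda>x. (x + tB) mod N) ` B) = card B"
    using inj_on_subset[OF bij_betw_imp_inj_on[OF bij_betw_add_mod[OF N]]] BB0 B0N by (intro card_image) blast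
  have "(\<Sum>a\<in>A. w a) \<le> card A0 * (2 * real n + 3) * (\<Lambda> * p * real (card B) ^ n)"
    unfolding w_def nk
  proof (rule walk_count_bound[OF N A0N])
    show "A \<subseteq> {0..<N}" "B \<subseteq> {0..<N}" using AA0 A0N BB0 B0N by auto
    fix v
    have "real (card (solutions ((\<lambda>x. (x + tA) mod N) ` A) {..<n} (\<lambda>_. (\<lambda>x. (x + tB) mod N) ` B) alt v))
      \<le> (b ^ (2 * M + 1) * (2 * real n + 3)) ^ (l div P) * (\<Prod>k\<in>F. \<rho> k / b) * (\<Prod>i<n. real (card ((\<lambda>x. (x + tB) mod N) ` B)))"
      using As Bs by (intro GC) (auto simp: alt_def)
    then show "real (card (solutions ((\<lambda>x. (x + tA) mod N) ` A) {..<2 * 2 ^ j} (\<lambda>_. (\<lambda>x. (x + tB) mod N) ` B) alt v))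
      \<le> \<Lambda> * p * real (card B) ^ (2 * 2 ^ j)"
      unfolding nk[symmetric] \<Lambda>_def[symmetric] p_def[symmetric] by (simp add: cBs)
  qed
  moreover have "(\<Sum>a\<in>A. w a) \<ge> (\<Sum>a\<in>A. r / 2 * real (card B) ^ n)"
    unfolding n2 using A(1) by (intro sum_mono) (auto simp: XA_def)
  ultimately have "card A * (r / 2 * real (card B) ^ n) \<le> card A0 * (2 * real n + 3) * (\<Lambda> * p * real (card B) ^ n)" by simp
  then have "(card A * (r / 2)) * real (card B) ^ n \<le> (card A0 * (2 * real n + 3) * (\<Lambda> * p)) * real (card B) ^ n"
    by (simp add: mult_ac)
  then have 1: "card A * (r / 2) \<le> card A0 * (2 * real n + 3) * (\<Lambda> * p)" using cB by simp
  \<comment> \<open>The walk starts in \<open>A\<close> but may end anywhere in \<open>A0\<close>;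
    \<open>lA\<close> trades \<open>card A0\<close> for \<open>card A\<close>.\<close>
  have "card A * (r / 2) \<le> ((4 * (D + 1)) ^ l * card A * (2 / r)) * (2 * real n + 3) * (\<Lambda> * p)"
  proof -
    have "card A0 \<le> (4 * (D + 1)) ^ l * card A * (2 / r)" using lA r0 by (simp add: field_simps)
    then have "card A0 * ((2 * real n + 3) * (\<Lambda> * p)) \<le> ((4 * (D + 1)) ^ l * card A * (2 / r)) * ((2 * real n + 3) * (\<Lambda> * p))"
      using \<Lambda>0 p0 by (intro mult_right_mono) auto
    then show ?thesis using 1 by (simp only: mult.assoc)
  qed
  also have "\<dots> = card A * (((4 * (D + 1)) ^ l * (2 / r)) * (2 * real n + 3) * (\<Lambda> * p))" by (simp add: mult_ac)
  finally have "r / 2 \<le> ((4 * (D + 1)) ^ l * (2 / r)) * (2 * real n + 3) * (\<Lambda> * p)"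
    by (rule mult_left_le_imp_le) (use cA in simp)
  then have "1 / p \<le> (4 * (D + 1)) ^ l * (2 / r)\<^sup>2 * (2 * real n + 3) * \<Lambda>"
    using r0 p0 by (simp add: field_simps power2_eq_square)
  moreover have "1 / p = (\<Prod>k\<in>F. b / \<rho> k)"
    unfolding p_def using \<rho>1 bpos by (simp add: prod_dividef)
  ultimately have "(\<Prod>k\<in>F. b / \<rho> k) \<le> (4 * (D + 1)) ^ l * (2 / r)\<^sup>2 * (2 * real n + 3) * \<Lambda>" by simp
  then show ?thesis
    using AA0 BB0 As Bs lA lB F unfolding N_def \<Lambda>_def
    by (intro exI[of _ A] conjI exI[of _ B] exI[of _ tA] exI[of _ tB] exI[of _ \<rho>] exI[of _ \<tau>] exI[of _ F]) assumption+
qed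

end

section \<open>Level sets\<close>


text \<open>Only the largest term is used; the loss is polynomial in the number of terms, which is
  affordable for the \<open>9 * m\<^sup>2\<close> pairs of levels below.\<close>

lemma powr_sum_le:
  fixes t :: "'a \<Rightarrow> real"
  assumes "finite I" "\<And>i. i \<in> I \<Longrightarrow> 0 \<le> t i" "0 < q"
  shows "(\<Sum>i\<in>I. t i) powr q \<le> real (card I) powr q * (\<Sum>i\<in>I. t i powr q)"
proof (cases "I = {}")
  case False
  define M where "M = Max (t ` I)"
  have M: "M \<in> t ` I" "\<And>i. i \<in> I \<Longrightarrow> t i \<le> M" using False assms(1) by (auto simp: M_def)
  then obtain i where i: "i \<in> I" "M = t i" by auto
  have "(\<Sum>i\<in>I. t i) \<le> real (card I) * M" using sum_bounded_above[of I t M] M by simp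
  then have "(\<Sum>i\<in>I. t i) powr q \<le> (real (card I) * M) powr q" using assms by (intro powr_mono2 sum_nonneg) auto
  also have "\<dots> = real (card I) powr q * t i powr q" using assms(2)[OF i(1)] i(2) by (simp add: powr_mult)
  also have "\<dots> \<le> real (card I) powr q * (\<Sum>i\<in>I. t i powr q)"
    using i assms(1) by (intro mult_left_mono member_le_sum) auto
  finally show ?thesis .
qed simp

lemma powr_add_le:
  assumes "0 \<le> x" "0 \<le> y" "0 < (q::real)"
  shows "(x + y) powr q \<le> 2 powr q * (x powr q + y powr q)"
proof -
  have "(x + y) powr q \<le> (2 * max x y) powr q" using assms by (intro powr_mono2) auto
  also have "\<dots> = 2 powr q * max x y powr q" using assms by (simp add: powr_mult)
  also have "\<dots> \<le> 2 powr q * (x powr q + y powr q)" by (intro mult_left_mono) (auto simp: max_def)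
  finally show ?thesis .
qed

definition level :: "int set \<Rightarrow> (int \<Rightarrow> real) \<Rightarrow> real \<Rightarrow> int set" where
  "level Z f c = {x \<in> Z. c / 2 < f x \<and> f x \<le> c}"

lemma level_majorant:
  assumes "x \<in> Z" "f x \<le> 1" "M > 0"
  shows "f x \<le> (1/2) ^ M \<or> f x \<le> (\<Sum>i<M. if x \<in> level Z f ((1/2) ^ i) then (1/2) ^ i else 0)"
proof (cases "f x \<le> (1/2) ^ M")
  case False
  define i where "i = (LEAST i. (1/2) ^ Suc i < f x)"
  have ex: "(1/2) ^ Suc (M - 1) < f x" using False assms(3) by simp
  have 1: "(1/2) ^ Suc i < f x" unfolding i_def by (rule LeastI[of "\<lambda>i. (1/2) ^ Suc i < f x", OF ex])
  have "i \<le> M - 1" unfolding i_def by (rule Least_le) (rule ex)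
  then have iM: "i < M" using assms(3) by simp
  have 2: "f x \<le> (1/2) ^ i"
  proof (cases i)
    case (Suc i')
    then have "\<not> (1/2) ^ Suc i' < f x" using not_less_Least[of i' "\<lambda>i. (1/2) ^ Suc i < f x"] unfolding i_def by simp
    then show ?thesis using Suc by simp
  qed (use assms in simp)
  have "x \<in> level Z f ((1/2) ^ i)" using assms(1) 1 2 by (simp add: level_def)
  then have "f x \<le> (if x \<in> level Z f ((1/2) ^ i) then (1/2) ^ i else 0)" using 2 by simp
  also have "\<dots> \<le> (\<Sum>i<M. if x \<in> level Z f ((1/2) ^ i) then (1/2) ^ i else 0)"
    using iM by (intro member_le_sum) auto
  finally show ?thesis by simp
qed simp

lemma bij_betw_reflect_mod:
  assumes "N > 0"
  shows "bij_betw (\<lambda>y::int. (z - y) mod N) {0..<N} {0..<N}"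
proof (rule bij_betw_byWitness[of _ "\<lambda>y. (z - y) mod N"])
  show "\<forall>a\<in>{0..<N}. (z - (z - a) mod N) mod N = a" by (auto simp: mod_diff_right_eq)
  show "\<forall>a\<in>{0..<N}. (z - (z - a) mod N) mod N = a" by (auto simp: mod_diff_right_eq)
qed (use assms in auto)

text \<open>Pigeonhole over the \<open>9 * m\<^sup>2\<close> pairs of dyadic levels.
  \<open>3 * m\<close> levels are enough: some value of \<open>f\<close> is at least
  \<open>1 / 2 ^ m\<close>, so \<open>F \<ge> 2 powr (- m * q)\<close>, and what lies below the
  cutoff accounts for at most half of the lower bound in \<open>H\<close>. The polynomial loss is
  paid by doubling the exponent from \<open>\<epsilon>\<close> to
  \<open>2 * \<epsilon>\<close>.\<close>

lemma ex_level_pair: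
  fixes f g :: "int \<Rightarrow> real" and q \<epsilon> :: real and m :: nat
  defines "N \<equiv> 2 ^ m" and "Z \<equiv> {0..<2 ^ m}"
  assumes q: "1 < q" and f: "\<And>x. 0 \<le> f x" "(\<Sum>x\<in>Z. f x) = 1" and g: "\<And>x. 0 \<le> g x" "(\<Sum>x\<in>Z. g x) = 1"
    and H: "(\<Sum>z\<in>Z. (\<Sum>y\<in>Z. g y * f ((z - y) mod N)) powr q) \<ge> 2 powr (- \<epsilon> * m * q) * (\<Sum>x\<in>Z. f x powr q)"
    and m: "\<epsilon> \<le> 1/2" "m \<ge> 6" "2 * 2 powr q * (9 * (real m)\<^sup>2) powr (q + 1) \<le> 2 powr (\<epsilon> * m * q)"
  shows "\<exists>c>0. \<exists>d>0. 2 powr (- 2 * \<epsilon> * m * q) * (\<Sum>x\<in>Z. f x powr q)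
    \<le> (c * d) powr q * (\<Sum>z\<in>Z. shift_sum (level Z g d) (- 1) (ind_mod N (level Z f c)) z powr q)"
proof -
  have N: "N > 0" by (simp add: N_def)
  have fZ: "finite Z" by (simp add: Z_def)
  have ZN: "Z = {0..<N}" by (simp add: Z_def N_def)
  have m0: "m > 0" using m by simp
  define F where "F = (\<Sum>x\<in>Z. f x powr q)"
  have f1: "f x \<le> 1" and g1: "g x \<le> 1" if "x \<in> Z" for x
    using member_le_sum[OF that, of f] member_le_sum[OF that, of g] f g fZ by auto
  have F: "F \<ge> 2 powr (- real m * q)"
  proof -
    have "\<exists>x\<in>Z. f x \<ge> 1 / 2 ^ m"
    proof (rule ccontr)
      assume "\<not> ?thesis"
      then have "(\<Sum>x\<in>Z. f x) < (\<Sum>x\<in>Z. 1 / 2 ^ m)" by (intro sum_strict_mono fZ) (auto simp: Z_def not_le)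
      also have "\<dots> = 1" by (simp add: Z_def nat_power_eq)
      finally show False using f(2) by simp
    qed
    then obtain x where x: "x \<in> Z" "f x \<ge> 1 / 2 ^ m" by blast
    have "2 powr (- real m * q) = (1 / 2 ^ m) powr q"
    proof -
      have "1 / 2 ^ m = (2::real) powr (- real m)" by (simp add: powr_minus_divide powr_realpow)
      then show ?thesis by (simp only: powr_powr)
    qed
    also have "\<dots> \<le> f x powr q" using x q by (intro powr_mono2) auto
    also have "\<dots> \<le> F" unfolding F_def using x fZ by (intro member_le_sum) auto
    finally show ?thesis .
  qed
  define I where "I = {..<3 * m} \<times> {..<3 * m}"
  have fI: "finite I" and cI: "card I = 9 * m\<^sup>2" by (auto simp: I_def power2_eq_square)
  define c :: real where "c = (1/2) ^ (3 * m)"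
  have c0: "c > 0" by (simp add: c_def)
  define A where "A i = level Z f ((1/2) ^ i)" for i :: nat
  define B where "B i = level Z g ((1/2) ^ i)" for i :: nat
  define fs where "fs x = (\<Sum>i<3 * m. if x \<in> A i then (1/2) ^ i else 0 :: real)" for x
  define gs where "gs x = (\<Sum>i<3 * m. if x \<in> B i then (1/2) ^ i else 0 :: real)" for x
  have fs0: "0 \<le> fs x" and gs0: "0 \<le> gs x" for x unfolding fs_def gs_def by (auto intro!: sum_nonneg)
  define t where "t p z = (1/2) ^ fst p * (1/2) ^ snd p * shift_sum (B (snd p)) (- 1) (ind_mod N (A (fst p))) z" for p z
  have t0: "0 \<le> t p z" for p z unfolding t_def shift_sum_def ind_mod_def by (auto intro!: mult_nonneg_nonneg sum_nonneg)
  \<comment> \<open>Either both values are bounded by their dyadic majorants, or one of them is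
    below the cutoff \<open>c\<close> and the product is charged to the other factor, whose sum is
    1.\<close>
  have point: "(\<Sum>y\<in>Z. g y * f ((z - y) mod N)) \<le> (\<Sum>p\<in>I. t p z) + 2 * c" if z: "z \<in> Z" for z
  proof -
    have "(\<Sum>y\<in>Z. g y * f ((z - y) mod N)) \<le> (\<Sum>y\<in>Z. gs y * fs ((z - y) mod N) + c * g y + c * f ((z - y) mod N))"
    proof (rule sum_mono)
      fix y assume y: "y \<in> Z"
      define x where "x = (z - y) mod N"
      have x: "x \<in> Z" using N by (simp add: x_def ZN)
      have "f x \<le> c \<or> f x \<le> fs x" using level_majorant[of x Z f "3 * m"] x f1[OF x] m0 unfolding fs_def A_def c_def by simp
      moreover have "g y \<le> c \<or> g y \<le> gs y" using level_majorant[of y Z g "3 * m"] y g1[OF y] m0 unfolding gs_def B_def c_def by simp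
      moreover have "g y * f x \<le> c * f x" if "g y \<le> c" using that f(1) by (intro mult_right_mono) auto
      moreover have "g y * f x \<le> c * g y" if "f x \<le> c" using mult_left_mono[OF that g(1)[of y]] by (simp add: mult.commute)
      moreover have "g y * f x \<le> gs y * fs x" if "g y \<le> gs y" "f x \<le> fs x" using that f g gs0 by (intro mult_mono) auto
      moreover have "0 \<le> gs y * fs x" "0 \<le> c * g y" "0 \<le> c * f x" using fs0 gs0 c0 f(1) g(1) by auto
      ultimately show "g y * f ((z - y) mod N) \<le> gs y * fs ((z - y) mod N) + c * g y + c * f ((z - y) mod N)"
        unfolding x_def[symmetric] by linarith
    qed
    also have "\<dots> = (\<Sum>y\<in>Z. gs y * fs ((z - y) mod N)) + c * (\<Sum>y\<in>Z. g y) + c * (\<Sum>y\<in>Z. f ((z - y) mod N))"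
      by (simp add: sum.distrib sum_distrib_left)
    also have "(\<Sum>y\<in>Z. f ((z - y) mod N)) = 1"
      using sum.reindex_bij_betw[OF bij_betw_reflect_mod[OF N, of z], of f] f(2) by (simp add: ZN)
    also have "(\<Sum>y\<in>Z. gs y * fs ((z - y) mod N)) = (\<Sum>p\<in>I. t p z)"
    proof -
      have "(\<Sum>y\<in>Z. gs y * fs ((z - y) mod N))
        = (\<Sum>y\<in>Z. \<Sum>j<3 * m. \<Sum>i<3 * m. (if y \<in> B j then (1/2) ^ j else 0) * (if (z - y) mod N \<in> A i then (1/2) ^ i else 0))"
        unfolding gs_def fs_def by (simp only: sum_product)
      also have "\<dots> = (\<Sum>j<3 * m. \<Sum>y\<in>Z. \<Sum>i<3 * m. (if y \<in> B j then (1/2) ^ j else 0) * (if (z - y) mod N \<in> A i then (1/2) ^ i else 0))"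
        by (rule sum.swap)
      also have "\<dots> = (\<Sum>j<3 * m. \<Sum>i<3 * m. \<Sum>y\<in>Z. (if y \<in> B j then (1/2) ^ j else 0) * (if (z - y) mod N \<in> A i then (1/2) ^ i else 0))"
        by (rule sum.cong[OF refl], rule sum.swap)
      also have "\<dots> = (\<Sum>i<3 * m. \<Sum>j<3 * m. \<Sum>y\<in>Z. (if y \<in> B j then (1/2) ^ j else 0) * (if (z - y) mod N \<in> A i then (1/2) ^ i else 0))"
        by (rule sum.swap)
      also have "\<dots> = (\<Sum>i<3 * m. \<Sum>j<3 * m. t (i, j) z)"
      proof (rule sum.cong[OF refl], rule sum.cong[OF refl])
        fix i j
        have BZ: "B j \<subseteq> Z" by (auto simp: B_def level_def)
        have "(\<Sum>y\<in>Z. (if y \<in> B j then (1/2) ^ j else 0) * (if (z - y) mod N \<in> A i then (1/2) ^ i else 0 :: real))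
          = (\<Sum>y\<in>Z. if y \<in> B j then (1/2) ^ j * (if (z - y) mod N \<in> A i then (1/2) ^ i else 0) else 0)"
          by (intro sum.cong) auto
        also have "\<dots> = (\<Sum>y\<in>Z \<inter> B j. (1/2) ^ j * (if (z - y) mod N \<in> A i then (1/2) ^ i else 0))"
          by (rule sum.inter_restrict[OF fZ, symmetric])
        also have "Z \<inter> B j = B j" using BZ by auto
        also have "(\<Sum>y\<in>B j. (1/2) ^ j * (if (z - y) mod N \<in> A i then (1/2) ^ i else 0 :: real)) = t (i, j) z"
          unfolding t_def shift_sum_def sum_distrib_left by (intro sum.cong) (auto simp: ind_mod_def)
        finally show "(\<Sum>y\<in>Z. (if y \<in> B j then (1/2) ^ j else 0) * (if (z - y) mod N \<in> A i then (1/2) ^ i else 0)) = t (i, j) z" .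
      qed
      also have "\<dots> = (\<Sum>p\<in>I. t p z)" unfolding I_def by (simp only: sum.cartesian_product case_prod_unfold prod.collapse)
      finally show ?thesis .
    qed
    finally show ?thesis using g(2) by simp
  qed
  have "2 powr (- \<epsilon> * m * q) * F \<le> (\<Sum>z\<in>Z. (\<Sum>y\<in>Z. g y * f ((z - y) mod N)) powr q)" using H by (simp add: F_def)
  also have "\<dots> \<le> (\<Sum>z\<in>Z. 2 powr q * (real (card I) powr q * (\<Sum>p\<in>I. t p z powr q) + (2 * c) powr q))"
  proof (rule sum_mono)
    fix z assume z: "z \<in> Z"
    have "(\<Sum>y\<in>Z. g y * f ((z - y) mod N)) powr q \<le> ((\<Sum>p\<in>I. t p z) + 2 * c) powr q"
      using point[OF z] q f(1) g(1) by (intro powr_mono2 sum_nonneg) auto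
    also have "\<dots> \<le> 2 powr q * ((\<Sum>p\<in>I. t p z) powr q + (2 * c) powr q)"
      using t0 c0 q by (intro powr_add_le sum_nonneg) auto
    also have "\<dots> \<le> 2 powr q * (real (card I) powr q * (\<Sum>p\<in>I. t p z powr q) + (2 * c) powr q)"
      using t0 q fI by (intro mult_left_mono add_mono powr_sum_le) auto
    finally show "(\<Sum>y\<in>Z. g y * f ((z - y) mod N)) powr q \<le> 2 powr q * (real (card I) powr q * (\<Sum>p\<in>I. t p z powr q) + (2 * c) powr q)" .
  qed
  also have "\<dots> = 2 powr q * real (card I) powr q * (\<Sum>z\<in>Z. \<Sum>p\<in>I. t p z powr q) + 2 ^ m * (2 powr q * (2 * c) powr q)"
    by (simp add: sum.distrib sum_distrib_left distrib_left mult.assoc Z_def nat_power_eq)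
  also have "(\<Sum>z\<in>Z. \<Sum>p\<in>I. t p z powr q) = (\<Sum>p\<in>I. \<Sum>z\<in>Z. t p z powr q)" by (rule sum.swap)
  finally have 1: "2 powr (- \<epsilon> * m * q) * F \<le> 2 powr q * real (card I) powr q * (\<Sum>p\<in>I. \<Sum>z\<in>Z. t p z powr q) + 2 ^ m * (2 powr q * (2 * c) powr q)" .
  have "2 ^ m * (2 powr q * (2 * c) powr q) = 2 powr (m + q + (1 - 3 * real m) * q)"
  proof -
    have "c = 1 / 2 powr real (3 * m)"
      unfolding c_def power_one_over by (subst powr_realpow) simp_all
    then have c2: "2 * c = 2 powr (1 - 3 * real m)" by (simp add: powr_diff)
    have "2 powr (m + q + (1 - 3 * real m) * q) = 2 powr real m * (2 powr q * (2 powr (1 - 3 * real m)) powr q)"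
      by (simp only: powr_add powr_powr mult.assoc)
    then show ?thesis unfolding c2 by (simp add: powr_realpow)
  qed
  also have "\<dots> \<le> 2 powr (- 1 + - \<epsilon> * m * q + - real m * q)"
  proof -
    have "\<epsilon> * (m * q) \<le> 1/2 * (m * q)" using m q by (intro mult_right_mono) auto
    moreover have "real m * 1 \<le> real m * q" using q by (intro mult_left_mono) auto
    moreover have "6 * q \<le> m * q" using m q by (intro mult_right_mono) auto
    moreover have "(1 - 3 * real m) * q = q - 3 * (m * q)" "- \<epsilon> * m * q = - (\<epsilon> * (m * q))" "- real m * q = - (m * q)"
      by (simp_all add: algebra_simps)
    ultimately have "m + q + (1 - 3 * real m) * q \<le> - 1 + - \<epsilon> * m * q + - real m * q" using q by linarith
    then show ?thesis by (rule powr_mono) simp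
  qed
  also have "\<dots> = 1/2 * (2 powr (- \<epsilon> * m * q) * 2 powr (- real m * q))"
    unfolding powr_add by simp
  also have "\<dots> \<le> 1/2 * (2 powr (- \<epsilon> * m * q) * F)" using F by (intro mult_left_mono) auto
  finally have 2: "1/2 * (2 powr (- \<epsilon> * m * q) * F) \<le> 2 powr q * real (card I) powr q * (\<Sum>p\<in>I. \<Sum>z\<in>Z. t p z powr q)"
    using 1 by linarith
  have "\<exists>p\<in>I. 2 powr (- 2 * \<epsilon> * m * q) * F \<le> (\<Sum>z\<in>Z. t p z powr q)"
  proof (rule ccontr)
    assume "\<not> ?thesis"
    then have "(\<Sum>p\<in>I. \<Sum>z\<in>Z. t p z powr q) < (\<Sum>p\<in>I. 2 powr (- 2 * \<epsilon> * m * q) * F)"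
      using m0 fI by (intro sum_strict_mono) (auto simp: not_le I_def lessThan_empty_iff)
    then have "(\<Sum>p\<in>I. \<Sum>z\<in>Z. t p z powr q) < card I * (2 powr (- 2 * \<epsilon> * m * q) * F)" by simp
    moreover have cI0: "real (card I) > 0" using m0 by (simp add: cI)
    ultimately have "2 powr q * real (card I) powr q * (\<Sum>p\<in>I. \<Sum>z\<in>Z. t p z powr q)
      < 2 powr q * real (card I) powr q * (card I * (2 powr (- 2 * \<epsilon> * m * q) * F))"
      by (intro mult_strict_left_mono) auto
    also have "\<dots> = (2 * 2 powr q * (9 * (real m)\<^sup>2) powr (q + 1)) * (1/2 * (2 powr (- 2 * \<epsilon> * m * q) * F))"
      using cI0 by (simp add: powr_add cI)
    also have "\<dots> \<le> 2 powr (\<epsilon> * m * q) * (1/2 * (2 powr (- 2 * \<epsilon> * m * q) * F))"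
      using m(3) F by (intro mult_right_mono mult_nonneg_nonneg) (auto simp: F_def intro!: sum_nonneg)
    also have "\<dots> = 1/2 * ((2 powr (\<epsilon> * m * q) * 2 powr (- 2 * \<epsilon> * m * q)) * F)" by simp
    also have "2 powr (\<epsilon> * m * q) * 2 powr (- 2 * \<epsilon> * m * q) = 2 powr (- \<epsilon> * m * q)"
      unfolding powr_add[symmetric] by (rule arg_cong[of _ _ "\<lambda>x. 2 powr x"]) (simp add: algebra_simps)
    finally show False using 2 by simp
  qed
  then obtain p where p: "p \<in> I" "2 powr (- 2 * \<epsilon> * m * q) * F \<le> (\<Sum>z\<in>Z. t p z powr q)" by blast
  have "(\<Sum>z\<in>Z. t p z powr q) = ((1/2) ^ fst p * (1/2) ^ snd p) powr q * (\<Sum>z\<in>Z. shift_sum (B (snd p)) (- 1) (ind_mod N (A (fst p))) z powr q)"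
    unfolding t_def sum_distrib_left
    by (intro sum.cong refl powr_mult)
  then show ?thesis using p(2) unfolding F_def A_def B_def
    by (intro exI[of _ "(1/2) ^ fst p"] exI[of _ "(1/2) ^ snd p"] conjI) auto
qed

text \<open>The bound \<open>R \<le> card A * card B powr q\<close>, with
  \<open>c * card A \<le> 2\<close> and \<open>d * card B \<le> 2\<close> from the total masses,
  shows that \<open>main\<close> is within a factor of order \<open>\<theta>\<close> of the best
  possible. So every inequality in this chain is nearly sharp, and each conclusion isolates one of
  them. The last two compare \<open>F\<close> and \<open>G\<close> with powers of the sizes of the
  level sets and later give the two bounds on the number of full levels.\<close>

lemma level_pair_bounds:
  fixes f g :: "int \<Rightarrow> real" and N :: int and c d \<theta> q :: real
  defines "Z \<equiv> {0..<N}"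
  assumes q: "1 < q" and N: "N > 0" and f: "\<And>x. 0 \<le> f x" "(\<Sum>x\<in>Z. f x) = 1" and g: "\<And>x. 0 \<le> g x" "(\<Sum>x\<in>Z. g x) = 1"
    and c: "c > 0" "d > 0" and \<theta>: "0 < \<theta>" "\<theta> \<le> 1"
  defines "A \<equiv> level Z f c" and "B \<equiv> level Z g d"
  defines "F \<equiv> \<Sum>x\<in>Z. f x powr q" and "G \<equiv> \<Sum>x\<in>Z. g x powr q"
    and "R \<equiv> \<Sum>z\<in>Z. shift_sum B (- 1) (ind_mod N A) z powr q"
  assumes main: "\<theta> * F \<le> (c * d) powr q * R"
  shows "card A > 0" "card B > 0" "F > 0"
    and "\<theta> / 4 powr q * card A * card B powr q \<le> R"
    and "\<theta> * F / 2 powr q \<le> c powr q * card A"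
    and "\<theta> powr (1 / q) / 2 \<le> d * card B"
    and "F \<le> 4 powr q / \<theta> * card A powr (1 - q)"
    and "\<theta> / 4 powr q * card B powr (1 - q) \<le> G"
proof -
  define \<alpha> \<beta> where "\<alpha> = real (card A)" and "\<beta> = real (card B)"
  have fZ: "finite Z" by (simp add: Z_def)
  have AZ: "A \<subseteq> {0..<N}" and BZ: "B \<subseteq> Z" by (auto simp: A_def B_def level_def Z_def)
  have fB: "finite B" and fA: "finite A" using AZ BZ fZ finite_subset by blast+
  show F: "F > 0"
  proof -
    have "\<exists>x\<in>Z. f x \<noteq> 0"
    proof (rule ccontr)
      assume "\<not> ?thesis"
      then have "(\<Sum>x\<in>Z. f x) = 0" by simp
      then show False using f(2) by simp
    qed
    then obtain x where "x \<in> Z" "f x \<noteq> 0" by blast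
    then show ?thesis unfolding F_def using fZ by (intro sum_pos2[of _ x]) auto
  qed
  note rb = shift_sum_ind_bounds[OF N AZ fB, of "-1", folded Z_def \<alpha>_def \<beta>_def]
  have R: "R \<le> \<alpha> * \<beta> powr q"
  proof (cases "\<beta> = 0")
    case False
    then have b: "\<beta> > 0" by (simp add: \<beta>_def)
    have "R \<le> (\<Sum>z\<in>Z. \<beta> powr (q - 1) * shift_sum B (- 1) (ind_mod N A) z)"
      unfolding R_def
    proof (rule sum_mono)
      fix z
      let ?r = "shift_sum B (- 1) (ind_mod N A) z"
      show "?r powr q \<le> \<beta> powr (q - 1) * ?r"
      proof (cases "?r = 0")
        case False
        then have r: "?r > 0" using rb(1)[of z] by linarith
        have "?r powr q = ?r powr (q - 1) * ?r" using r by (simp add: powr_diff)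
        also have "\<dots> \<le> \<beta> powr (q - 1) * ?r" using r rb(2)[of z] q by (intro mult_right_mono powr_mono2) auto
        finally show ?thesis .
      qed simp
    qed
    also have "\<dots> = \<beta> powr (q - 1) * (\<alpha> * \<beta>)" unfolding sum_distrib_left[symmetric] rb(3) ..
    also have "\<dots> = \<alpha> * \<beta> powr q" using b by (simp add: powr_diff)
    finally show ?thesis .
  next
    case True
    then have "B = {}" using fB by (simp add: \<beta>_def)
    then have "R = 0" by (simp add: R_def shift_sum_def)
    then show ?thesis by (simp add: \<alpha>_def)
  qed
  have "0 < \<theta> * F" using F \<theta> by simp
  also have "\<dots> \<le> (c * d) powr q * (\<alpha> * \<beta> powr q)" using main R by (meson mult_left_mono order_trans powr_ge_zero)
  finally have pos: "0 < (c * d) powr q * (\<alpha> * \<beta> powr q)" .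
  then have "\<alpha> \<noteq> 0" "\<beta> \<noteq> 0" by auto
  then have ab: "\<alpha> > 0" "\<beta> > 0" by (auto simp: \<alpha>_def \<beta>_def)
  then show "card A > 0" "card B > 0" by (auto simp: \<alpha>_def \<beta>_def)
  have ca: "c * \<alpha> \<le> 2"
  proof -
    have "\<alpha> * (c / 2) = (\<Sum>x\<in>A. c / 2)" by (simp add: \<alpha>_def)
    also have "\<dots> \<le> (\<Sum>x\<in>A. f x)" by (intro sum_mono) (auto simp: A_def level_def)
    also have "\<dots> \<le> (\<Sum>x\<in>Z. f x)" using f(1) AZ fZ by (intro sum_mono2) (auto simp: Z_def)
    finally show ?thesis using f(2) by (simp add: mult.commute)
  qed
  have db: "d * \<beta> \<le> 2"
  proof -
    have "\<beta> * (d / 2) = (\<Sum>x\<in>B. d / 2)" by (simp add: \<beta>_def)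
    also have "\<dots> \<le> (\<Sum>x\<in>B. g x)" by (intro sum_mono) (auto simp: B_def level_def)
    also have "\<dots> \<le> (\<Sum>x\<in>Z. g x)" using g(1) BZ fZ by (intro sum_mono2) auto
    finally show ?thesis using g(2) by (simp add: mult.commute)
  qed
  have Fa: "\<alpha> * (c / 2) powr q \<le> F"
  proof -
    have "\<alpha> * (c / 2) powr q = (\<Sum>x\<in>A. (c / 2) powr q)" by (simp add: \<alpha>_def)
    also have "\<dots> \<le> (\<Sum>x\<in>A. f x powr q)" using q c by (intro sum_mono powr_mono2) (auto simp: A_def level_def)
    also have "\<dots> \<le> F" unfolding F_def using AZ fZ by (intro sum_mono2) (auto simp: Z_def)
    finally show ?thesis .
  qed
  have Gb: "\<beta> * (d / 2) powr q \<le> G"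
  proof -
    have "\<beta> * (d / 2) powr q = (\<Sum>x\<in>B. (d / 2) powr q)" by (simp add: \<beta>_def)
    also have "\<dots> \<le> (\<Sum>x\<in>B. g x powr q)" using q c by (intro sum_mono powr_mono2) (auto simp: B_def level_def)
    also have "\<dots> \<le> G" unfolding G_def using BZ fZ by (intro sum_mono2) auto
    finally show ?thesis .
  qed
  define cq dq bq aq where "cq = c powr q" and "dq = d powr q" and "bq = \<beta> powr q" and "aq = \<alpha> powr q"
  have pq: "cq > 0" "dq > 0" "bq > 0" "aq > 0" using c ab by (auto simp: cq_def dq_def bq_def aq_def)
  have cd: "(c * d) powr q = cq * dq" "(c / 2) powr q = cq / 2 powr q" "(d / 2) powr q = dq / 2 powr q"
    using c by (auto simp: cq_def dq_def powr_mult powr_divide)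
  define tq :: real where "tq = 2 powr q"
  have tq: "tq > 0" "4 powr q = tq * tq" unfolding tq_def by (auto simp: powr_mult[symmetric])
  have dbq: "dq * bq \<le> tq"
  proof -
    have "(d * \<beta>) powr q \<le> 2 powr q" using db c ab q by (intro powr_mono2) auto
    then show ?thesis using c ab by (simp add: powr_mult dq_def bq_def tq_def)
  qed
  have caq: "cq * aq \<le> tq"
  proof -
    have "(c * \<alpha>) powr q \<le> 2 powr q" using ca c ab q by (intro powr_mono2) auto
    then show ?thesis using c ab by (simp add: powr_mult cq_def aq_def tq_def)
  qed
  have m1: "\<theta> * F \<le> cq * dq * R" using main by (simp add: cd)
  have m2: "\<theta> * F \<le> cq * dq * (\<alpha> * bq)" using m1 R pq unfolding bq_def[symmetric] by (meson mult_left_mono order_trans less_imp_le mult_pos_pos)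
  have fa: "\<alpha> * cq \<le> tq * F" using Fa tq by (simp add: cd tq_def[symmetric] field_simps)
  have gb: "\<beta> * dq \<le> tq * G" using Gb tq by (simp add: cd tq_def[symmetric] field_simps)
  have "\<theta> / 4 powr q * \<alpha> * bq \<le> R"
  proof -
    have "\<theta> * (\<alpha> * cq) \<le> \<theta> * (tq * F)" using fa \<theta> by (intro mult_left_mono) auto
    also have "\<dots> = tq * (\<theta> * F)" by simp
    also have "\<dots> \<le> tq * (cq * dq * R)" using m1 tq by (intro mult_left_mono) auto
    finally have "cq * (\<theta> * \<alpha>) \<le> cq * (tq * dq * R)" by (simp add: mult_ac)
    then have 3: "\<theta> * \<alpha> \<le> tq * dq * R" using pq by simp
    have R0: "R \<ge> 0" unfolding R_def by (intro sum_nonneg) simp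
    have "\<theta> * \<alpha> * bq \<le> tq * dq * R * bq" using 3 pq by (intro mult_right_mono) auto
    also have "\<dots> = tq * R * (dq * bq)" by simp
    also have "\<dots> \<le> tq * R * tq" using dbq tq R0 by (intro mult_left_mono) auto
    finally show ?thesis using tq by (simp add: field_simps)
  qed
  then show "\<theta> / 4 powr q * card A * card B powr q \<le> R" by (simp add: \<alpha>_def \<beta>_def bq_def)
  have "\<theta> * F \<le> cq * \<alpha> * tq"
  proof -
    have "\<theta> * F \<le> (cq * \<alpha>) * (dq * bq)" using m2 by (simp add: mult_ac)
    also have "\<dots> \<le> (cq * \<alpha>) * tq" using dbq pq ab by (intro mult_left_mono) auto
    finally show ?thesis .
  qed
  then have 4: "\<theta> * F / tq \<le> cq * \<alpha>" using tq by (simp add: field_simps)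
  then show "\<theta> * F / 2 powr q \<le> c powr q * card A" by (simp add: tq_def cq_def \<alpha>_def)
  \<comment> \<open>\<open>F\<close> cancels here, because the level set satisfies
    \<open>\<alpha> * c powr q \<le> 2 powr q * F\<close>.\<close>
  have 5: "\<theta> \<le> tq * (dq * bq)"
  proof -
    have "\<theta> * F \<le> (\<alpha> * cq) * (dq * bq)" using m2 by (simp add: mult_ac)
    also have "\<dots> \<le> (tq * F) * (dq * bq)" using fa pq by (intro mult_right_mono) auto
    finally have "\<theta> * F \<le> (tq * (dq * bq)) * F" by (simp add: mult_ac)
    then show ?thesis using F by simp
  qed
  have "\<theta> powr (1 / q) \<le> (tq * (dq * bq)) powr (1 / q)" using 5 \<theta> q by (intro powr_mono2) auto
  also have "\<dots> = 2 * (d * \<beta>)"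
  proof -
    have "tq * (dq * bq) = (2 * (d * \<beta>)) powr q" using c ab by (simp add: powr_mult tq_def dq_def bq_def)
    then show ?thesis using q c ab by (simp add: powr_powr)
  qed
  finally show "\<theta> powr (1 / q) / 2 \<le> d * card B" by (simp add: \<beta>_def)
  have a1: "\<alpha> powr (1 - q) = \<alpha> / aq" "\<beta> powr (1 - q) = \<beta> / bq" using ab by (simp_all add: powr_diff aq_def bq_def)
  have "\<theta> * F \<le> tq * tq * (\<alpha> / aq)"
  proof -
    have "\<theta> * F * aq \<le> (cq * \<alpha> * tq) * aq" using 4 tq pq by (intro mult_right_mono) (auto simp: field_simps)
    also have "\<dots> = (cq * aq) * (\<alpha> * tq)" by simp
    also have "\<dots> \<le> tq * (\<alpha> * tq)" using caq ab tq by (intro mult_right_mono) auto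
    finally show ?thesis using pq by (simp add: field_simps)
  qed
  then show "F \<le> 4 powr q / \<theta> * card A powr (1 - q)"
  proof -
    have "F \<le> tq * tq * (\<alpha> / aq) / \<theta>" using \<open>\<theta> * F \<le> tq * tq * (\<alpha> / aq)\<close> \<theta>(1) by (simp only: pos_le_divide_eq mult.commute)
    then show ?thesis unfolding \<alpha>_def[symmetric] a1 tq(2) by (simp add: mult_ac)
  qed
  have "\<theta> * \<beta> \<le> tq * (tq * G) * bq"
  proof -
    have "\<theta> * \<beta> \<le> tq * (dq * bq) * \<beta>" using 5 ab by (intro mult_right_mono) auto
    also have "\<dots> = tq * (\<beta> * dq) * bq" by simp
    also have "\<dots> \<le> tq * (tq * G) * bq" using gb tq pq by (intro mult_right_mono mult_left_mono) auto
    finally show ?thesis .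
  qed
  then show "\<theta> / 4 powr q * card B powr (1 - q) \<le> G"
    unfolding \<beta>_def[symmetric] a1 tq(2) using pq tq by (simp add: field_simps)
qed

section \<open>The structure theorem on integers\<close>


lemma card_image_add_mod:
  assumes "N > 0" "X \<subseteq> {0..<N}"
  shows "card ((\<lambda>x::int. (x + t) mod N) ` X) = card X"
  using inj_on_subset[OF bij_betw_imp_inj_on[OF bij_betw_add_mod[OF assms(1)]] assms(2)] by (rule card_image)

lemma reg_thin_translate:
  assumes b: "b > 0" and r: "reg b h \<rho> ((\<lambda>x. (x + t) mod N) ` X)" and \<tau>: "\<And>k. k < h \<Longrightarrow> 1 \<le> \<tau> k \<and> \<tau> k \<le> \<rho> k"
  shows "\<exists>Y\<subseteq>X. reg b h \<tau> ((\<lambda>x. (x + t) mod N) ` Y)"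
proof -
  obtain Z where "Z \<subseteq> (\<lambda>x. (x + t) mod N) ` X" "reg b h \<tau> Z" using reg_thin[OF b r \<tau>] by blast
  then show ?thesis by (metis subset_imageE)
qed

text \<open>A multiplicative Markov inequality: factors below \<open>y\<close> are still at least
  1.\<close>

lemma prod_ratio_count:
  fixes v :: "nat \<Rightarrow> real" and y :: real
  assumes "finite F" "\<And>k. k \<in> F \<Longrightarrow> 1 \<le> v k" "1 \<le> y"
  shows "y ^ card {k \<in> F. y \<le> v k} \<le> (\<Prod>k\<in>F. v k)"
proof -
  have "y ^ card {k \<in> F. y \<le> v k} = (\<Prod>k\<in>{k \<in> F. y \<le> v k}. y)" by simp
  also have "\<dots> = (\<Prod>k\<in>F. if y \<le> v k then y else 1)" using assms(1) by (subst prod.inter_filter) auto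
  also have "\<dots> \<le> (\<Prod>k\<in>F. v k)" using assms by (intro prod_mono) auto
  finally show ?thesis .
qed

text \<open>Every numerical loss is recorded as a multiple of \<open>\<eta> * m\<close>, which frees
  the structural argument from limits; \<open>ex_parameters\<close> provides the assumptions for all
  large \<open>l\<close>. \<open>\<sigma>\<close> is the energy constant of
  \<open>energy_from_q_norm\<close> for a level pair with loss \<open>\<theta>\<close>. The value
  \<open>\<phi>\<^sup>2 / 20\<close> keeps the total loss
  \<open>12 / \<phi> * \<eta> + 3 * \<eta>\<close> within \<open>\<phi>\<close>.\<close>

locale parameters = scales +
  fixes q \<delta> \<epsilon> :: real and l j :: nat
  fixes \<phi> \<eta> m \<theta> \<sigma> r
  defines "\<phi> \<equiv> min \<delta> 1 / 2" and "\<eta> \<equiv> \<phi>\<^sup>2 / 20" and "m \<equiv> l * D"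
    and "\<theta> \<equiv> 2 powr (- 2 * \<epsilon> * m * q)"
    and "\<sigma> \<equiv> (\<theta> / 4 powr q / 2) powr (1 / (q - 1)) * (\<theta> / 4 powr q / 2)"
    and "r \<equiv> (\<sigma>\<^sup>2 / 4) ^ (2 ^ j)"
  assumes q: "1 < q" and \<delta>: "0 < \<delta>" and \<epsilon>: "0 < \<epsilon>" "\<epsilon> \<le> 1/2" and nj: "n = 2 ^ Suc j"
    and m6: "m \<ge> 6" and lev: "2 * 2 powr q * (9 * (real m)\<^sup>2) powr (q + 1) \<le> 2 powr (\<epsilon> * m * q)"
    and reg_loss: "(4 * (real D + 1)) ^ l \<le> 2 powr (\<eta> * m)" and two_loss: "2 ^ l \<le> 2 powr (\<eta> * m)"
    and r_loss: "(2 / r)\<^sup>2 \<le> 2 powr (\<eta> * m)"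
    and n_loss: "2 * real n + 3 \<le> 2 powr (\<eta> * m)"
    and carry_loss: "(b ^ (2 * M + 1) * (2 * real n + 3)) ^ (l div P) \<le> 2 powr (6 * \<eta> * m)"
    and unfilled_loss: "real D * ((l div P) * (2 * M) + P) \<le> 3 * \<eta> * m"
begin

lemma \<phi>: "0 < \<phi>" "\<phi> \<le> 1/2" "2 * \<phi> \<le> \<delta>" "\<eta> > 0"
  using \<delta> by (auto simp: \<phi>_def \<eta>_def min_def)

lemma \<theta>: "0 < \<theta>" "\<theta> \<le> 1"
proof -
  show "0 < \<theta>" by (simp add: \<theta>_def)
  have "- 2 * \<epsilon> * m * q \<le> 0" using q \<epsilon> by (simp add: mult_nonneg_nonneg)
  then have "2 powr (- 2 * \<epsilon> * m * q) \<le> 2 powr (0::real)" by (intro powr_mono) auto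
  then show "\<theta> \<le> 1" by (simp add: \<theta>_def)
qed

definition "\<Lambda> = 2 powr (\<eta> * m)"

text \<open>All quantities are dominated by \<open>(2 / r)\<^sup>2\<close>:
  \<open>r \<le> \<sigma> / 4\<close>, and \<open>\<sigma>\<close> is a product of two factors at
  most 1, hence at most each of them. So the upper bounds all come from
  \<open>r_loss\<close>.\<close>

lemma losses: "\<Lambda> \<ge> 1" "\<sigma> > 0" "r > 0" "2 / \<sigma> \<le> \<Lambda>" "2 / r \<le> \<Lambda>" "4 powr q / \<theta> \<le> \<Lambda>" "(4 powr q / \<theta>) powr (1 / (q - 1)) \<le> \<Lambda>"
proof -
  define u where "u = \<theta> / 4 powr q"
  have q4: "4 powr q \<ge> (4::real)" using powr_mono[of 1 q "4::real"] q by simp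
  have u: "u > 0" "u \<le> 1" using \<theta> q4 by (auto simp: u_def field_simps)
  define p where "p = (u / 2) powr (1 / (q - 1))"
  have p: "p > 0" "p \<le> 1" using u q by (auto simp: p_def intro!: powr_le1)
  have \<sigma>: "\<sigma> = p * (u / 2)" by (simp add: \<sigma>_def p_def u_def)
  show s0: "\<sigma> > 0" unfolding \<sigma> using p u by simp
  have su: "\<sigma> \<le> u / 2" unfolding \<sigma> using p u mult_right_mono[of p 1 "u / 2"] by simp
  have sp: "\<sigma> \<le> p" unfolding \<sigma> using p u mult_left_mono[of "u / 2" 1 p] by simp
  have s1: "\<sigma> \<le> 1" using sp p by simp
  have sq: "\<sigma>\<^sup>2 \<le> \<sigma>" using s0 s1 by (simp add: power2_eq_square mult_le_cancel_left1)
  have "\<sigma>\<^sup>2 / 4 \<le> 1" using sq s1 by linarith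
  then have "r \<le> (\<sigma>\<^sup>2 / 4) ^ 1" unfolding r_def by (intro power_decreasing) (use s0 in auto)
  then have rs: "r \<le> \<sigma> / 4" using sq by simp
  show r0: "r > 0" using s0 by (simp add: r_def)
  have "1 \<le> 2 / r" using rs s1 r0 by (simp add: field_simps)
  then have "2 / r \<le> (2 / r)\<^sup>2" by (rule self_le_power) simp
  then show 2: "2 / r \<le> \<Lambda>" using r_loss by (simp add: \<Lambda>_def)
  then show "\<Lambda> \<ge> 1" using \<open>1 \<le> 2 / r\<close> by simp
  have "2 / \<sigma> \<le> 2 / r" using rs r0 s0 by (intro divide_left_mono) auto
  then show "2 / \<sigma> \<le> \<Lambda>" using 2 by simp
  have "4 powr q / \<theta> = 1 / u" by (simp add: u_def)
  have "1 / u \<le> 2 / \<sigma>" using su s0 u by (simp add: field_simps)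
  then show "4 powr q / \<theta> \<le> \<Lambda>" using \<open>2 / \<sigma> \<le> \<Lambda>\<close> \<open>4 powr q / \<theta> = 1 / u\<close> by simp
  have "(1 / u) powr (1 / (q - 1)) \<le> (1 / (u / 2)) powr (1 / (q - 1))" using u q by (intro powr_mono2) (auto simp: field_simps)
  also have "\<dots> = 1 / p" unfolding p_def by (subst powr_divide) (use u in auto)
  also have "\<dots> \<le> 2 / \<sigma>" using sp s0 p by (simp add: field_simps)
  finally show "(4 powr q / \<theta>) powr (1 / (q - 1)) \<le> \<Lambda>" using \<open>2 / \<sigma> \<le> \<Lambda>\<close> \<open>4 powr q / \<theta> = 1 / u\<close> by simp
qed

lemma bpow: "b ^ l = 2 ^ m"
  by (simp add: b_def m_def power_mult[symmetric] mult.commute)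

text \<open>Two thresholds are at work. A level is full if \<open>\<rho> k\<close> reaches
  \<open>T = 2 powr ((1 - \<phi>) * D)\<close>, where \<open>2 * \<phi> \<le> \<delta>\<close>; at
  all other levels \<open>A\<close> is thinned until its branching is below
  \<open>2 powr ((1 - \<delta>) * D)\<close>, as far as \<open>\<delta> < 1\<close>. The levels
  counted at the end are then full in the stronger sense, and the gap pays for the losses in the
  upper bound.\<close>

lemma integer_structure:
  fixes f g :: "int \<Rightarrow> real"
  defines "N \<equiv> 2 ^ m" and "Z \<equiv> {0..<2 ^ m}"
  assumes f: "\<And>x. 0 \<le> f x" "(\<Sum>x\<in>Z. f x) = 1" and g: "\<And>x. 0 \<le> g x" "(\<Sum>x\<in>Z. g x) = 1"
  defines "F \<equiv> \<Sum>x\<in>Z. f x powr q" and "G \<equiv> \<Sum>x\<in>Z. g x powr q"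
  assumes H: "(\<Sum>z\<in>Z. (\<Sum>y\<in>Z. g y * f ((z - y) mod N)) powr q) \<ge> 2 powr (- \<epsilon> * m * q) * F"
  shows "\<exists>A\<subseteq>Z. \<exists>B\<subseteq>Z. \<exists>tA tB \<rho> \<tau>.
    reg b l \<rho> ((\<lambda>x. (x + tA) mod N) ` A) \<and> (\<forall>x\<in>A. central b l ((x + tA) mod N)) \<and>
    reg b l \<tau> ((\<lambda>x. (x + tB) mod N) ` B) \<and> (\<forall>x\<in>B. central b l ((x + tB) mod N)) \<and>
    (\<forall>x\<in>A. f x > 0) \<and> (\<forall>x\<in>A. \<forall>y\<in>A. f y \<le> 2 * f x) \<and>
    (\<forall>x\<in>B. g x > 0) \<and> (\<forall>x\<in>B. \<forall>y\<in>B. g y \<le> 2 * g x) \<and>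
    2 powr (- \<delta> * m * q) * F \<le> (\<Sum>x\<in>A. f x powr q) \<and> 2 powr (- \<delta> * m) \<le> (\<Sum>x\<in>B. g x) \<and>
    (\<forall>k<l. \<tau> k = 1 \<or> real (\<rho> k) \<ge> 2 powr ((1 - \<delta>) * D)) \<and>
    log 2 (G powr (- 1 / (q - 1))) - \<delta> * m \<le> real D * card {k. k < l \<and> real (\<rho> k) \<ge> 2 powr ((1 - \<delta>) * D)} \<and>
    real D * card {k. k < l \<and> real (\<rho> k) \<ge> 2 powr ((1 - \<delta>) * D)} \<le> log 2 (F powr (- 1 / (q - 1))) + \<delta> * m"
proof -
  have N: "N > 0" by (simp add: N_def)
  have NZ: "Z = {0..<N}" by (simp add: N_def Z_def)
  have Nb: "b ^ l = N" by (simp add: N_def bpow)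
  have bpos: "real_of_int b > 0" using b by simp
  have br: "real_of_int b = 2 powr D" by (simp add: b_def powr_realpow)
  obtain c d where cd: "c > 0" "d > 0" and
    cdm: "\<theta> * F \<le> (c * d) powr q * (\<Sum>z\<in>Z. shift_sum (level Z g d) (- 1) (ind_mod N (level Z f c)) z powr q)"
    using ex_level_pair[OF q f(1) f(2)[unfolded Z_def] g(1) g(2)[unfolded Z_def] H[unfolded Z_def N_def F_def] \<epsilon>(2) m6 lev,
        folded Z_def, folded N_def \<theta>_def, folded F_def]
    by (elim exE conjE) (rule that, assumption+)
  define A0 B0 where "A0 = level Z f c" and "B0 = level Z g d"
  have A0Z: "A0 \<subseteq> {0..<N}" and B0Z: "B0 \<subseteq> {0..<N}" by (auto simp: A0_def B0_def level_def NZ)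
  define \<alpha> \<beta> where "\<alpha> = real (card A0)" and "\<beta> = real (card B0)"
  note lp = level_pair_bounds[OF q N f(1) f(2)[unfolded NZ] g(1) g(2)[unfolded NZ] cd \<theta> cdm[unfolded F_def NZ],
      folded NZ, folded F_def G_def A0_def B0_def, folded \<alpha>_def \<beta>_def]
  have ab: "\<alpha> > 0" "\<beta> > 0" using lp(1,2) by (auto simp: \<alpha>_def \<beta>_def)
  have ne: "A0 \<noteq> {}" "B0 \<noteq> {}" using lp(1,2) by auto
  have F0: "F > 0" by (rule lp(3))
  have fin: "finite A0" "finite B0" using A0Z B0Z finite_subset by blast+
  let ?r = "shift_sum B0 (- 1) (ind_mod N A0)"
  note rb = shift_sum_ind_bounds[OF N A0Z fin(2), of "-1", folded \<alpha>_def \<beta>_def]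
  have "(\<theta> / 4 powr q / 2) powr (1 / (q - 1)) * (\<theta> / 4 powr q / 2) * \<alpha> * \<beta>\<^sup>2 \<le> (\<Sum>z\<in>{0..<N}. (?r z)\<^sup>2)"
    using rb(1-3) q ab \<theta> lp(4) by (intro energy_from_q_norm) (auto simp: NZ)
  then have E: "inner_mod (b ^ l) (shift_sum B0 (- 1) (ind_mod (b ^ l) A0)) (shift_sum B0 (- 1) (ind_mod (b ^ l) A0))
      \<ge> \<sigma> * card A0 * (card B0)\<^sup>2"
    unfolding Nb by (simp add: inner_mod_def \<sigma>_def \<alpha>_def \<beta>_def power2_eq_square)
  obtain A B tA tB \<rho> \<tau> Fl where AB: "A \<subseteq> A0" "B \<subseteq> B0"
    and As: "reg b l \<rho> ((\<lambda>x. (x + tA) mod N) ` A)" "\<forall>x\<in>A. central b l ((x + tA) mod N)"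
    and Bs: "reg b l \<tau> ((\<lambda>x. (x + tB) mod N) ` B)" "\<forall>x\<in>B. central b l ((x + tB) mod N)"
    and lA: "r / 2 * card A0 \<le> (4 * (D + 1)) ^ l * card A" and lB: "\<sigma> / 2 * card B0 \<le> (4 * (D + 1)) ^ l * card B"
    and Fl: "Fl \<subseteq> {..<l}" "card ({k\<in>{..<l}. \<tau> k \<ge> 2} - Fl) \<le> (l div P) * (2 * M) + P"
    and prodF: "(\<Prod>k\<in>Fl. b / \<rho> k) \<le> (4 * (D + 1)) ^ l * (2 / r)\<^sup>2 * (2 * real n + 3) * (b ^ (2 * M + 1) * (2 * real n + 3)) ^ (l div P)"
    using structured_pair[OF nj A0Z[folded Nb] ne(1) B0Z[folded Nb] ne(2) losses(2) E, folded r_def, unfolded Nb]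
    by (elim exE conjE) (rule that, assumption+)
  have \<rho>1: "1 \<le> \<rho> k" "real (\<rho> k) \<le> b" if "k < l" for k
    using reg_pos[OF b(2) As(1) that] reg_le[OF b(2) As(1) that] by (auto simp: of_int_le_iff[where 'a=real, symmetric] simp del: of_int_le_iff)
  have \<tau>1: "1 \<le> \<tau> k" "real (\<tau> k) \<le> b" if "k < l" for k
    using reg_pos[OF b(2) Bs(1) that] reg_le[OF b(2) Bs(1) that] by (auto simp: of_int_le_iff[where 'a=real, symmetric] simp del: of_int_le_iff)
  have "r / 2 * \<alpha> \<le> \<Lambda> * card A"
  proof -
    have "r / 2 * \<alpha> \<le> (4 * (real D + 1)) ^ l * card A" using lA by (simp add: \<alpha>_def add.commute)
    also have "\<dots> \<le> \<Lambda> * card A" using reg_loss unfolding \<Lambda>_def by (intro mult_right_mono) auto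
    finally show ?thesis .
  qed
  then have "\<alpha> \<le> (2 / r) * (\<Lambda> * card A)" using losses(3) by (simp add: field_simps)
  also have "\<dots> \<le> \<Lambda> * (\<Lambda> * card A)" using losses(1,5) by (intro mult_right_mono) auto
  finally have cA: "\<alpha> \<le> \<Lambda>\<^sup>2 * card A" by (simp add: power2_eq_square)
  have "\<sigma> / 2 * \<beta> \<le> \<Lambda> * card B"
  proof -
    have "\<sigma> / 2 * \<beta> \<le> (4 * (real D + 1)) ^ l * card B" using lB by (simp add: \<beta>_def add.commute)
    also have "\<dots> \<le> \<Lambda> * card B" using reg_loss unfolding \<Lambda>_def by (intro mult_right_mono) auto
    finally show ?thesis .
  qed
  then have "\<beta> \<le> (2 / \<sigma>) * (\<Lambda> * card B)" using losses(2) by (simp add: field_simps)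
  also have "\<dots> \<le> \<Lambda> * (\<Lambda> * card B)" using losses(1,4) by (intro mult_right_mono) auto
  finally have cB: "\<beta> \<le> \<Lambda>\<^sup>2 * card B" by (simp add: power2_eq_square)

  define T where "T = 2 powr ((1 - \<phi>) * D)"
  \<comment> \<open>Levels violating the dichotomy with the stronger threshold; \<open>B\<close>
    will keep one child per node there.\<close>
  define Kill where "Kill = {k. k < l \<and> \<tau> k \<ge> 2 \<and> real (\<rho> k) < T}"
  have fK: "finite Kill" by (rule finite_subset[of _ "{..<l}"]) (auto simp: Kill_def)
  have fFl: "finite Fl" using Fl(1) finite_subset by blast
  \<comment> \<open>Two sources, both with weight \<open>D\<close>: levels missed by
    \<open>Fl\<close> contribute at most \<open>3 * \<eta> * m\<close>, and levels of
    \<open>Fl\<close> with \<open>b / \<rho> k \<ge> y\<close> at most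
    \<open>9 * \<eta> * m / \<phi>\<close>, because their product is at most
    \<open>2 powr (9 * \<eta> * m)\<close>.\<close>
  have kill: "real D * card Kill \<le> 12 / \<phi> * \<eta> * m"
  proof -
    define y where "y = 2 powr (\<phi> * D)"
    have y: "y \<ge> 1" using \<phi> by (simp add: y_def ge_one_powr_ge_zero)
    have bT: "real_of_int b = T * y" by (simp add: br T_def y_def powr_add[symmetric] algebra_simps)
    let ?W = "{k \<in> Fl. y \<le> b / \<rho> k}"
    have "Kill \<subseteq> ({k\<in>{..<l}. \<tau> k \<ge> 2} - Fl) \<union> ?W"
    proof
      fix k assume k: "k \<in> Kill"
      have "y * \<rho> k \<le> b" using k y unfolding bT Kill_def by (simp add: mult.commute[of T] mult_left_mono)
      moreover have "real (\<rho> k) > 0" using \<rho>1(1)[of k] k by (simp add: Kill_def)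
      ultimately have "y \<le> b / \<rho> k" by (simp add: field_simps)
      then show "k \<in> ({k\<in>{..<l}. \<tau> k \<ge> 2} - Fl) \<union> ?W" using k by (auto simp: Kill_def)
    qed
    then have "card Kill \<le> card (({k\<in>{..<l}. \<tau> k \<ge> 2} - Fl) \<union> ?W)" using fFl by (intro card_mono) auto
    also have "\<dots> \<le> card ({k\<in>{..<l}. \<tau> k \<ge> 2} - Fl) + card ?W" by (rule card_Un_le)
    finally have "card Kill \<le> (l div P) * (2 * M) + P + card ?W" using Fl(2) by simp
    then have "real (card Kill) \<le> real ((l div P) * (2 * M) + P) + card ?W" by (simp flip: of_nat_add)
    then have "real D * card Kill \<le> real D * (real ((l div P) * (2 * M) + P) + card ?W)" by (intro mult_left_mono) auto
    then have k1: "real D * card Kill \<le> 3 * \<eta> * m + real D * card ?W" using unfilled_loss by (simp add: distrib_left)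
    have "y ^ card ?W \<le> (\<Prod>k\<in>Fl. b / \<rho> k)"
      using \<rho>1 Fl(1) y by (intro prod_ratio_count fFl) (auto simp: subset_iff field_simps Suc_le_eq)
    also have "\<dots> \<le> (4 * (real D + 1)) ^ l * (2 / r)\<^sup>2 * (2 * real n + 3) * (b ^ (2 * M + 1) * (2 * real n + 3)) ^ (l div P)"
      using prodF by (simp add: add.commute)
    also have "\<dots> \<le> \<Lambda> * \<Lambda> * \<Lambda> * 2 powr (6 * \<eta> * m)"
      using reg_loss r_loss n_loss carry_loss bpos unfolding \<Lambda>_def by (intro mult_mono) auto
    also have "\<dots> = 2 powr (9 * \<eta> * m)" by (simp add: \<Lambda>_def powr_add[symmetric] mult.assoc)
    finally have "2 powr (\<phi> * D * card ?W) \<le> 2 powr (9 * \<eta> * m)"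
      unfolding y_def by (simp add: powr_realpow[symmetric] powr_powr)
    then have "\<phi> * (real D * card ?W) \<le> 9 * \<eta> * m" by (simp add: mult.assoc)
    then have "real D * card ?W \<le> 9 * \<eta> * m / \<phi>" using \<phi>(1) by (simp add: field_simps)
    moreover have "3 * \<eta> * m \<le> 3 * \<eta> * m / \<phi>" using \<phi> by (simp add: pos_le_divide_eq mult_left_le)
    ultimately show ?thesis using k1 by (simp add: add_divide_distrib[symmetric])
  qed

  \<comment> \<open>The largest integer strictly below the threshold, but at least 1, because every
    node must keep a child; the maximum takes effect exactly when
    \<open>\<delta> \<ge> 1\<close>.\<close>
  define cap where "cap = max 1 (nat (\<lceil>2 powr ((1 - \<delta>) * D)\<rceil> - 1))"
  have cap1: "cap \<ge> 1" by (simp add: cap_def)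
  have cap2: "real cap \<ge> 2 powr ((1 - \<delta>) * D) / 2"
  proof (cases "2 powr ((1 - \<delta>) * D) \<le> 2")
    case True
    then show ?thesis using cap1 by simp
  next
    case False
    have "nat (\<lceil>2 powr ((1 - \<delta>) * D)\<rceil> - 1) \<le> cap" by (simp add: cap_def)
    then have "real_of_int (\<lceil>2 powr ((1 - \<delta>) * D)\<rceil> - 1) \<le> real cap" by linarith
    then show ?thesis using False by linarith
  qed
  have cap3: "real cap < 2 powr ((1 - \<delta>) * D)" if "\<delta> < 1"
  proof -
    have "1 < 2 powr ((1 - \<delta>) * D)" using powr_less_mono[of 0 "(1 - \<delta>) * D" 2] that D by simp
    then show ?thesis unfolding cap_def by (simp add: max_def) linarith
  qed
  define \<rho>' where "\<rho>' k = (if real (\<rho> k) \<ge> T then \<rho> k else min (\<rho> k) cap)" for k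
  define \<tau>' where "\<tau>' k = (if k \<in> Kill then 1 else \<tau> k)" for k
  have "\<exists>A'\<subseteq>A. reg b l \<rho>' ((\<lambda>x. (x + tA) mod N) ` A')"
    by (rule reg_thin_translate[OF b(2) As(1)]) (use \<rho>1 cap1 in \<open>auto simp: \<rho>'_def\<close>)
  then obtain A' where A': "A' \<subseteq> A" "reg b l \<rho>' ((\<lambda>x. (x + tA) mod N) ` A')" by blast
  have "\<exists>B'\<subseteq>B. reg b l \<tau>' ((\<lambda>x. (x + tB) mod N) ` B')"
    by (rule reg_thin_translate[OF b(2) Bs(1)]) (use \<tau>1 in \<open>auto simp: \<tau>'_def\<close>)
  then obtain B' where B': "B' \<subseteq> B" "reg b l \<tau>' ((\<lambda>x. (x + tB) mod N) ` B')" by blast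
  have subs: "A \<subseteq> {0..<N}" "B \<subseteq> {0..<N}" "A' \<subseteq> {0..<N}" "B' \<subseteq> {0..<N}" using AB A' B' A0Z B0Z by auto
  have cards: "card A = (\<Prod>k<l. \<rho> k)" "card B = (\<Prod>k<l. \<tau> k)" "card A' = (\<Prod>k<l. \<rho>' k)" "card B' = (\<Prod>k<l. \<tau>' k)"
    using reg_card[OF b(2) As(1)] reg_card[OF b(2) Bs(1)] reg_card[OF b(2) A'(2)] reg_card[OF b(2) B'(2)]
      subs card_image_add_mod[OF N] by auto
  let ?S = "{k. k < l \<and> real (\<rho>' k) \<ge> 2 powr ((1 - \<delta>) * D)}"
  have fS: "finite ?S" by (rule finite_subset[of _ "{..<l}"]) auto
  have TS: "2 powr ((1 - \<delta>) * D) \<le> T" using \<phi>(1,3) unfolding T_def by (intro powr_mono mult_right_mono) auto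
  have dich: "\<tau>' k = 1 \<or> real (\<rho>' k) \<ge> 2 powr ((1 - \<delta>) * D)" if "k < l" for k
  proof (cases "\<tau> k \<ge> 2 \<and> real (\<rho> k) \<ge> T")
    case True
    then show ?thesis using TS by (auto simp: \<rho>'_def)
  next
    case False
    then show ?thesis using that \<tau>1(1)[OF that] by (auto simp: \<tau>'_def Kill_def)
  qed
  \<comment> \<open>Switching off a level divides the cardinality by at most
    \<open>b\<close>.\<close>
  have lossB: "card B \<le> 2 powr (12 / \<phi> * \<eta> * m) * card B'"
  proof -
    have "real (card B) = (\<Prod>k<l. real (\<tau> k))" by (simp add: cards)
    also have "\<dots> \<le> (\<Prod>k<l. (if k \<in> Kill then real_of_int b else 1) * real (\<tau>' k))"
      using \<tau>1 by (intro prod_mono) (auto simp: \<tau>'_def)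
    also have "\<dots> = (\<Prod>k<l. if k \<in> Kill then real_of_int b else 1) * card B'" by (simp add: prod.distrib cards)
    also have "(\<Prod>k<l. if k \<in> Kill then real_of_int b else 1) = (\<Prod>k\<in>{..<l} \<inter> Kill. real_of_int b)"
      by (rule prod.inter_restrict[symmetric]) simp
    also have "{..<l} \<inter> Kill = Kill" by (auto simp: Kill_def)
    also have "(\<Prod>k\<in>Kill. real_of_int b) = 2 powr (real D * card Kill)" by (simp add: br powr_realpow[symmetric] powr_powr)
    also have "2 powr (real D * card Kill) * card B' \<le> 2 powr (12 / \<phi> * \<eta> * m) * card B'"
      using kill by (intro mult_right_mono powr_mono) auto
    finally show ?thesis .
  qed
  \<comment> \<open>A capped level loses at most \<open>T / cap\<close>, hence at most
    \<open>2 * 2 powr ((\<delta> - \<phi>) * D)\<close>; the factors 2 are paid by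
    \<open>two_loss\<close>.\<close>
  have lossA: "card A \<le> \<Lambda> * 2 powr ((\<delta> - \<phi>) * m) * card A'"
  proof -
    have "real (card A) = (\<Prod>k<l. real (\<rho> k))" by (simp add: cards)
    also have "\<dots> \<le> (\<Prod>k<l. (2 * 2 powr ((\<delta> - \<phi>) * D)) * real (\<rho>' k))"
    proof (intro prod_mono conjI)
      fix k assume k: "k \<in> {..<l}"
      have o1: "1 \<le> 2 powr ((\<delta> - \<phi>) * D)" using \<phi> by (intro ge_one_powr_ge_zero) auto
      show "real (\<rho> k) \<le> (2 * 2 powr ((\<delta> - \<phi>) * D)) * real (\<rho>' k)"
      proof (cases "\<rho>' k = \<rho> k")
        case True
        then show ?thesis using o1 mult_right_mono[of 1 "2 * 2 powr ((\<delta> - \<phi>) * D)" "real (\<rho> k)"] by simp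
      next
        case False
        then have h: "real (\<rho> k) < T" "\<rho>' k = cap" by (auto simp: \<rho>'_def min_def split: if_splits)
        have "real (\<rho> k) \<le> 2 * 2 powr ((\<delta> - \<phi>) * D) * (2 powr ((1 - \<delta>) * D) / 2)"
          using h(1) by (simp add: T_def powr_add[symmetric] algebra_simps)
        also have "\<dots> \<le> 2 * 2 powr ((\<delta> - \<phi>) * D) * cap" using cap2 by (intro mult_left_mono) auto
        finally show ?thesis by (simp add: h(2))
      qed
    qed auto
    also have "\<dots> = 2 ^ l * 2 powr ((\<delta> - \<phi>) * m) * card A'"
      by (simp add: prod.distrib cards power_mult_distrib powr_realpow[symmetric] powr_powr m_def mult_ac)
    also have "\<dots> \<le> \<Lambda> * 2 powr ((\<delta> - \<phi>) * m) * card A'"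
      using two_loss unfolding \<Lambda>_def by (intro mult_right_mono) auto
    finally show ?thesis .
  qed
  have \<eta>\<phi>: "12 / \<phi> * \<eta> + 3 * \<eta> \<le> \<phi>"
  proof -
    have "12 / \<phi> * \<eta> = 12 / 20 * \<phi>" using \<phi>(1) by (simp add: \<eta>_def power2_eq_square)
    moreover have "3 * \<eta> \<le> 3 / 20 * \<phi>" using \<phi> by (simp add: \<eta>_def power2_eq_square mult_left_le)
    ultimately show ?thesis using \<phi>(1) by simp
  qed
  have \<eta>2: "4 * \<eta> \<le> \<phi>" using \<phi> by (simp add: \<eta>_def power2_eq_square mult_left_le)
  \<comment> \<open>On a level set \<open>f\<close> is constant up to a factor 2, so passing from
    \<open>A0\<close> to \<open>A'\<close> costs little more than the ratio of the
    cardinalities.\<close>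
  have Ai: "2 powr (- \<delta> * m * q) * F \<le> (\<Sum>x\<in>A'. f x powr q)"
  proof -
    have "\<alpha> \<le> \<Lambda>\<^sup>2 * (\<Lambda> * 2 powr ((\<delta> - \<phi>) * m) * card A')"
      by (rule order_trans[OF cA mult_left_mono[OF lossA]]) simp
    also have "\<Lambda>\<^sup>2 * (\<Lambda> * 2 powr ((\<delta> - \<phi>) * m) * card A') = (\<Lambda> * \<Lambda> * \<Lambda> * 2 powr ((\<delta> - \<phi>) * m)) * card A'"
      by (simp only: power2_eq_square mult.assoc)
    also have "\<Lambda> * \<Lambda> * \<Lambda> * 2 powr ((\<delta> - \<phi>) * m) = 2 powr ((\<delta> - \<phi> + 3 * \<eta>) * m)"
      unfolding \<Lambda>_def powr_add[symmetric] by (rule arg_cong[of _ _ "\<lambda>x. 2 powr x"]) (simp add: algebra_simps)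
    finally have a: "\<alpha> \<le> 2 powr ((\<delta> - \<phi> + 3 * \<eta>) * m) * card A'" .
    have "\<theta> * F / 2 powr q \<le> c powr q * \<alpha>" using lp(5) by (simp add: mult.commute)
    also have "\<dots> \<le> c powr q * (2 powr ((\<delta> - \<phi> + 3 * \<eta>) * m) * card A')" using a by (intro mult_left_mono) auto
    also have "\<dots> = 2 powr q * 2 powr ((\<delta> - \<phi> + 3 * \<eta>) * m) * ((c / 2) powr q * card A')" using cd by (simp add: powr_divide)
    also have "(c / 2) powr q * card A' = (\<Sum>x\<in>A'. (c / 2) powr q)" by simp
    also have "\<dots> \<le> (\<Sum>x\<in>A'. f x powr q)"
      using q cd AB A' by (intro sum_mono powr_mono2) (auto simp: A0_def level_def subset_iff)
    finally have "\<theta> * F / 2 powr q \<le> 2 powr q * 2 powr ((\<delta> - \<phi> + 3 * \<eta>) * m) * (\<Sum>x\<in>A'. f x powr q)" by simp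
    then have "\<theta> * F \<le> (2 powr q * 2 powr q) * 2 powr ((\<delta> - \<phi> + 3 * \<eta>) * m) * (\<Sum>x\<in>A'. f x powr q)"
      by (simp add: field_simps)
    also have "2 powr q * 2 powr q = (4::real) powr q" by (simp add: powr_mult[symmetric])
    finally have "F \<le> 4 powr q / \<theta> * (2 powr ((\<delta> - \<phi> + 3 * \<eta>) * m) * (\<Sum>x\<in>A'. f x powr q))"
      using \<theta>(1) by (simp add: field_simps)
    also have "\<dots> \<le> \<Lambda> * (2 powr ((\<delta> - \<phi> + 3 * \<eta>) * m) * (\<Sum>x\<in>A'. f x powr q))"
      using losses(6) by (intro mult_right_mono) (auto intro!: mult_nonneg_nonneg sum_nonneg)
    also have "\<dots> = (\<Lambda> * 2 powr ((\<delta> - \<phi> + 3 * \<eta>) * m)) * (\<Sum>x\<in>A'. f x powr q)"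
      by (simp only: mult.assoc)
    also have "\<Lambda> * 2 powr ((\<delta> - \<phi> + 3 * \<eta>) * m) = 2 powr ((\<delta> - \<phi> + 4 * \<eta>) * m)"
      unfolding \<Lambda>_def powr_add[symmetric] by (rule arg_cong[of _ _ "\<lambda>x. 2 powr x"]) (simp add: algebra_simps)
    also have "2 powr ((\<delta> - \<phi> + 4 * \<eta>) * m) * (\<Sum>x\<in>A'. f x powr q) \<le> 2 powr (\<delta> * m * q) * (\<Sum>x\<in>A'. f x powr q)"
    proof (intro mult_right_mono powr_mono sum_nonneg)
      have "(\<delta> - \<phi> + 4 * \<eta>) * m \<le> \<delta> * m" using \<eta>2 by (intro mult_right_mono) auto
      also have "\<dots> \<le> \<delta> * m * q" using mult_left_mono[of 1 q "\<delta> * m"] q \<delta> by simp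
      finally show "(\<delta> - \<phi> + 4 * \<eta>) * m \<le> \<delta> * m * q" .
    qed auto
    finally have "F / 2 powr (\<delta> * m * q) \<le> (\<Sum>x\<in>A'. f x powr q)" by (subst pos_divide_le_eq) (simp_all add: mult.commute)
    then show ?thesis by (simp add: powr_minus_divide)
  qed
  have cB': "\<beta> \<le> 2 powr ((2 * \<eta> + 12 / \<phi> * \<eta>) * m) * card B'"
  proof -
    have "\<beta> \<le> \<Lambda>\<^sup>2 * (2 powr (12 / \<phi> * \<eta> * m) * card B')"
      by (rule order_trans[OF cB mult_left_mono[OF lossB]]) simp
    also have "\<Lambda>\<^sup>2 * (2 powr (12 / \<phi> * \<eta> * m) * card B') = (\<Lambda> * \<Lambda> * 2 powr (12 / \<phi> * \<eta> * m)) * card B'"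
      by (simp only: power2_eq_square mult.assoc)
    also have "\<Lambda> * \<Lambda> * 2 powr (12 / \<phi> * \<eta> * m) = 2 powr ((2 * \<eta> + 12 / \<phi> * \<eta>) * m)"
      unfolding \<Lambda>_def powr_add[symmetric] by (rule arg_cong[of _ _ "\<lambda>x. 2 powr x"]) (simp add: algebra_simps)
    finally show ?thesis .
  qed
  have \<Lambda>2: "\<Lambda> * 2 powr ((2 * \<eta> + 12 / \<phi> * \<eta>) * m) = 2 powr ((3 * \<eta> + 12 / \<phi> * \<eta>) * m)"
    unfolding \<Lambda>_def powr_add[symmetric] by (rule arg_cong[of _ _ "\<lambda>x. 2 powr x"]) (simp add: algebra_simps)
  have Bi: "2 powr (- \<delta> * m) \<le> (\<Sum>x\<in>B'. g x)"
  proof -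
    have "\<theta> powr 1 \<le> \<theta> powr (1 / q)" using \<theta> q by (intro powr_mono') (auto simp: field_simps)
    then have t: "\<theta> / 2 \<le> d * \<beta>" using lp(6) \<theta> by simp
    have q4: "4 powr q \<ge> (4::real)" using powr_mono[of 1 q "4::real"] q by simp
    have "4 / \<theta> \<le> 4 powr q / \<theta>" using q4 \<theta> by (intro divide_right_mono) auto
    then have "4 / \<theta> \<le> \<Lambda>" using losses(6) by simp
    then have "1 \<le> \<Lambda> * (\<theta> / 2 / 2)" using \<theta>(1) by (simp add: field_simps)
    also have "\<dots> \<le> \<Lambda> * (d * \<beta> / 2)" using t losses(1) by (intro mult_left_mono) auto
    also have "\<dots> \<le> \<Lambda> * (d * (2 powr ((2 * \<eta> + 12 / \<phi> * \<eta>) * m) * card B') / 2)"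
      using cB' losses(1) cd by (intro mult_left_mono divide_right_mono) auto
    also have "\<dots> = (\<Lambda> * 2 powr ((2 * \<eta> + 12 / \<phi> * \<eta>) * m)) * (card B' * (d / 2))"
      by simp
    also note \<Lambda>2
    also have "card B' * (d / 2) = (\<Sum>x\<in>B'. d / 2)" by simp
    also have "2 powr ((3 * \<eta> + 12 / \<phi> * \<eta>) * m) * \<dots> \<le> 2 powr (\<delta> * m) * (\<Sum>x\<in>B'. g x)"
    proof (rule mult_mono)
      have "(3 * \<eta> + 12 / \<phi> * \<eta>) * m \<le> \<delta> * m" using \<eta>\<phi> \<phi> by (intro mult_right_mono) auto
      then show "2 powr ((3 * \<eta> + 12 / \<phi> * \<eta>) * m) \<le> 2 powr (\<delta> * m)" by (rule powr_mono) simp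
      show "(\<Sum>x\<in>B'. d / 2) \<le> (\<Sum>x\<in>B'. g x)"
      proof (rule sum_mono)
        fix x assume "x \<in> B'"
        then have "x \<in> level Z g d" using AB B' by (auto simp: B0_def)
        then show "d / 2 \<le> g x" by (simp add: level_def)
      qed
    qed (use cd in \<open>auto intro!: sum_nonneg\<close>)
    finally have "1 / 2 powr (\<delta> * m) \<le> (\<Sum>x\<in>B'. g x)" by (subst pos_divide_le_eq) (simp_all add: mult.commute)
    then show ?thesis by (simp add: powr_minus_divide)
  qed
  have G0: "G > 0" using lp(8) \<theta> ab by (smt (verit) divide_pos_pos mult_pos_pos powr_gt_zero)
  \<comment> \<open>Up to small losses \<open>G powr (- 1 / (q - 1))\<close> is at most
    \<open>card B0\<close> and so at most \<open>card B'\<close>; and \<open>B'\<close> branches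
    only at counted levels, with at most \<open>b\<close> children each.\<close>
  have lower: "log 2 (G powr (- 1 / (q - 1))) - \<delta> * m \<le> real D * card ?S"
  proof -
    let ?e = "- 1 / (q - 1)"
    have "G powr ?e \<le> (\<theta> / 4 powr q * \<beta> powr (1 - q)) powr ?e"
      using lp(8) \<theta> ab q by (intro powr_mono2') auto
    also have "\<dots> = (\<theta> / 4 powr q) powr ?e * (\<beta> powr (1 - q)) powr ?e"
      by (rule powr_mult)
    also have "(\<beta> powr (1 - q)) powr ?e = \<beta>"
    proof -
      have "(1 - q) * ?e = 1" using q by (simp add: field_simps)
      then show ?thesis using ab by (simp only: powr_powr) simp
    qed
    also have "(\<theta> / 4 powr q) powr ?e = (4 powr q / \<theta>) powr (1 / (q - 1))"
    proof -
      have "(\<theta> / 4 powr q) powr (1 / (q - 1)) * (4 powr q / \<theta>) powr (1 / (q - 1)) = 1"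
        unfolding powr_mult[symmetric] using \<theta> by simp
      moreover have "(\<theta> / 4 powr q) powr (1 / (q - 1)) > 0" using \<theta> by simp
      ultimately have "1 / (\<theta> / 4 powr q) powr (1 / (q - 1)) = (4 powr q / \<theta>) powr (1 / (q - 1))"
        by (metis less_irrefl nonzero_mult_div_cancel_left)
      then show ?thesis by (simp add: powr_minus_divide)
    qed
    also have "\<dots> * \<beta> \<le> \<Lambda> * (2 powr ((2 * \<eta> + 12 / \<phi> * \<eta>) * m) * card B')"
      using losses cB' ab by (intro mult_mono) auto
    also have "\<dots> = (\<Lambda> * 2 powr ((2 * \<eta> + 12 / \<phi> * \<eta>) * m)) * card B'"
      by (simp only: mult.assoc)
    also note \<Lambda>2
    also have "2 powr ((3 * \<eta> + 12 / \<phi> * \<eta>) * m) * card B' \<le> 2 powr (\<delta> * m) * 2 powr (real D * card ?S)"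
    proof (rule mult_mono)
      have "(3 * \<eta> + 12 / \<phi> * \<eta>) * m \<le> \<delta> * m" using \<eta>\<phi> \<phi> by (intro mult_right_mono) auto
      then show "2 powr ((3 * \<eta> + 12 / \<phi> * \<eta>) * m) \<le> 2 powr (\<delta> * m)" by (rule powr_mono) simp
      have "real (card B') = (\<Prod>k<l. real (\<tau>' k))" by (simp add: cards)
      also have "\<dots> \<le> (\<Prod>k<l. if k \<in> ?S then real_of_int b else 1)"
      proof (intro prod_mono conjI)
        fix k assume k: "k \<in> {..<l}"
        have "real (\<tau>' k) \<le> b" using \<tau>1[of k] k b by (auto simp: \<tau>'_def)
        then show "real (\<tau>' k) \<le> (if k \<in> ?S then real_of_int b else 1)" using dich[of k] k by auto
      qed auto
      also have "\<dots> = (\<Prod>k\<in>{..<l} \<inter> ?S. real_of_int b)" by (rule prod.inter_restrict[symmetric]) simp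
      also have "{..<l} \<inter> ?S = ?S" by auto
      also have "(\<Prod>k\<in>?S. real_of_int b) = 2 powr (real D * card ?S)" by (simp add: br powr_realpow[symmetric] powr_powr)
      finally show "real (card B') \<le> 2 powr (real D * card ?S)" .
    qed auto
    also have "\<dots> = 2 powr (\<delta> * m + real D * card ?S)" by (simp add: powr_add)
    finally have "G powr ?e \<le> 2 powr (\<delta> * m + real D * card ?S)" .
    then have "log 2 (G powr ?e) \<le> \<delta> * m + real D * card ?S" using G0 by (subst log_le_iff) auto
    then show ?thesis by simp
  qed
  have upper: "real D * card ?S \<le> log 2 (F powr (- 1 / (q - 1))) + \<delta> * m"
  proof (cases "\<delta> < 1")
    \<comment> \<open>The threshold is at most 1 and \<open>D * l = m \<le> \<delta> * m\<close>
      already suffices, since \<open>F \<le> 1\<close> makes the logarithm nonnegative.\<close>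
    case False
    have "F \<le> (\<Sum>x\<in>Z. f x)"
      unfolding F_def
    proof (rule sum_mono)
      fix x assume x: "x \<in> Z"
      have "f x \<le> 1" using member_le_sum[OF x, of f] f by (simp add: Z_def)
      then have "f x powr q \<le> f x powr 1" using f(1)[of x] q by (intro powr_mono') auto
      then show "f x powr q \<le> f x" using f(1)[of x] by simp
    qed
    then have "1 powr (- 1 / (q - 1)) \<le> F powr (- 1 / (q - 1))" using f(2) F0 q by (intro powr_mono2') auto
    then have l0: "0 \<le> log 2 (F powr (- 1 / (q - 1)))" using F0 by (subst zero_le_log_cancel_iff) auto
    have "card ?S \<le> l" using card_mono[of "{..<l}" ?S] by auto
    then have "real D * card ?S \<le> m" by (simp add: m_def mult.commute mult_left_mono)
    also have "\<dots> \<le> \<delta> * m" using False by (simp add: mult_le_cancel_right1)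
    finally show ?thesis using l0 by simp
  next
    case True
    let ?e = "- 1 / (q - 1)"
    \<comment> \<open>Capping leaves no branching number between the two thresholds, so a counted
      level is full in the stronger sense.\<close>
    have SS: "real (\<rho> k) \<ge> T" if "k \<in> ?S" for k
      using that cap3[OF True] by (auto simp: \<rho>'_def min_def split: if_splits)
    have "2 powr ((1 - \<phi>) * D * card ?S) = (\<Prod>k\<in>?S. T)" by (simp add: T_def powr_realpow[symmetric] powr_powr)
    also have "\<dots> = (\<Prod>k\<in>{..<l} \<inter> ?S. T)" by (rule arg_cong[of _ _ "prod _"]) auto
    also have "\<dots> = (\<Prod>k<l. if k \<in> ?S then T else 1)" by (rule prod.inter_restrict) simp
    also have "\<dots> \<le> (\<Prod>k<l. real (\<rho> k))"
      using SS \<rho>1(1) by (intro prod_mono) (auto simp: T_def)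
    also have "\<dots> = card A" by (simp add: cards)
    also have "\<dots> \<le> \<alpha>" unfolding \<alpha>_def using AB fin by (intro of_nat_mono card_mono)
    finally have 1: "2 powr ((1 - \<phi>) * D * card ?S) \<le> \<alpha>" .
    have "\<alpha> / \<Lambda> \<le> F powr ?e"
    proof -
      have "(4 powr q / \<theta> * \<alpha> powr (1 - q)) powr ?e \<le> F powr ?e"
        using lp(7) F0 q by (intro powr_mono2') auto
      also have "(4 powr q / \<theta> * \<alpha> powr (1 - q)) powr ?e = (4 powr q / \<theta>) powr ?e * (\<alpha> powr (1 - q)) powr ?e"
        by (rule powr_mult)
      also have "(\<alpha> powr (1 - q)) powr ?e = \<alpha>"
      proof -
        have "(1 - q) * ?e = 1" using q by (simp add: field_simps)
        then show ?thesis using ab by (simp only: powr_powr) simp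
      qed
      also have "(4 powr q / \<theta>) powr ?e = 1 / (4 powr q / \<theta>) powr (1 / (q - 1))"
        by (simp add: powr_minus_divide)
      finally have "1 / (4 powr q / \<theta>) powr (1 / (q - 1)) * \<alpha> \<le> F powr ?e" .
      moreover have "1 / \<Lambda> * \<alpha> \<le> 1 / (4 powr q / \<theta>) powr (1 / (q - 1)) * \<alpha>"
        using losses(1,7) ab \<theta> by (intro mult_right_mono divide_left_mono) auto
      ultimately show ?thesis by simp
    qed
    then have "2 powr ((1 - \<phi>) * D * card ?S) / \<Lambda> \<le> F powr ?e"
      using 1 losses(1) by (meson divide_right_mono order_trans zero_le_one)
    then have "2 powr ((1 - \<phi>) * D * card ?S - \<eta> * m) \<le> F powr ?e" by (simp add: \<Lambda>_def powr_diff)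
    then have 2: "(1 - \<phi>) * D * card ?S - \<eta> * m \<le> log 2 (F powr ?e)" using F0 by (subst le_log_iff) auto
    have "card ?S \<le> l" using card_mono[of "{..<l}" ?S] by auto
    then have "real D * card ?S \<le> m" by (simp add: m_def mult.commute mult_left_mono)
    then have "\<phi> * (real D * card ?S) \<le> \<phi> * m" using \<phi> by (intro mult_left_mono) auto
    moreover have "\<phi> * m + \<eta> * m \<le> \<delta> * m" using \<phi> \<eta>2 unfolding distrib_right[symmetric] by (intro mult_right_mono) auto
    ultimately show ?thesis using 2 by (simp add: algebra_simps)
  qed
  have AL: "c / 2 < f x" "f x \<le> c" if "x \<in> A'" for x
    using that A'(1) AB(1) unfolding A0_def level_def by auto
  have BL: "d / 2 < g x" "g x \<le> d" if "x \<in> B'" for x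
    using that B'(1) AB(2) unfolding B0_def level_def by auto
  have lev2: "f y \<le> 2 * f x" "f x > 0" if "x \<in> A'" "y \<in> A'" for x y
    using AL[OF that(1)] AL[OF that(2)] cd by linarith+
  have lev3: "g y \<le> 2 * g x" "g x > 0" if "x \<in> B'" "y \<in> B'" for x y
    using BL[OF that(1)] BL[OF that(2)] cd by linarith+
  have "A' \<subseteq> Z" "B' \<subseteq> Z" using subs by (auto simp: NZ)
  moreover have "\<forall>x\<in>A'. central b l ((x + tA) mod N)" "\<forall>x\<in>B'. central b l ((x + tB) mod N)" using As Bs A' B' by auto
  ultimately show ?thesis
    using A'(2) B'(2) lev2 lev3 Ai Bi dich lower upper
    by (intro exI[of _ A'] conjI exI[of _ B'] exI[of _ tA] exI[of _ tB] exI[of _ \<rho>'] exI[of _ \<tau>'] allI impI ballI) (assumption | blast)+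
qed

end

section \<open>Transfer to measures on the circle\<close>


definition pt :: "nat \<Rightarrow> int \<Rightarrow> real" where "pt m x = real_of_int x / 2 ^ m"

lemma pt_inj: "pt m x = pt m y \<longleftrightarrow> x = y"
  by (simp add: pt_def)

lemma grid_eq: "grid m = pt m ` {0..<2 ^ m}"
proof (intro equalityI subsetI)
  fix x assume "x \<in> grid m"
  then obtain j where j: "j < (2::nat) ^ m" "x = real j / 2 ^ m" by (auto simp: grid_def)
  have "int j < 2 ^ m" using j(1) of_nat_less_iff[where 'a=int, of j "2 ^ m"] by simp
  then show "x \<in> pt m ` {0..<2 ^ m}" using j(2) by (intro image_eqI[of _ _ "int j"]) (auto simp: pt_def)
next
  fix x assume "x \<in> pt m ` {0..<2 ^ m}"
  then obtain i where i: "0 \<le> i" "i < 2 ^ m" "x = pt m i" by auto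
  have "nat i < 2 ^ m" using i by (simp add: nat_less_iff)
  then show "x \<in> grid m" using i by (auto simp: grid_def pt_def intro!: exI[of _ "nat i"])
qed

lemma sum_grid: "(\<Sum>x\<in>grid m. h x) = (\<Sum>i\<in>{0..<2 ^ m}. h (pt m i))"
  unfolding grid_eq by (subst sum.reindex) (auto simp: inj_on_def pt_inj)

lemma of_int_div_mod: "real_of_int x = real_of_int (x div q) * real_of_int q + real_of_int (x mod q)"
  by (metis div_mult_mod_eq of_int_add of_int_mult)

lemma frac_pt: "frac (pt m x) = pt m (x mod 2 ^ m)"
proof -
  have "pt m x = (real_of_int (x div 2 ^ m) * real_of_int (2 ^ m) + real_of_int (x mod 2 ^ m)) / 2 ^ m"
    unfolding pt_def of_int_div_mod[of x "2 ^ m", symmetric] ..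
  then have e: "pt m x = pt m (x mod 2 ^ m) + real_of_int (x div 2 ^ m)" by (simp add: pt_def add_divide_distrib)
  have "x mod 2 ^ m < 2 ^ m" by simp
  then have "real_of_int (x mod 2 ^ m) < real_of_int (2 ^ m)" by (simp only: of_int_less_iff)
  then have "0 \<le> pt m (x mod 2 ^ m)" "pt m (x mod 2 ^ m) < 1" by (auto simp: pt_def)
  then have "frac (pt m (x mod 2 ^ m)) = pt m (x mod 2 ^ m)" by (simp add: frac_eq)
  then show ?thesis unfolding e by simp
qed

lemma pt_add: "pt m x + pt m y = pt m (x + y)" "pt m x - pt m y = pt m (x - y)"
  by (simp_all add: pt_def add_divide_distrib diff_divide_distrib)

lemma pt_range: "0 \<le> x \<Longrightarrow> x < 2 ^ m \<Longrightarrow> 0 \<le> pt m x \<and> pt m x < 1"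
proof -
  assume a: "0 \<le> x" "x < 2 ^ m"
  then have "real_of_int x < real_of_int (2 ^ m)" by (simp only: of_int_less_iff)
  then show ?thesis using a(1) by (simp add: pt_def)
qed

lemma finite_grid: "finite (grid m)"
  by (simp add: grid_eq)

lemma sum_supp_grid:
  assumes "supp \<mu> \<subseteq> grid m" "\<And>x. \<mu> x = 0 \<Longrightarrow> h x = 0"
  shows "(\<Sum>x\<in>supp \<mu>. h x) = (\<Sum>i\<in>{0..<2 ^ m}. h (pt m i))"
proof -
  have "(\<Sum>x\<in>supp \<mu>. h x) = (\<Sum>x\<in>grid m. h x)"
    using assms finite_grid by (intro sum.mono_neutral_left) (auto simp: supp_def)
  then show ?thesis by (simp add: sum_grid)
qed

lemma qnorm_grid:
  assumes "supp \<mu> \<subseteq> grid m"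
  shows "qnorm q \<mu> = (\<Sum>i\<in>{0..<2 ^ m}. \<mu> (pt m i) powr q) powr (1 / q)"
  unfolding qnorm_def using sum_supp_grid[OF assms, of "\<lambda>x. \<mu> x powr q"] by simp

lemma conv_grid:
  assumes \<mu>: "supp \<mu> \<subseteq> grid m" and \<nu>: "supp \<nu> \<subseteq> grid m" and z: "0 \<le> z" "z < 2 ^ m"
  shows "conv \<mu> \<nu> (pt m z) = (\<Sum>y\<in>{0..<2 ^ m}. \<nu> (pt m y) * \<mu> (pt m ((z - y) mod 2 ^ m)))"
proof -
  let ?Z = "{0..<2 ^ m} :: int set"
  have "conv \<mu> \<nu> (pt m z) = (\<Sum>x\<in>supp \<mu>. \<Sum>j\<in>?Z. if frac (x + pt m j) = pt m z then \<mu> x * \<nu> (pt m j) else 0)"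
    unfolding conv_def by (intro sum.cong refl sum_supp_grid \<nu>) simp
  also have "\<dots> = (\<Sum>i\<in>?Z. \<Sum>j\<in>?Z. if frac (pt m i + pt m j) = pt m z then \<mu> (pt m i) * \<nu> (pt m j) else 0)"
    by (rule sum_supp_grid[OF \<mu>]) (auto intro!: sum.neutral)
  also have "\<dots> = (\<Sum>j\<in>?Z. \<Sum>i\<in>?Z. if frac (pt m i + pt m j) = pt m z then \<mu> (pt m i) * \<nu> (pt m j) else 0)"
    by (rule sum.swap)
  also have "\<dots> = (\<Sum>j\<in>?Z. \<nu> (pt m j) * \<mu> (pt m ((z - j) mod 2 ^ m)))"
  proof (rule sum.cong[OF refl])
    fix j assume j: "j \<in> ?Z"
    have "frac (pt m i + pt m j) = pt m z \<longleftrightarrow> i = (z - j) mod 2 ^ m" if "i \<in> ?Z" for i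
    proof -
      have "frac (pt m i + pt m j) = pt m z \<longleftrightarrow> (i + j) mod 2 ^ m = z" by (simp add: pt_add frac_pt pt_inj)
      also have "\<dots> \<longleftrightarrow> i = (z - j) mod 2 ^ m"
      proof
        assume "(i + j) mod 2 ^ m = z"
        then have "(z - j) mod 2 ^ m = (i + j - j) mod 2 ^ m" by (metis mod_diff_left_eq)
        then show "i = (z - j) mod 2 ^ m" using that by simp
      next
        assume "i = (z - j) mod 2 ^ m"
        then have "(i + j) mod 2 ^ m = (z - j + j) mod 2 ^ m" by (metis mod_add_left_eq)
        then show "(i + j) mod 2 ^ m = z" using z by simp
      qed
      finally show ?thesis .
    qed
    then have "(\<Sum>i\<in>?Z. if frac (pt m i + pt m j) = pt m z then \<mu> (pt m i) * \<nu> (pt m j) else 0)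
      = (\<Sum>i\<in>?Z. if i = (z - j) mod 2 ^ m then \<mu> (pt m i) * \<nu> (pt m j) else 0)"
      by (intro sum.cong) auto
    also have "\<dots> = \<nu> (pt m j) * \<mu> (pt m ((z - j) mod 2 ^ m))"
      by (subst sum.delta) (simp_all add: mult.commute)
    finally show "(\<Sum>i\<in>?Z. if frac (pt m i + pt m j) = pt m z then \<mu> (pt m i) * \<nu> (pt m j) else 0)
      = \<nu> (pt m j) * \<mu> (pt m ((z - j) mod 2 ^ m))" .
  qed
  finally show ?thesis .
qed

lemma supp_conv:
  assumes "supp \<mu> \<subseteq> grid m" "supp \<nu> \<subseteq> grid m"
  shows "supp (conv \<mu> \<nu>) \<subseteq> grid m"
proof
  fix z assume "z \<in> supp (conv \<mu> \<nu>)"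
  then have "conv \<mu> \<nu> z \<noteq> 0" by (simp add: supp_def)
  then have "\<exists>x\<in>supp \<mu>. \<exists>y\<in>supp \<nu>. frac (x + y) = z"
  proof (rule contrapos_np)
    assume "\<not> (\<exists>x\<in>supp \<mu>. \<exists>y\<in>supp \<nu>. frac (x + y) = z)"
    then show "conv \<mu> \<nu> z = 0" unfolding conv_def by (intro sum.neutral ballI) simp
  qed
  then obtain x y where xy: "x \<in> supp \<mu>" "y \<in> supp \<nu>" "frac (x + y) = z" by blast
  then obtain i j where "x = pt m i" "y = pt m j" using assms unfolding grid_eq by blast
  then have "z = pt m ((i + j) mod 2 ^ m)" using xy(3) by (simp add: pt_add frac_pt)
  then show "z \<in> grid m" unfolding grid_eq by auto
qed

lemma translate_pt:
  assumes "0 \<le> i" "i < 2 ^ m"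
  shows "translate (real_of_int t / 2 ^ m) \<mu> (pt m i) = \<mu> (pt m ((i - t) mod 2 ^ m))"
  using pt_range[OF assms] by (simp add: translate_def frac_pt pt_add(2)[of m i t, symmetric, unfolded pt_def[of m t]] flip: frac_pt)

lemma translate_shifted:
  "translate (real_of_int t / 2 ^ m) \<mu> (pt m ((x + t) mod 2 ^ m)) = \<mu> (pt m (x mod 2 ^ m))"
  by (subst translate_pt) (simp_all add: mod_diff_left_eq)

lemma supp_translate:
  assumes "supp \<mu> \<subseteq> grid m"
  shows "supp (translate (real_of_int t / 2 ^ m) \<mu>) \<subseteq> grid m"
proof
  fix x assume "x \<in> supp (translate (real_of_int t / 2 ^ m) \<mu>)"
  then have x: "0 \<le> x" "x < 1" "\<mu> (frac (x - pt m t)) \<noteq> 0" by (auto simp: supp_def translate_def pt_def split: if_splits)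
  then have "frac (x - pt m t) \<in> pt m ` {0..<2 ^ m}" using assms by (auto simp: supp_def grid_eq)
  then obtain i where i: "frac (x - pt m t) = pt m i" by auto
  have "x - pt m t = pt m i + of_int \<lfloor>x - pt m t\<rfloor>" using i by (simp add: frac_def algebra_simps)
  then have "x = pt m (i + t + 2 ^ m * \<lfloor>x - pt m t\<rfloor>)"
    by (simp add: pt_def add_divide_distrib algebra_simps)
  then obtain w where w: "x = pt m w" by blast
  have "x = frac x" using x by (simp add: frac_eq)
  then have "x = pt m (w mod 2 ^ m)" using w by (simp add: frac_pt)
  then show "x \<in> grid m" unfolding grid_eq by auto
qed

lemma pt_scale:
  assumes "s \<le> m"
  shows "2 ^ s * pt m x = real_of_int x / real_of_int (2 ^ (m - s))"
proof -
  have "(2::real) ^ m = 2 ^ s * 2 ^ (m - s)" using assms by (simp flip: power_add)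
  then show ?thesis by (simp add: pt_def)
qed

lemma pt_div:
  assumes "s \<le> m"
  shows "\<lfloor>2 ^ s * pt m x\<rfloor> = x div 2 ^ (m - s)"
proof -
  have "2 ^ s * pt m x = real_of_int x / real_of_int (2 ^ (m - s))" by (rule pt_scale[OF assms])
  then show ?thesis by (simp only: floor_divide_of_int_eq)
qed

lemma dyadic_interval_mem: "y \<in> dyadic_interval s j \<longleftrightarrow> \<lfloor>2 ^ s * y\<rfloor> = j"
  by (auto simp: dyadic_interval_def floor_eq_iff field_simps)

lemma dyadic_interval_inj: "dyadic_interval s i = dyadic_interval s j \<longleftrightarrow> i = j"
proof
  assume e: "dyadic_interval s i = dyadic_interval s j"
  have "real_of_int i / 2 ^ s \<in> dyadic_interval s i" by (simp add: dyadic_interval_mem)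
  then show "i = j" unfolding e by (simp add: dyadic_interval_mem)
qed simp

lemma dyadic_cover_pt:
  assumes "s \<le> m"
  shows "dyadic_cover s (pt m ` X) = dyadic_interval s ` (\<lambda>x. x div 2 ^ (m - s)) ` X"
proof (intro equalityI subsetI)
  fix I assume "I \<in> dyadic_cover s (pt m ` X)"
  then obtain j x where "I = dyadic_interval s j" "x \<in> X" "pt m x \<in> I" by (auto simp: dyadic_cover_def dyadic_family_def)
  then show "I \<in> dyadic_interval s ` (\<lambda>x. x div 2 ^ (m - s)) ` X" using pt_div[OF assms] by (auto simp: dyadic_interval_mem)
next
  fix I assume "I \<in> dyadic_interval s ` (\<lambda>x. x div 2 ^ (m - s)) ` X"
  then obtain x where x: "x \<in> X" "I = dyadic_interval s (x div 2 ^ (m - s))" by auto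
  then have "pt m x \<in> I" using pt_div[OF assms] by (simp add: dyadic_interval_mem)
  then show "I \<in> dyadic_cover s (pt m ` X)" using x by (auto simp: dyadic_cover_def dyadic_family_def)
qed

lemma covering_number_pt:
  assumes "s \<le> m"
  shows "covering_number s (pt m ` X) = card ((\<lambda>x. x div 2 ^ (m - s)) ` X)"
  unfolding covering_number_def dyadic_cover_pt[OF assms]
  by (rule card_image) (auto simp: inj_on_def dyadic_interval_inj)

text \<open>An interval of scale \<open>s * D\<close> is a node of level \<open>l - s\<close>, so
  its children are counted by digit \<open>l - 1 - s\<close>: digits are numbered from the fine end,
  scales from the coarse end.\<close>

lemma reg_covering:
  fixes D l :: nat
  defines "m \<equiv> l * D"
  assumes r: "reg (2 ^ D) l \<rho> X" and s: "s < l" and I: "I \<in> dyadic_cover (s * D) (pt m ` X)"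
  shows "covering_number ((s + 1) * D) (pt m ` X \<inter> I) = \<rho> (l - 1 - s)"
proof -
  define k where "k = l - 1 - s"
  have k: "k < l" "l - s = Suc k" "l - (s + 1) = k" using s by (auto simp: k_def)
  have sm: "s * D \<le> m" "(s + 1) * D \<le> m" using s by (auto simp: m_def intro: mult_right_mono simp del: mult_Suc)
  have e1: "(2::int) ^ (m - s * D) = (2 ^ D) ^ Suc k"
    unfolding m_def diff_mult_distrib[symmetric] k(2) by (simp only: power_mult[symmetric] mult.commute)
  have e2: "(2::int) ^ (m - (s + 1) * D) = (2 ^ D) ^ k"
    unfolding m_def diff_mult_distrib[symmetric] k(3) by (simp only: power_mult[symmetric] mult.commute)
  obtain x where x: "x \<in> X" "I = dyadic_interval (s * D) (x div (2 ^ D) ^ Suc k)"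
    using I unfolding dyadic_cover_pt[OF sm(1)] e1 by auto
  have "pt m ` X \<inter> I = pt m ` {y \<in> X. y div (2 ^ D) ^ Suc k = x div (2 ^ D) ^ Suc k}"
    unfolding x(2) using pt_div[OF sm(1)] unfolding e1 by (auto simp: dyadic_interval_mem simp del: power_Suc)
  then have "covering_number ((s + 1) * D) (pt m ` X \<inter> I)
      = card ((\<lambda>y. y div (2 ^ D) ^ k) ` {y \<in> X. y div (2 ^ D) ^ Suc k = x div (2 ^ D) ^ Suc k})"
    using covering_number_pt[OF sm(2)] unfolding e2 by simp
  also have "\<dots> = \<rho> k" using r x(1) k(1) by (simp add: reg_def del: power_Suc)
  finally show ?thesis by (simp add: k_def)
qed

text \<open>Scaling by \<open>2 ^ s\<close> turns the interval into \<open>[j, j + 1)\<close>. Both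
  ends follow the half-open convention of \<open>central\<close>.\<close>

lemma half_dyadic_interval:
  "y \<in> half_interval (dyadic_interval s j) \<longleftrightarrow> 4 * real_of_int j + 1 \<le> 4 * (2 ^ s * y) \<and> 4 * (2 ^ s * y) < 4 * real_of_int j + 3"
proof -
  have e: "dyadic_interval s j = {real_of_int j / 2 ^ s..<(real_of_int j + 1) / 2 ^ s}" by (auto simp: dyadic_interval_def)
  have lt: "real_of_int j / 2 ^ s < (real_of_int j + 1) / 2 ^ s" by (simp add: divide_strict_right_mono)
  have IS: "Inf (dyadic_interval s j) = real_of_int j / 2 ^ s" "Sup (dyadic_interval s j) = (real_of_int j + 1) / 2 ^ s"
    unfolding e using lt by simp_all
  have hs: "(3 * Inf (dyadic_interval s j) + Sup (dyadic_interval s j)) / 4 = (4 * real_of_int j + 1) / (4 * 2 ^ s)"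
    "(Inf (dyadic_interval s j) + 3 * Sup (dyadic_interval s j)) / 4 = (4 * real_of_int j + 3) / (4 * 2 ^ s)"
    unfolding IS by (simp_all add: add_divide_distrib)
  show ?thesis unfolding half_interval_def mem_Collect_eq hs by (simp add: pos_divide_le_eq pos_less_divide_eq mult_ac)
qed

lemma central_half_interval:
  fixes D l :: nat
  defines "m \<equiv> l * D"
  assumes c: "central (2 ^ D) l x" and s: "s < l"
  shows "pt m x \<in> half_interval (dyadic_of (s * D) (pt m x))"
proof -
  define k where "k = l - 1 - s"
  have k: "k < l" "l - s = Suc k" using s by (auto simp: k_def)
  have sm: "s * D \<le> m" using s by (auto simp: m_def intro: mult_right_mono)
  define Q :: int where "Q = (2 ^ D) ^ Suc k"
  have Q: "Q > 0" by (simp add: Q_def)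
  have e1: "(2::int) ^ (m - s * D) = Q" unfolding Q_def
    unfolding m_def diff_mult_distrib[symmetric] k(2) by (simp only: power_mult[symmetric] mult.commute)
  have "2 ^ (s * D) * pt m x = real_of_int x / real_of_int (2 ^ (m - s * D))" by (rule pt_scale[OF sm])
  then have px: "2 ^ (s * D) * pt m x = real_of_int x / Q" unfolding e1 .
  have "real_of_int x / Q = (real_of_int (x div Q) * real_of_int Q + real_of_int (x mod Q)) / Q"
    unfolding of_int_div_mod[of x Q, symmetric] ..
  then have d: "real_of_int x / Q = real_of_int (x div Q) + real_of_int (x mod Q) / Q" using Q by (simp add: add_divide_distrib)
  have "Q \<le> 4 * (x mod Q)" "4 * (x mod Q) < 3 * Q" using c k(1) unfolding central_def Q_def by auto
  then have "real_of_int Q \<le> real_of_int (4 * (x mod Q))" "real_of_int (4 * (x mod Q)) < real_of_int (3 * Q)"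
    by (simp_all only: of_int_le_iff of_int_less_iff)
  then have "1 \<le> 4 * (real_of_int (x mod Q) / Q)" "4 * (real_of_int (x mod Q) / Q) < 3" using Q by (simp_all add: field_simps)
  moreover have "\<lfloor>2 ^ (s * D) * pt m x\<rfloor> = x div Q" using pt_div[OF sm] unfolding e1 .
  ultimately show ?thesis unfolding dyadic_of_def half_dyadic_interval px d by (simp add: distrib_left)
qed

text \<open>The conjugate exponent divided by \<open>q\<close> is \<open>1 / (q - 1)\<close>, which
  is why this power of the sum appears on the integer side.\<close>

lemma powr_qnorm:
  assumes "0 < q" "0 \<le> X"
  shows "(X powr (1 / q)) powr (- conj_exp q) = X powr (- 1 / (q - 1))"
  using assms by (simp add: powr_powr conj_exp_def)

text \<open>A rotation permutes the grid, so norms and masses after translation can be evaluated on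
  the original integer sets.\<close>

lemma translated_set:
  fixes \<mu> :: "real \<Rightarrow> real" and t :: int and m :: nat and A :: "int set"
  assumes \<mu>: "supp \<mu> \<subseteq> grid m" and A: "A \<subseteq> {0..<2 ^ m}" and pos: "\<forall>x\<in>A. \<mu> (pt m x) > 0"
  defines "\<mu>' \<equiv> translate (real_of_int t / 2 ^ m) \<mu>" and "E \<equiv> pt m ` (\<lambda>x. (x + t) mod 2 ^ m) ` A"
  shows "E \<subseteq> supp \<mu>'"
    and "\<forall>x\<in>A. \<forall>y\<in>A. \<mu> (pt m y) \<le> 2 * \<mu> (pt m x) \<Longrightarrow> \<forall>x\<in>E. \<forall>y\<in>E. \<mu>' y \<le> 2 * \<mu>' x"
    and "qnorm q \<mu>' = qnorm q \<mu>"
    and "qnorm q (restr \<mu>' E) = (\<Sum>x\<in>A. \<mu> (pt m x) powr q) powr (1 / q)"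
    and "mass \<mu>' E = (\<Sum>x\<in>A. \<mu> (pt m x))"
proof -
  let ?Z = "{0..<2 ^ m} :: int set"
  define p where "p x = pt m ((x + t) mod 2 ^ m)" for x
  have E: "E = p ` A" unfolding E_def p_def image_image ..
  have inj: "inj_on p A"
  proof (rule inj_onI)
    fix x y assume "x \<in> A" "y \<in> A" "p x = p y"
    then have "x \<in> ?Z" "y \<in> ?Z" "(x + t) mod 2 ^ m = (y + t) mod 2 ^ m" using A by (auto simp: p_def pt_inj)
    then show "x = y" using inj_onD[OF bij_betw_imp_inj_on[OF bij_betw_add_mod[of "2 ^ m" t]], of x y] by simp
  qed
  have val: "\<mu>' (p x) = \<mu> (pt m x)" if "x \<in> A" for x
    using that A unfolding \<mu>'_def p_def translate_shifted by (auto simp: subset_iff)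
  show sub: "E \<subseteq> supp \<mu>'" using val pos unfolding E supp_def by force
  show "\<forall>x\<in>E. \<forall>y\<in>E. \<mu>' y \<le> 2 * \<mu>' x" if "\<forall>x\<in>A. \<forall>y\<in>A. \<mu> (pt m y) \<le> 2 * \<mu> (pt m x)"
    using that val unfolding E by auto
  have s': "supp \<mu>' \<subseteq> grid m" unfolding \<mu>'_def by (rule supp_translate[OF \<mu>])
  have "(\<Sum>i\<in>?Z. \<mu>' (pt m i) powr q) = (\<Sum>i\<in>?Z. \<mu> (pt m ((i + - t) mod 2 ^ m)) powr q)"
    unfolding \<mu>'_def by (intro sum.cong) (auto simp: translate_pt)
  also have "\<dots> = (\<Sum>i\<in>?Z. \<mu> (pt m i) powr q)"
    using sum.reindex_bij_betw[OF bij_betw_add_mod[of "2 ^ m" "- t"], of "\<lambda>i. \<mu> (pt m i) powr q"] by simp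
  finally show "qnorm q \<mu>' = qnorm q \<mu>" unfolding qnorm_grid[OF s'] qnorm_grid[OF \<mu>] by simp
  have fin: "finite E" unfolding E using A finite_subset by blast
  have sr: "supp (restr \<mu>' E) = E" using sub by (auto simp: supp_def restr_def)
  have "(\<Sum>x\<in>supp (restr \<mu>' E). restr \<mu>' E x powr q) = (\<Sum>x\<in>E. \<mu>' x powr q)"
    unfolding sr by (intro sum.cong) (auto simp: restr_def)
  also have "\<dots> = (\<Sum>x\<in>A. \<mu> (pt m x) powr q)" unfolding E using inj val by (simp add: sum.reindex)
  finally show "qnorm q (restr \<mu>' E) = (\<Sum>x\<in>A. \<mu> (pt m x) powr q) powr (1 / q)" unfolding qnorm_def by simp
  have "E \<inter> supp \<mu>' = E" using sub by blast
  then have "mass \<mu>' E = (\<Sum>x\<in>E. \<mu>' x)" by (simp add: mass_def)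
  also have "\<dots> = (\<Sum>x\<in>A. \<mu> (pt m x))" unfolding E using inj val by (simp add: sum.reindex)
  finally show "mass \<mu>' E = (\<Sum>x\<in>A. \<mu> (pt m x))" .
qed

section \<open>Choice of the parameters\<close>


text \<open>\<open>M\<close> will be \<open>2 ^ p\<close>, so that a proportion \<open>1 / M\<close>
  is at most \<open>\<eta>\<close>. \<open>D\<close> is chosen after it, when all constants built
  from \<open>P\<close> are fixed and lose against \<open>2 ^ D\<close>. The condition
  \<open>D \<ge> 2 * p + 3\<close> serves to bound \<open>8 * n\<close> by
  \<open>2 ^ (D * (2 * M + 1))\<close>.\<close>

lemma ex_scale_parameters:
  fixes \<eta> :: real and D0 :: nat
  assumes \<eta>: "0 < \<eta>"
  shows "\<exists>p D. 1 / 2 ^ p \<le> \<eta> \<and> D \<ge> D0 \<and> D \<ge> 2 \<and> D \<ge> 2 * p + 3 \<and> 1 \<le> \<eta> * D \<and> 4 * (real D + 1) \<le> 2 powr (\<eta> * D) \<and>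
    (let P = (2::nat) ^ p * 2 ^ p in
      (2 * (2 * real P * D) * P + 2 * (2 * real P * D) + 5) * (4 * (1 + (2 * real P * D) * P) + 1) \<le> 2 ^ D)"
proof -
  obtain p :: nat where p: "1 / \<eta> < 2 ^ p" using real_arch_pow[of 2 "1 / \<eta>"] by auto
  define c where "c = real ((2::nat) ^ p * 2 ^ p)"
  have c: "c > 0" by (simp add: c_def)
  have "\<forall>\<^sub>F D in sequentially. (2 * (2 * c * real D) * c + 2 * (2 * c * real D) + 5) * (4 * (1 + (2 * c * real D) * c) + 1) \<le> 2 ^ D"
    using c by real_asymp
  moreover have "\<forall>\<^sub>F D in sequentially. 4 * (real D + 1) \<le> 2 powr (\<eta> * real D)" using \<eta> by real_asymp
  moreover have "\<forall>\<^sub>F D in sequentially. 1 \<le> \<eta> * real D" using \<eta> by real_asymp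
  moreover have "\<forall>\<^sub>F D in sequentially. D \<ge> max D0 (max 2 (2 * p + 3))" by (rule eventually_ge_at_top)
  ultimately have "\<forall>\<^sub>F D in sequentially. (2 * (2 * c * real D) * c + 2 * (2 * c * real D) + 5) * (4 * (1 + (2 * c * real D) * c) + 1) \<le> 2 ^ D \<and>
      4 * (real D + 1) \<le> 2 powr (\<eta> * real D) \<and> 1 \<le> \<eta> * real D \<and> D \<ge> max D0 (max 2 (2 * p + 3))"
    by eventually_elim simp
  then obtain D where "(2 * (2 * c * real D) * c + 2 * (2 * c * real D) + 5) * (4 * (1 + (2 * c * real D) * c) + 1) \<le> 2 ^ D"
      "4 * (real D + 1) \<le> 2 powr (\<eta> * real D)" "1 \<le> \<eta> * real D" "D \<ge> max D0 (max 2 (2 * p + 3))"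
    by (auto simp: eventually_sequentially)
  moreover have "1 / 2 ^ p \<le> \<eta>" using p \<eta> by (simp add: field_simps)
  ultimately show ?thesis unfolding Let_def c_def by (intro exI[of _ p] exI[of _ D]) auto
qed

lemma eventually_poly_le_exp:
  fixes c q :: real
  assumes c: "c > 0" and q: "q > 0"
  shows "\<forall>\<^sub>F x in sequentially. 2 * 2 powr q * (9 * (real x)\<^sup>2) powr (q + 1) \<le> 2 powr (c * real x)"
proof -
  \<comment> \<open>Half of the exponent pays for the constants, the other half for the
    polynomial.\<close>
  define e where "e = c * ln 2 / 2"
  have e: "e > 0" using c by (simp add: e_def)
  define d where "d = e / (q + 1)"
  have d: "d > 0" "(q + 1) * d = e" using e q by (simp_all add: d_def)
  have "\<forall>\<^sub>F x in sequentially. ln (9 * (real x)\<^sup>2) \<le> d * real x" using d(1) by real_asymp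
  moreover have "\<forall>\<^sub>F x in sequentially. x \<ge> nat \<lceil>(q + 1) * ln 2 / e\<rceil>" by (rule eventually_ge_at_top)
  moreover have "\<forall>\<^sub>F x in sequentially. x \<ge> (1::nat)" by (rule eventually_ge_at_top)
  ultimately show ?thesis
  proof eventually_elim
    case (elim x)
    have "(q + 1) * ln 2 / e \<le> real x" using elim(2) by (simp add: nat_le_iff ceiling_le_iff)
    then have 1: "(q + 1) * ln 2 \<le> e * real x" using e by (simp add: divide_le_eq mult.commute)
    have 2: "(q + 1) * ln (9 * (real x)\<^sup>2) \<le> e * real x"
      using mult_left_mono[OF elim(1), of "q + 1"] q d(2) by (simp add: mult.assoc[symmetric])
    have "2 * 2 powr q * (9 * (real x)\<^sup>2) powr (q + 1) = exp ((q + 1) * ln 2 + (q + 1) * ln (9 * (real x)\<^sup>2))"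
    proof -
      have "2 * 2 powr q = (2::real) powr (q + 1)" by (simp add: powr_add)
      then show ?thesis using elim(3) by (simp add: powr_def exp_add)
    qed
    also have "\<dots> \<le> exp (e * real x + e * real x)" using 1 2 by simp
    also have "\<dots> = 2 powr (c * real x)" by (simp add: powr_def e_def field_simps)
    finally show ?case .
  qed
qed

lemma ex_parameters:
  fixes q \<delta> :: real and D0 :: nat
  assumes q: "1 < q" and \<delta>: "0 < \<delta>"
  shows "\<exists>\<epsilon>>0. \<exists>D\<ge>D0. \<exists>M L j. \<forall>l\<ge>L. parameters D M q \<delta> \<epsilon> l j"
proof -
  define \<phi> \<eta> where "\<phi> = min \<delta> 1 / 2" and "\<eta> = \<phi>\<^sup>2 / 20"
  have \<eta>: "\<eta> > 0" using \<delta> by (simp add: \<phi>_def \<eta>_def min_def)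
  obtain p D where pD: "1 / 2 ^ p \<le> \<eta>" "D \<ge> D0" "D \<ge> 2" "D \<ge> 2 * p + 3" "1 \<le> \<eta> * D" "4 * (real D + 1) \<le> 2 powr (\<eta> * D)"
    and large: "(let P = (2::nat) ^ p * 2 ^ p in
      (2 * (2 * real P * D) * P + 2 * (2 * real P * D) + 5) * (4 * (1 + (2 * real P * D) * P) + 1) \<le> 2 ^ D)"
    using ex_scale_parameters[OF \<eta>, of D0] by auto
  \<comment> \<open>A power of 2, so that \<open>n\<close> is one as well: doubling only reaches
    walks of \<open>2 ^ Suc j\<close> steps.\<close>
  define M :: nat where "M = 2 ^ p"
  define P where "P = M * M"
  define n where "n = P * (2 ^ D) ^ (2 * M)"
  define j where "j = 2 * p + D * (2 * M) - 1"
  have M: "M \<ge> 1" by (simp add: M_def)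
  have nj: "n = 2 ^ Suc j"
  proof -
    have "D * (2 * M) \<ge> 1" using M pD(3) by simp
    then have "Suc j = p + p + D * (2 * M)" by (simp add: j_def)
    then show ?thesis by (simp only: n_def P_def M_def power_add power_mult)
  qed
  have n0: "real n > 0" by (simp add: nj)
  define q' where "q' = q / (q - 1)"
  have q': "q' > 0" using q by (simp add: q'_def)
  \<comment> \<open>In the exponent of \<open>(2 / r)\<^sup>2\<close> the coefficient of
    \<open>m\<close> is \<open>4 * n * q' * q * \<epsilon>\<close>, which this choice keeps at most
    \<open>\<eta> / 2\<close>; the constant part is \<open>C1\<close> and is absorbed for large
    \<open>l\<close>.\<close>
  define \<epsilon> where "\<epsilon> = min (1/2) (\<eta> / (8 * n * q' * q))"
  have \<epsilon>: "\<epsilon> > 0" "\<epsilon> \<le> 1/2" "4 * n * q' * q * \<epsilon> \<le> \<eta> / 2"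
  proof -
    have pos: "8 * n * q' * q > 0" using n0 q' q by simp
    then show "\<epsilon> > 0" "\<epsilon> \<le> 1/2" using \<eta> by (auto simp: \<epsilon>_def)
    have "\<epsilon> \<le> \<eta> / (8 * n * q' * q)" by (simp add: \<epsilon>_def)
    then show "4 * n * q' * q * \<epsilon> \<le> \<eta> / 2" using pos by (simp add: field_simps)
  qed
  have "\<epsilon> * q > 0" using \<epsilon> q by simp
  then have "\<forall>\<^sub>F x in sequentially. 2 * 2 powr q * (9 * (real x)\<^sup>2) powr (q + 1) \<le> 2 powr ((\<epsilon> * q) * real x)"
    using q by (intro eventually_poly_le_exp) auto
  then obtain m0 where m0: "\<And>x. x \<ge> m0 \<Longrightarrow> 2 * 2 powr q * (9 * (real x)\<^sup>2) powr (q + 1) \<le> 2 powr ((\<epsilon> * q) * real x)"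
    by (auto simp: eventually_sequentially)
  define C1 where "C1 = 2 + 2 * n + 2 * n * q' * (2 * q + 1)"
  define L where "L = max (max 6 m0) (max (nat \<lceil>2 * C1 / \<eta>\<rceil>) (max (nat \<lceil>(2 * real n + 3) / \<eta>\<rceil>) (nat \<lceil>real P / \<eta>\<rceil>)))"
  have "parameters D M q \<delta> \<epsilon> l j" if l: "l \<ge> L" for l
  proof -
    define m where "m = l * D"
    have ml: "m \<ge> l" using pD(3) by (simp add: m_def)
    have lb: "l \<ge> 6" "l \<ge> m0" "real l \<ge> 2 * C1 / \<eta>" "real l \<ge> (2 * real n + 3) / \<eta>" "real l \<ge> real P / \<eta>"
      using l unfolding L_def by (auto simp: le_max_iff_disj nat_le_iff ceiling_le_iff)
    have \<eta>l: "2 * C1 \<le> \<eta> * l" "2 * real n + 3 \<le> \<eta> * l" "real P \<le> \<eta> * l"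
      using lb(3-5) \<eta> by (simp_all add: divide_le_eq mult.commute)
    have \<eta>m: "\<eta> * l \<le> \<eta> * m" using ml \<eta> by (intro mult_left_mono) auto
    define \<theta> where "\<theta> = 2 powr (- 2 * \<epsilon> * m * q)"
    define \<sigma> where "\<sigma> = (\<theta> / 4 powr q / 2) powr (1 / (q - 1)) * (\<theta> / 4 powr q / 2)"
    define r where "r = (\<sigma>\<^sup>2 / 4) ^ (2 ^ j)"
    \<comment> \<open>All losses become powers of 2. Since \<open>1 / (q - 1) + 1 = q'\<close>, the
      energy constant \<open>\<sigma>\<close> has exponent \<open>- (q' * v)\<close>.\<close>
    define v where "v = 2 * \<epsilon> * m * q + 2 * q + 1"
    have u: "\<theta> / 4 powr q / 2 = 2 powr (- v)"
    proof -
      have "(4::real) powr q = 2 powr (2 * q)" by (simp add: powr_powr[symmetric])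
      then have "\<theta> / 4 powr q / 2 = 2 powr (- 2 * \<epsilon> * m * q) / 2 powr (2 * q) / 2 powr 1" by (simp add: \<theta>_def)
      also have "\<dots> = 2 powr (- 2 * \<epsilon> * m * q - 2 * q - 1)" by (simp only: powr_diff)
      also have "- 2 * \<epsilon> * m * q - 2 * q - 1 = - v" by (simp add: v_def)
      finally show ?thesis .
    qed
    have \<sigma>: "\<sigma> = 2 powr (- (q' * v))"
    proof -
      have "\<sigma> = 2 powr (- v * (1 / (q - 1)) + - v)" unfolding \<sigma>_def u powr_powr powr_add ..
      also have "- v * (1 / (q - 1)) + - v = - (q' * v)" using q by (simp add: q'_def field_simps)
      finally show ?thesis .
    qed
    have r: "(2 / r)\<^sup>2 = 2 powr (2 + n * (2 + 2 * (q' * v)))"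
    proof -
      have "\<sigma>\<^sup>2 / 4 = \<sigma> * \<sigma> / 2 powr 2" by (simp add: power2_eq_square)
      also have "\<dots> = 2 powr (- (2 + 2 * (q' * v)))"
        unfolding \<sigma> powr_add[symmetric] powr_diff[symmetric] by (rule arg_cong[of _ _ "\<lambda>x. 2 powr x"]) simp
      finally have "r = 2 powr (- (2 + 2 * (q' * v)) * real (2 ^ j))" unfolding r_def by (simp only: powr_power mult.commute)
      then have "2 / r = 2 powr 1 / 2 powr (- (2 + 2 * (q' * v)) * real (2 ^ j))" by simp
      also have "\<dots> = 2 powr (1 + (2 + 2 * (q' * v)) * real (2 ^ j))"
        unfolding powr_diff[symmetric] by (rule arg_cong[of _ _ "\<lambda>x. 2 powr x"]) (simp add: algebra_simps)
      finally have r2: "2 / r = 2 powr (1 + (2 + 2 * (q' * v)) * real (2 ^ j))" .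
      have "(2 / r)\<^sup>2 = 2 powr ((1 + (2 + 2 * (q' * v)) * real (2 ^ j)) * 2)"
        unfolding r2 power2_eq_square powr_add[symmetric] by (rule arg_cong[of _ _ "\<lambda>x. 2 powr x"]) simp
      also have "(1 + (2 + 2 * (q' * v)) * real (2 ^ j)) * 2 = 2 + n * (2 + 2 * (q' * v))" by (simp add: nj algebra_simps)
      finally show ?thesis .
    qed
    have r_loss: "(2 / r)\<^sup>2 \<le> 2 powr (\<eta> * m)"
    proof -
      have "2 + n * (2 + 2 * (q' * v)) = C1 + (4 * n * q' * q * \<epsilon>) * m"
        by (simp add: C1_def v_def algebra_simps)
      also have "\<dots> \<le> \<eta> * m / 2 + \<eta> / 2 * m"
        using \<eta>l(1) \<eta>m \<epsilon>(3) by (intro add_mono mult_right_mono) auto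
      also have "\<dots> = \<eta> * m" by simp
      finally show ?thesis unfolding r by (intro powr_mono) auto
    qed
    have n_loss: "2 * real n + 3 \<le> 2 powr (\<eta> * m)"
    proof -
      have "2 * real n + 3 = real (2 * n + 3)" by simp
      also have "\<dots> \<le> real (2 ^ (2 * n + 3))" using less_exp[of "2 * n + 3"] by (intro of_nat_mono) simp
      also have "\<dots> = 2 powr real (2 * n + 3)" by (subst powr_realpow) auto
      also have "\<dots> \<le> 2 powr (\<eta> * m)" using \<eta>l(2) \<eta>m by (intro powr_mono) auto
      finally show ?thesis .
    qed
    have ldiv: "real (l div P) * P \<le> l" by (simp flip: of_nat_mult)
    have Mr: "real M > 0" "1 \<le> \<eta> * M" using M pD(1) by (auto simp: M_def field_simps)
    \<comment> \<open>\<open>M\<close> levels out of the \<open>M * M\<close> in a block are a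
      proportion \<open>1 / M \<le> \<eta>\<close>; both the carries and the missed levels are of
      this order.\<close>
    have lM: "real (l div P) * M \<le> \<eta> * l"
    proof -
      have "real (l div P) * M * 1 \<le> real (l div P) * M * (\<eta> * M)" using Mr by (intro mult_left_mono) auto
      also have "\<dots> = \<eta> * (real (l div P) * P)" by (simp add: P_def)
      also have "\<dots> \<le> \<eta> * l" using ldiv \<eta> by (intro mult_left_mono) auto
      finally show ?thesis by simp
    qed
    have carry: "((2 ^ D) ^ (2 * M + 1) * (2 * real n + 3)) ^ (l div P) \<le> 2 powr (6 * \<eta> * m)"
    proof -
      have "2 * n + 3 \<le> 8 * n" using nj by simp
      also have "\<dots> = 2 ^ (3 + Suc j)" by (simp add: nj power_add)
      also have "\<dots> \<le> 2 ^ (D * (2 * M + 1))"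
        using pD(4) M pD(3) by (intro power_increasing) (auto simp: j_def)
      finally have "real (2 * n + 3) \<le> real (2 ^ (D * (2 * M + 1)))" by (rule of_nat_mono)
      then have "2 * real n + 3 \<le> 2 ^ (D * (2 * M + 1))" by simp
      then have "(2 ^ D) ^ (2 * M + 1) * (2 * real n + 3) \<le> 2 ^ (D * (2 * M + 1)) * 2 ^ (D * (2 * M + 1))"
        unfolding power_mult[symmetric] by (intro mult_left_mono) auto
      also have "\<dots> = 2 ^ (D * (4 * M + 2))" by (simp only: power_add[symmetric]) (simp add: algebra_simps)
      finally have "((2 ^ D) ^ (2 * M + 1) * (2 * real n + 3)) ^ (l div P) \<le> (2 ^ (D * (4 * M + 2))) ^ (l div P)"
        by (intro power_mono) auto
      also have "\<dots> = 2 ^ (D * (4 * M + 2) * (l div P))" by (simp only: power_mult[symmetric])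
      also have "\<dots> = 2 powr real (D * (4 * M + 2) * (l div P))" by (subst powr_realpow) auto
      also have "\<dots> \<le> 2 powr (6 * \<eta> * m)"
      proof (rule powr_mono)
        have "D * (4 * M + 2) * (l div P) \<le> D * (6 * M) * (l div P)" using M by (intro mult_right_mono mult_left_mono) auto
        then have "real (D * (4 * M + 2) * (l div P)) \<le> real (D * (6 * M) * (l div P))" by (rule of_nat_mono)
        also have "\<dots> = 6 * D * (real (l div P) * M)" by simp
        also have "\<dots> \<le> 6 * D * (\<eta> * l)" using lM by (intro mult_left_mono) auto
        finally show "real (D * (4 * M + 2) * (l div P)) \<le> 6 * \<eta> * m" by (simp add: m_def mult_ac)
      qed simp
      finally show ?thesis .
    qed
    have unf: "real D * ((l div P) * (2 * M) + P) \<le> 3 * \<eta> * m"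
    proof -
      have "real ((l div P) * (2 * M) + P) = 2 * (real (l div P) * M) + P" by simp
      also have "\<dots> \<le> 2 * (\<eta> * l) + \<eta> * l" using lM \<eta>l(3) by (intro add_mono mult_left_mono) auto
      finally have "real D * real ((l div P) * (2 * M) + P) \<le> real D * (2 * (\<eta> * l) + \<eta> * l)" by (intro mult_left_mono) auto
      then show ?thesis by (simp add: m_def algebra_simps)
    qed
    have reg_loss: "(4 * (real D + 1)) ^ l \<le> 2 powr (\<eta> * m)"
    proof -
      have "(4 * (real D + 1)) ^ l \<le> (2 powr (\<eta> * D)) ^ l" using pD(6) by (intro power_mono) auto
      also have "\<dots> = 2 powr (\<eta> * m)" by (simp add: powr_power m_def mult_ac)
      finally show ?thesis .
    qed
    have two_loss: "2 ^ l \<le> 2 powr (\<eta> * m)"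
    proof -
      have "1 * real l \<le> (\<eta> * D) * l" using pD(5) by (intro mult_right_mono) auto
      then have "real l \<le> \<eta> * m" by (simp add: m_def mult_ac)
      then have "2 powr real l \<le> 2 powr (\<eta> * m)" by (intro powr_mono) auto
      then show ?thesis by (simp add: powr_realpow)
    qed
    have lev: "2 * 2 powr q * (9 * (real m)\<^sup>2) powr (q + 1) \<le> 2 powr (\<epsilon> * m * q)"
      using m0[of m] ml lb(2) by (simp add: mult_ac)
    have lg: "(2 * (2 * real P * D) * P + 2 * (2 * real P * D) + 5) * (4 * (1 + (2 * real P * D) * P) + 1) \<le> 2 ^ D"
      using large unfolding Let_def P_def M_def .
    have scales: "scales D M" by unfold_locales (use pD(3) M lg in \<open>simp_all add: P_def\<close>)
    have m6: "6 \<le> l * D" using ml lb(1) unfolding m_def by linarith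
    note defs = \<theta>_def[unfolded m_def] \<sigma>_def r_def \<eta>_def[unfolded \<phi>_def] n_def[unfolded P_def]
    have "parameters_axioms D M q \<delta> \<epsilon> l j"
      unfolding parameters_axioms_def
      using q \<delta> \<epsilon>(1,2) nj[unfolded defs] m6 lev[unfolded m_def] reg_loss[unfolded m_def defs] two_loss[unfolded m_def defs]
        r_loss[unfolded m_def defs] n_loss[unfolded m_def defs] carry[unfolded m_def P_def defs] unf[unfolded m_def P_def defs]
      by (simp only: of_int_power of_int_numeral simp_thms)
    then show ?thesis using scales unfolding parameters_def by blast
  qed
  then show ?thesis using \<epsilon>(1) pD(2) by blast
qed

theorem mainTheorem7:
  fixes q \<delta> :: real and D0 :: nat
  assumes "1 < q" and "0 < \<delta>"
  shows "\<exists>\<epsilon>>0. \<exists>D\<ge>D0. \<exists>L. \<forall>l\<ge>L. \<forall>\<mu> \<nu>.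
    dyadic_measure (l * D) \<mu> \<longrightarrow> dyadic_measure (l * D) \<nu> \<longrightarrow>
    qnorm q (conv \<mu> \<nu>) \<ge> 2 powr (- \<epsilon> * real (l * D)) * qnorm q \<mu> \<longrightarrow>
    (\<exists>k1 k2 :: int. \<exists>A B. \<exists>R' R'' :: nat \<Rightarrow> nat.
      let m = l * D;
          \<mu>' = translate (real_of_int k1 / 2 ^ m) \<mu>;
          \<nu>' = translate (real_of_int k2 / 2 ^ m) \<nu>;
          S = {s. s < l \<and> real (R' s) \<ge> 2 powr ((1 - \<delta>) * D)}
      in A \<subseteq> supp \<mu>' \<and> B \<subseteq> supp \<nu>'
       \<and> qnorm q (restr \<mu>' A) \<ge> 2 powr (- \<delta> * m) * qnorm q \<mu>'
       \<and> (\<forall>x\<in>A. \<forall>y\<in>A. \<mu>' y \<le> 2 * \<mu>' x)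
       \<and> (\<forall>s<l. \<forall>I\<in>dyadic_cover (s * D) A. covering_number ((s + 1) * D) (A \<inter> I) = R' s)
       \<and> (\<forall>x\<in>A. \<forall>s<l. x \<in> half_interval (dyadic_of (s * D) x))
       \<and> mass \<nu>' B \<ge> 2 powr (- \<delta> * m)
       \<and> (\<forall>x\<in>B. \<forall>y\<in>B. \<nu>' y \<le> 2 * \<nu>' x)
       \<and> (\<forall>s<l. \<forall>I\<in>dyadic_cover (s * D) B. covering_number ((s + 1) * D) (B \<inter> I) = R'' s)
       \<and> (\<forall>y\<in>B. \<forall>s<l. y \<in> half_interval (dyadic_of (s * D) y))
       \<and> (\<forall>s<l. R'' s = 1 \<or> real (R' s) \<ge> 2 powr ((1 - \<delta>) * D))
       \<and> log 2 (qnorm q \<nu> powr (- conj_exp q)) - \<delta> * m \<le> real D * real (card S)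
       \<and> real D * real (card S) \<le> log 2 (qnorm q \<mu> powr (- conj_exp q)) + \<delta> * m)"
proof -
  obtain \<epsilon> D M L j where par: "\<epsilon> > 0" "D \<ge> D0" "\<And>l. l \<ge> L \<Longrightarrow> parameters D M q \<delta> \<epsilon> l j"
    using ex_parameters[OF assms, of D0] by blast
  show ?thesis
  proof (rule exI[of _ \<epsilon>], rule conjI[OF par(1)], rule exI[of _ D], rule conjI[OF par(2)], rule exI[of _ L],
      intro allI impI)
    fix l \<mu> \<nu>
    assume l: "l \<ge> L" and \<mu>: "dyadic_measure (l * D) \<mu>" and \<nu>: "dyadic_measure (l * D) \<nu>"
      and conv: "qnorm q (conv \<mu> \<nu>) \<ge> 2 powr (- \<epsilon> * real (l * D)) * qnorm q \<mu>"
    define m where "m = l * D"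
    let ?Z = "{0..<2 ^ m} :: int set"
    define f g where "f i = \<mu> (pt m i)" and "g i = \<nu> (pt m i)" for i
    define F G where "F = (\<Sum>x\<in>?Z. f x powr q)" and "G = (\<Sum>x\<in>?Z. g x powr q)"
    have s: "supp \<mu> \<subseteq> grid m" "supp \<nu> \<subseteq> grid m" using \<mu> \<nu> by (auto simp: dyadic_measure_def m_def)
    have f: "\<And>x. 0 \<le> f x" "(\<Sum>x\<in>?Z. f x) = 1" and g: "\<And>x. 0 \<le> g x" "(\<Sum>x\<in>?Z. g x) = 1"
      using \<mu> \<nu> by (auto simp: dyadic_measure_def m_def[symmetric] sum_grid f_def g_def)
    have FG: "F \<ge> 0" "G \<ge> 0" by (auto simp: F_def G_def intro!: sum_nonneg)
    have nF: "qnorm q \<mu> = F powr (1 / q)" and nG: "qnorm q \<nu> = G powr (1 / q)"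
      using qnorm_grid[OF s(1)] qnorm_grid[OF s(2)] by (auto simp: F_def G_def f_def g_def)
    define H where "H = (\<Sum>z\<in>?Z. (\<Sum>y\<in>?Z. g y * f ((z - y) mod 2 ^ m)) powr q)"
    have H0: "H \<ge> 0" unfolding H_def by (intro sum_nonneg) simp
    have "qnorm q (conv \<mu> \<nu>) = H powr (1 / q)"
      unfolding qnorm_grid[OF supp_conv[OF s]] H_def f_def g_def using conv_grid[OF s]
      by (intro arg_cong[of _ _ "\<lambda>x. x powr (1 / q)"] sum.cong) auto
    then have "2 powr (- \<epsilon> * m) * F powr (1 / q) \<le> H powr (1 / q)" using conv nF by (simp add: m_def)
    then have "(2 powr (- \<epsilon> * m) * F powr (1 / q)) powr q \<le> (H powr (1 / q)) powr q"
      using assms by (intro powr_mono2) auto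
    then have H: "2 powr (- \<epsilon> * m * q) * F \<le> H"
      using assms(1) FG H0 by (simp add: powr_mult powr_powr)
    obtain A B tA tB \<rho> \<tau> where A: "A \<subseteq> ?Z" and B: "B \<subseteq> ?Z"
      and As: "reg (2 ^ D) l \<rho> ((\<lambda>x. (x + tA) mod 2 ^ m) ` A)" "\<forall>x\<in>A. central (2 ^ D) l ((x + tA) mod 2 ^ m)"
      and Bs: "reg (2 ^ D) l \<tau> ((\<lambda>x. (x + tB) mod 2 ^ m) ` B)" "\<forall>x\<in>B. central (2 ^ D) l ((x + tB) mod 2 ^ m)"
      and fA: "\<forall>x\<in>A. f x > 0" "\<forall>x\<in>A. \<forall>y\<in>A. f y \<le> 2 * f x" and gB: "\<forall>x\<in>B. g x > 0" "\<forall>x\<in>B. \<forall>y\<in>B. g y \<le> 2 * g x"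
      and Ai: "2 powr (- \<delta> * m * q) * F \<le> (\<Sum>x\<in>A. f x powr q)" and Bi: "2 powr (- \<delta> * m) \<le> (\<Sum>x\<in>B. g x)"
      and dich: "\<forall>k<l. \<tau> k = 1 \<or> real (\<rho> k) \<ge> 2 powr ((1 - \<delta>) * D)"
      and lower: "log 2 (G powr (- 1 / (q - 1))) - \<delta> * m \<le> real D * card {k. k < l \<and> real (\<rho> k) \<ge> 2 powr ((1 - \<delta>) * D)}"
      and upper: "real D * card {k. k < l \<and> real (\<rho> k) \<ge> 2 powr ((1 - \<delta>) * D)} \<le> log 2 (F powr (- 1 / (q - 1))) + \<delta> * m"
      using parameters.integer_structure[OF par(3)[OF l], of f g, folded m_def, OF f g H[unfolded F_def H_def], folded F_def G_def]
      by (elim exE conjE) (rule that, assumption+)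
    \<comment> \<open>Scale \<open>s\<close> counts from the root, whereas digit indices count from
      the leaves.\<close>
    define R' R'' where "R' s = \<rho> (l - 1 - s)" and "R'' s = \<tau> (l - 1 - s)" for s
    define EA EB where "EA = pt m ` (\<lambda>x. (x + tA) mod 2 ^ m) ` A" and "EB = pt m ` (\<lambda>x. (x + tB) mod 2 ^ m) ` B"
    note TA = translated_set[OF s(1) A fA(1)[unfolded f_def], where t = tA, folded EA_def f_def]
    note TB = translated_set[OF s(2) B gB(1)[unfolded g_def], where t = tB, folded EB_def g_def]
    have cS: "card {s. s < l \<and> real (R' s) \<ge> 2 powr ((1 - \<delta>) * D)} = card {k. k < l \<and> real (\<rho> k) \<ge> 2 powr ((1 - \<delta>) * D)}"
      by (rule bij_betw_same_card[of "\<lambda>s. l - 1 - s"], rule bij_betw_byWitness[of _ "\<lambda>s. l - 1 - s"]) (auto simp: R'_def)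
    have q0: "0 < q" using assms by simp
    have cA: "2 powr (- \<delta> * m) * qnorm q \<mu> \<le> qnorm q (restr (translate (real_of_int tA / 2 ^ m) \<mu>) EA)"
    proof -
      have "2 powr (- \<delta> * m) * qnorm q \<mu> = (2 powr (- \<delta> * m * q) * F) powr (1 / q)"
        unfolding nF using q0 by (simp add: powr_mult powr_powr)
      also have "\<dots> \<le> (\<Sum>x\<in>A. f x powr q) powr (1 / q)" using Ai FG q0 by (intro powr_mono2) auto
      finally show ?thesis using TA(4) by simp
    qed
    show "\<exists>k1 k2 :: int. \<exists>A B. \<exists>R' R'' :: nat \<Rightarrow> nat.
      let m = l * D;
          \<mu>' = translate (real_of_int k1 / 2 ^ m) \<mu>;
          \<nu>' = translate (real_of_int k2 / 2 ^ m) \<nu>;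
          S = {s. s < l \<and> real (R' s) \<ge> 2 powr ((1 - \<delta>) * D)}
      in A \<subseteq> supp \<mu>' \<and> B \<subseteq> supp \<nu>'
       \<and> qnorm q (restr \<mu>' A) \<ge> 2 powr (- \<delta> * m) * qnorm q \<mu>'
       \<and> (\<forall>x\<in>A. \<forall>y\<in>A. \<mu>' y \<le> 2 * \<mu>' x)
       \<and> (\<forall>s<l. \<forall>I\<in>dyadic_cover (s * D) A. covering_number ((s + 1) * D) (A \<inter> I) = R' s)
       \<and> (\<forall>x\<in>A. \<forall>s<l. x \<in> half_interval (dyadic_of (s * D) x))
       \<and> mass \<nu>' B \<ge> 2 powr (- \<delta> * m)
       \<and> (\<forall>x\<in>B. \<forall>y\<in>B. \<nu>' y \<le> 2 * \<nu>' x)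
       \<and> (\<forall>s<l. \<forall>I\<in>dyadic_cover (s * D) B. covering_number ((s + 1) * D) (B \<inter> I) = R'' s)
       \<and> (\<forall>y\<in>B. \<forall>s<l. y \<in> half_interval (dyadic_of (s * D) y))
       \<and> (\<forall>s<l. R'' s = 1 \<or> real (R' s) \<ge> 2 powr ((1 - \<delta>) * D))
       \<and> log 2 (qnorm q \<nu> powr (- conj_exp q)) - \<delta> * m \<le> real D * real (card S)
       \<and> real D * real (card S) \<le> log 2 (qnorm q \<mu> powr (- conj_exp q)) + \<delta> * m"
      unfolding Let_def m_def[symmetric]
    proof (rule exI[of _ tA], rule exI[of _ tB], rule exI[of _ EA], rule exI[of _ EB], rule exI[of _ R'], rule exI[of _ R''],
        intro conjI)
      show "EA \<subseteq> supp (translate (real_of_int tA / 2 ^ m) \<mu>)" by (rule TA(1))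
      show "EB \<subseteq> supp (translate (real_of_int tB / 2 ^ m) \<nu>)" by (rule TB(1))
      show "2 powr (- \<delta> * m) * qnorm q (translate (real_of_int tA / 2 ^ m) \<mu>) \<le> qnorm q (restr (translate (real_of_int tA / 2 ^ m) \<mu>) EA)"
        unfolding TA(3) by (rule cA)
      show "\<forall>x\<in>EA. \<forall>y\<in>EA. translate (real_of_int tA / 2 ^ m) \<mu> y \<le> 2 * translate (real_of_int tA / 2 ^ m) \<mu> x"
        by (rule TA(2)[OF fA(2)])
      show "\<forall>x\<in>EB. \<forall>y\<in>EB. translate (real_of_int tB / 2 ^ m) \<nu> y \<le> 2 * translate (real_of_int tB / 2 ^ m) \<nu> x"
        by (rule TB(2)[OF gB(2)])
      show "\<forall>s<l. \<forall>I\<in>dyadic_cover (s * D) EA. covering_number ((s + 1) * D) (EA \<inter> I) = R' s"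
        using reg_covering[OF As(1)] unfolding EA_def m_def R'_def by blast
      show "\<forall>s<l. \<forall>I\<in>dyadic_cover (s * D) EB. covering_number ((s + 1) * D) (EB \<inter> I) = R'' s"
        using reg_covering[OF Bs(1)] unfolding EB_def m_def R''_def by blast
      show "\<forall>x\<in>EA. \<forall>s<l. x \<in> half_interval (dyadic_of (s * D) x)"
        using As(2) central_half_interval unfolding EA_def m_def by auto
      show "\<forall>x\<in>EB. \<forall>s<l. x \<in> half_interval (dyadic_of (s * D) x)"
        using Bs(2) central_half_interval unfolding EB_def m_def by auto
      show "2 powr (- \<delta> * m) \<le> mass (translate (real_of_int tB / 2 ^ m) \<nu>) EB"
        unfolding TB(5) by (rule Bi)
      show "\<forall>s<l. R'' s = 1 \<or> real (R' s) \<ge> 2 powr ((1 - \<delta>) * D)"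
        using dich unfolding R'_def R''_def by auto
      show "log 2 (qnorm q \<nu> powr (- conj_exp q)) - \<delta> * m \<le> real D * real (card {s. s < l \<and> real (R' s) \<ge> 2 powr ((1 - \<delta>) * D)})"
        unfolding cS nG powr_qnorm[OF q0 FG(2)] by (rule lower)
      show "real D * real (card {s. s < l \<and> real (R' s) \<ge> 2 powr ((1 - \<delta>) * D)}) \<le> log 2 (qnorm q \<mu> powr (- conj_exp q)) + \<delta> * m"
        unfolding cS nF powr_qnorm[OF q0 FG(1)] by (rule upper)
    qed
  qed
qed

end
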